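(* Let $n\geq2$ and $\frac n2\leq p<2n$. Let $\varepsilon>0$ be the smallness constant for global existence, i.e. a constant such that for all initial data $(v_0,w_0)\in\dot B^{-2+n/p}_{p,\infty}(\mathbb{R}^n)$ with $\|(v_0,w_0)\|_{\dot B^{-2+n/p}_{p,\infty}}\leq\varepsilon$ the Debye-Hückel system $$\begin{cases}\partial_t v=\nabla\cdot(\nabla v-v\nabla\phi) & \text{in } \mathbb{R}^n\times(0,\infty),\\ \partial_t w=\nabla\cdot(\nabla w+w\nabla\phi) & \text{in } \mathbb{R}^n\times(0,\infty),\\ \Delta\phi=v-w & \text{in } \mathbb{R}^n\times(0,\infty),\\ v(x,0)=v_0(x),\quad w(x,0)=w_0(x) & \text{in } \mathbb{R}^n\end{cases}$$ has a unique global solution $(v,w)\in\bigcap_{1<r\leq\infty}\mathfrak{L}^r(0,\infty;\dot B^{-2+n/p+2/r}_{p,\infty}(\mathbb{R}^n))$. Suppose that $(v_0,w_0)\in\dot B^{-2+n/p}_{p,\infty}(\mathbb{R}^n)$ and $\|(v_0,w_0)\|_{\dot B^{-2+n/p}_{p,\infty}}\leq\varepsilon$. Suppose furthermore that $v_0,w_0$ are homogeneous of degree $-2$, i.e., $v_0(x)=\lambda^2v_0(\lambda x)$ and $w_0(x)=\lambda^2w_0(\lambda x)$ for all $x\in\mathbb{R}^n$ and $\lambda>0$. Then this unique global solution is self-similar, i.e., for all $\lambda>0$, $$v(x,t)=\lambda^2v(\lambda x,\lambda^2t),\quad w(x,t)=\lambda^2w(\lambda x,\lambda^2t),\quad \phi(x,t)=\phi(\lambda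 x,\lambda^2t).$$
   Context: For a Banach space $\mathcal{X}$, $(v,w)\in\mathcal{X}$ means $(v,w)\in\mathcal{X}\times\mathcal{X}$, and $\|(v,w)\|_{\mathcal X}$ is the product norm. Meaning of the system: $\phi$ is eliminated by $\phi=(-\Delta)^{-1}(w-v):=E*(w-v)$, where $E(x)=-\frac{1}{2\pi}\log|x|$ for $n=2$ and $E(x)=\frac14\pi^{-n/2}\Gamma(\frac n2-1)|x|^{-(n-2)}$ for $n\geq3$. The problem is considered in the equivalent form $$\partial_t v-\Delta v=-\nabla\cdot(v\nabla(-\Delta)^{-1}(w-v)),\quad \partial_t w-\Delta w=\nabla\cdot(w\nabla(-\Delta)^{-1}(w-v)),\quad v(x,0)=v_0(x),\ w(x,0)=w_0(x),$$ which is understood through the Duhamel integral equations $$v(t)=e^{t\Delta}v_0-\int_0^t e^{(t-\tau)\Delta}\nabla\cdot(v\nabla(-\Delta)^{-1}(w-v))(\tau)\,d\tau,\quad w(t)=e^{t\Delta}w_0+\int_0^t e^{(t-\tau)\Delta}\nabla\cdot(w\nabla(-\Delta)^{-1}(w-v))(\tau)\,d\tau,$$ where $e^{t\Delta}$ is the heat operator with kernel $(4\pi t)^{-n/2}\exp(-|x|^2/(4t))$. Function spaces: $\mathcal{S}(\mathbb{R}^n)$ is the Schwartz space, and $\hat f(\xi)=(2\pi)^{-n/2}\int_{\mathbb{R}^n} f(x)e^{-ix\cdot\xi}dx$. Let $\mathcal{Z}(\mathbb{R}^n)=\{f\in\mathcal{S}(\mathbb{R}^n):\partial^\alpha\hat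 f(0)=0\ \forall\alpha\in(\mathbb{N}\cup\{0\})^n\}$ and let $\mathcal{Z}'(\mathbb{R}^n)$ be its dual. Fix non-negative $\psi,\varphi\in\mathcal{S}(\mathbb{R}^n)$ with $\operatorname{supp}\psi\subset\{|\xi|\leq\frac43\}$, $\operatorname{supp}\varphi\subset\{\frac34\leq|\xi|\leq\frac83\}$, $\psi(\xi)+\sum_{j\geq0}\varphi(2^{-j}\xi)=1$ for all $\xi\in\mathbb{R}^n$ and $\sum_{j\in\mathbb{Z}}\varphi(2^{-j}\xi)=1$ for $\xi\neq0$. Set $\Delta_jf=\varphi(2^{-j}D)f$, i.e. $\widehat{\Delta_jf}(\xi)=\varphi(2^{-j}\xi)\hat f(\xi)$. For $s\in\mathbb{R}$, $1\leq p\leq\infty$, the homogeneous Besov space $\dot B^s_{p,\infty}(\mathbb{R}^n)$ is the set of $f\in\mathcal{Z}'(\mathbb{R}^n)$ with $\|f\|_{\dot B^s_{p,\infty}}=\sup_{j\in\mathbb{Z}}2^{js}\|\Delta_jf\|_{L^p}<\infty$. For $0<T\leq\infty$, $1\leq r\leq\infty$, the Chemin-Lerner space $\mathfrak{L}^r(0,T;\dot B^s_{p,\infty}(\mathbb{R}^n))$ is the set of $f\in\mathcal{D}'((0,T),\mathcal{Z}'(\mathbb{R}^n))$ with $\|f\|_{\mathfrak{L}^r(0,T;\dot B^s_{p,\infty})}=\sup_{j\in\mathbb{Z}}2^{js}\|\Delta_jf\|_{L^r(0,T;L^p)}<\infty$. *)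

theory Defs
  imports "HOL-Analysis.Analysis" "HOL-Probability.Essential_Supremum"
begin

text \<open>
  Throughout, \<open>'a\<close> is the space variable, \<open>\<real>\<^sup>n\<close> with \<open>n = DIM('a)\<close>. Functions and distributions
  are complex valued. A distribution is a functional on functions; it is set to \<open>0\<close> outside its
  space of test functions, so that equality of distributions is equality in HOL.
\<close>

section \<open>Test functions\<close>

definition dpart :: "'a::euclidean_space \<Rightarrow> ('a \<Rightarrow> complex) \<Rightarrow> 'a \<Rightarrow> complex" where
  "dpart b f = (\<lambda>x. frechet_derivative f (at x) b)"

text \<open>A multi-index is rendered as a list of basis vectors.\<close>

definition dparts :: "'a::euclidean_space list \<Rightarrow> ('a \<Rightarrow> complex) \<Rightarrow> 'a \<Rightarrow> complex" where
  "dparts bs f = foldr dpart bs f"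

definition smooth_fun :: "('a::euclidean_space \<Rightarrow> complex) \<Rightarrow> bool" where
  "smooth_fun f \<longleftrightarrow> (\<forall>bs x. set bs \<subseteq> Basis \<longrightarrow> dparts bs f differentiable (at x))"

definition schwartz :: "('a::euclidean_space \<Rightarrow> complex) set" where
  "schwartz = {f. smooth_fun f \<and>
     (\<forall>bs k. set bs \<subseteq> Basis \<longrightarrow> bounded (range (\<lambda>x. of_real ((1 + norm x) ^ k) * dparts bs f x)))}"

definition schwartz_seminorm :: "nat \<Rightarrow> ('a::euclidean_space \<Rightarrow> complex) \<Rightarrow> real" where
  "schwartz_seminorm N f =
     (SUP (bs, x) \<in> {bs. set bs \<subseteq> Basis \<and> length bs \<le> N} \<times> UNIV.
        (1 + norm x) ^ N * cmod (dparts bs f x))"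

definition fourier :: "('a::euclidean_space \<Rightarrow> complex) \<Rightarrow> 'a \<Rightarrow> complex" where
  "fourier f \<xi> = of_real ((2 * pi) powr (- real DIM('a) / 2)) *
     (LINT x|lborel. f x * exp (- \<i> * of_real (x \<bullet> \<xi>)))"

definition fourier_inv :: "('a::euclidean_space \<Rightarrow> complex) \<Rightarrow> 'a \<Rightarrow> complex" where
  "fourier_inv f x = of_real ((2 * pi) powr (- real DIM('a) / 2)) *
     (LINT \<xi>|lborel. f \<xi> * exp (\<i> * of_real (x \<bullet> \<xi>)))"

definition Z_test :: "('a::euclidean_space \<Rightarrow> complex) set" where
  "Z_test = {f \<in> schwartz. \<forall>bs. set bs \<subseteq> Basis \<longrightarrow> dparts bs (fourier f) 0 = 0}"

definition smooth_supp_in :: "real set \<Rightarrow> (real \<Rightarrow> complex) set" where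
  "smooth_supp_in K = {\<eta>. smooth_fun \<eta> \<and> (\<forall>t. t \<notin> K \<longrightarrow> \<eta> t = 0)}"

definition D_test :: "real set \<Rightarrow> (real \<Rightarrow> complex) set" where
  "D_test I = (\<Union>K \<in> {K. compact K \<and> K \<subseteq> I}. smooth_supp_in K)"

section \<open>Distributions\<close>

definition lin_on :: "('b \<Rightarrow> complex) set \<Rightarrow> (('b \<Rightarrow> complex) \<Rightarrow> complex) \<Rightarrow> bool" where
  "lin_on X u \<longleftrightarrow> (\<forall>f\<in>X. \<forall>g\<in>X. \<forall>c d. u (\<lambda>x. c * f x + d * g x) = c * u f + d * u g)"

type_synonym 'a distr = "('a \<Rightarrow> complex) \<Rightarrow> complex"

definition Z_dual :: "('a::euclidean_space) distr set" where
  "Z_dual = {u. lin_on Z_test u \<and>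
     (\<exists>N C. \<forall>f\<in>Z_test. cmod (u f) \<le> C * schwartz_seminorm N f) \<and>
     (\<forall>f. f \<notin> Z_test \<longrightarrow> u f = 0)}"

text \<open>
  \<open>\<D>'(I, \<Z>')\<close>: linear maps from \<open>\<D>(I)\<close> to \<open>\<Z>'\<close> that are continuous on the functions supported in any
  fixed compact \<open>K \<subseteq> I\<close>. On those functions, the Schwartz seminorms are equivalent to the \<open>C\<^sup>N\<close> norms.
\<close>

type_synonym 'a tdistr = "(real \<Rightarrow> complex) \<Rightarrow> 'a distr"

definition Z_distributions :: "real set \<Rightarrow> ('a::euclidean_space) tdistr set" where
  "Z_distributions I = {U.
     (\<forall>\<eta>\<in>D_test I. U \<eta> \<in> Z_dual) \<and>
     (\<forall>\<zeta>\<in>Z_test. lin_on (D_test I) (\<lambda>\<eta>. U \<eta> \<zeta>)) \<and>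
     (\<forall>K. compact K \<and> K \<subseteq> I \<longrightarrow> (\<forall>\<zeta>\<in>Z_test. \<exists>N C. \<forall>\<eta>\<in>smooth_supp_in K.
        cmod (U \<eta> \<zeta>) \<le> C * schwartz_seminorm N \<eta>)) \<and>
     (\<forall>\<eta>. \<eta> \<notin> D_test I \<longrightarrow> U \<eta> = (\<lambda>_. 0))}"

section \<open>Littlewood-Paley decomposition\<close>

definition dyadic_partition :: "real \<Rightarrow> real \<Rightarrow> ('a::euclidean_space \<Rightarrow> real) \<Rightarrow> bool" where
  "dyadic_partition a b \<theta> \<longleftrightarrow>
     (\<lambda>\<xi>. complex_of_real (\<theta> \<xi>)) \<in> schwartz \<and> (\<forall>\<xi>. 0 \<le> \<theta> \<xi>) \<and>
     closure {\<xi>. \<theta> \<xi> \<noteq> 0} \<subseteq> {\<xi>. a \<le> norm \<xi> \<and> norm \<xi> \<le> b} \<and>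
     (\<forall>\<xi>. \<xi> \<noteq> 0 \<longrightarrow> ((\<lambda>j::int. \<theta> (2 powi (- j) *\<^sub>R \<xi>)) has_sum 1) UNIV)"

definition littlewood_paley :: "('a::euclidean_space \<Rightarrow> real) \<Rightarrow> ('a \<Rightarrow> real) \<Rightarrow> bool" where
  "littlewood_paley \<psi> \<phi> \<longleftrightarrow>
     (\<lambda>\<xi>. complex_of_real (\<psi> \<xi>)) \<in> schwartz \<and> (\<forall>\<xi>. 0 \<le> \<psi> \<xi>) \<and>
     closure {\<xi>. \<psi> \<xi> \<noteq> 0} \<subseteq> {\<xi>. norm \<xi> \<le> 4/3} \<and>
     dyadic_partition (3/4) (8/3) \<phi> \<and>
     (\<forall>\<xi>. ((\<lambda>j::nat. \<phi> ((1/2) ^ j *\<^sub>R \<xi>)) has_sum (1 - \<psi> \<xi>)) UNIV)"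

text \<open>
  \<open>\<Delta>\<^sub>j u = \<phi>(2\<^sup>-\<^sup>j D) u\<close> as a tempered distribution: as \<open>\<langle>u^, \<zeta>\<rangle> = \<langle>u, \<zeta>^\<rangle>\<close>, one has
  \<open>\<langle>\<Delta>\<^sub>j u, \<zeta>\<rangle> = \<langle>\<phi>(2\<^sup>-\<^sup>j \<cdot>) u^, F\<^sup>-\<^sup>1 \<zeta>\<rangle> = \<langle>u, F (\<phi>(2\<^sup>-\<^sup>j \<cdot>) F\<^sup>-\<^sup>1 \<zeta>)\<rangle>\<close>. The argument of \<open>u\<close> lies in \<open>\<Z>\<close> for each
  Schwartz function \<open>\<zeta>\<close>, since \<open>\<phi>\<close> vanishes near \<open>0\<close>.
\<close>

definition lp_block :: "('a::euclidean_space \<Rightarrow> real) \<Rightarrow> int \<Rightarrow> 'a distr \<Rightarrow> 'a distr" where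
  "lp_block \<phi> j u =
     (\<lambda>\<zeta>. if \<zeta> \<in> schwartz
          then u (fourier (\<lambda>\<xi>. of_real (\<phi> (2 powi (- j) *\<^sub>R \<xi>)) * fourier_inv \<zeta> \<xi>)) else 0)"

section \<open>Homogeneous Besov spaces and Chemin-Lerner spaces\<close>

definition epowr :: "ennreal \<Rightarrow> real \<Rightarrow> ennreal" where
  "epowr x a = (if x = \<infinity> then \<infinity> else ennreal (enn2real x powr a))"

definition Lp_norm :: "ennreal \<Rightarrow> 'b measure \<Rightarrow> ('b \<Rightarrow> ennreal) \<Rightarrow> ennreal" where
  "Lp_norm p M f =
     (if p = \<infinity> then esssup M f
      else epowr (\<integral>\<^sup>+ x. epowr (f x) (enn2real p) \<partial>M) (1 / enn2real p))"

definition represented_by :: "('a::euclidean_space) distr \<Rightarrow> ('a \<Rightarrow> complex) \<Rightarrow> bool" where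
  "represented_by T g \<longleftrightarrow> g \<in> borel_measurable lborel \<and>
     (\<forall>\<zeta>\<in>schwartz. integrable lborel (\<lambda>x. g x * \<zeta> x) \<and> T \<zeta> = (LINT x|lborel. g x * \<zeta> x))"

text \<open>
  The norm of a distribution in \<open>L\<^sup>p\<close>. The function is unique up to null sets if it exists, and the
  infimum of the empty set is \<open>\<infinity>\<close>.
\<close>

definition distr_Lp_norm :: "ennreal \<Rightarrow> ('a::euclidean_space) distr \<Rightarrow> ennreal" where
  "distr_Lp_norm p T = Inf {Lp_norm p lborel (\<lambda>x. ennreal (cmod (g x))) | g. represented_by T g}"

definition besov_norm ::
    "('a::euclidean_space \<Rightarrow> real) \<Rightarrow> real \<Rightarrow> ennreal \<Rightarrow> 'a distr \<Rightarrow> ennreal" where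
  "besov_norm \<phi> s p u =
     (SUP j::int. ennreal (2 powr (real_of_int j * s)) * distr_Lp_norm p (lp_block \<phi> j u))"

definition besov :: "('a::euclidean_space \<Rightarrow> real) \<Rightarrow> real \<Rightarrow> ennreal \<Rightarrow> 'a distr set" where
  "besov \<phi> s p = {u \<in> Z_dual. besov_norm \<phi> s p u < \<infinity>}"

definition time_interval :: "ereal \<Rightarrow> real set" where
  "time_interval T = {t. 0 < t \<and> ereal t < T}"

definition trepresented_by ::
    "real set \<Rightarrow> ('a::euclidean_space) tdistr \<Rightarrow> (real \<Rightarrow> 'a \<Rightarrow> complex) \<Rightarrow> bool" where
  "trepresented_by I U g \<longleftrightarrow> case_prod g \<in> borel_measurable (lborel \<Otimes>\<^sub>M lborel) \<and>
     (\<forall>\<eta>\<in>D_test I. \<forall>\<zeta>\<in>schwartz.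
        integrable (lborel \<Otimes>\<^sub>M lborel) (\<lambda>(t, x). g t x * \<eta> t * \<zeta> x) \<and>
        U \<eta> \<zeta> = (LINT (t, x)|(lborel \<Otimes>\<^sub>M lborel). g t x * \<eta> t * \<zeta> x))"

definition distr_LrLp_norm ::
    "real set \<Rightarrow> ennreal \<Rightarrow> ennreal \<Rightarrow> ('a::euclidean_space) tdistr \<Rightarrow> ennreal" where
  "distr_LrLp_norm I r p U =
     Inf {Lp_norm r (restrict_space lborel I)
            (\<lambda>t. Lp_norm p lborel (\<lambda>x. ennreal (cmod (g t x)))) | g. trepresented_by I U g}"

definition chemin_lerner_norm ::
    "('a::euclidean_space \<Rightarrow> real) \<Rightarrow> ereal \<Rightarrow> ennreal \<Rightarrow> real \<Rightarrow> ennreal \<Rightarrow> 'a tdistr \<Rightarrow> ennreal" where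
  "chemin_lerner_norm \<phi> T r s p U =
     (SUP j::int. ennreal (2 powr (real_of_int j * s)) *
        distr_LrLp_norm (time_interval T) r p (\<lambda>\<eta>. lp_block \<phi> j (U \<eta>)))"

definition chemin_lerner ::
    "('a::euclidean_space \<Rightarrow> real) \<Rightarrow> ereal \<Rightarrow> ennreal \<Rightarrow> real \<Rightarrow> ennreal \<Rightarrow> 'a tdistr set" where
  "chemin_lerner \<phi> T r s p =
     {U \<in> Z_distributions (time_interval T). chemin_lerner_norm \<phi> T r s p U < \<infinity>}"

section \<open>Operators on distributions, defined by duality\<close>

definition Z_restrict :: "('a::euclidean_space) distr \<Rightarrow> 'a distr" where
  "Z_restrict u = (\<lambda>\<zeta>. if \<zeta> \<in> Z_test then u \<zeta> else 0)"

definition conv :: "('a::euclidean_space \<Rightarrow> real) \<Rightarrow> ('a \<Rightarrow> complex) \<Rightarrow> 'a \<Rightarrow> complex" where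
  "conv k \<zeta> x = (LINT y|lborel. of_real (k (x - y)) * \<zeta> y)"

definition laplace_kernel :: "'a::euclidean_space \<Rightarrow> real" where
  "laplace_kernel x =
     (if DIM('a) = 2 then - (1 / (2 * pi)) * ln (norm x)
      else 1/4 * pi powr (- real DIM('a) / 2) * Gamma (real DIM('a) / 2 - 1) *
           norm x powr (- (real DIM('a) - 2)))"

definition heat_kernel :: "real \<Rightarrow> 'a::euclidean_space \<Rightarrow> real" where
  "heat_kernel t x = (4 * pi * t) powr (- real DIM('a) / 2) * exp (- (norm x)\<^sup>2 / (4 * t))"

text \<open>Both kernels are even, so convolution with them is its own transpose.\<close>

definition inv_neg_laplace :: "('a::euclidean_space) distr \<Rightarrow> 'a distr" where
  "inv_neg_laplace u = Z_restrict (\<lambda>\<zeta>. u (conv laplace_kernel \<zeta>))"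

definition heat :: "real \<Rightarrow> ('a::euclidean_space) distr \<Rightarrow> 'a distr" where
  "heat t u = Z_restrict (\<lambda>\<zeta>. u (conv (heat_kernel t) \<zeta>))"

definition dderiv :: "'a::euclidean_space \<Rightarrow> 'a distr \<Rightarrow> 'a distr" where
  "dderiv b u = Z_restrict (\<lambda>\<zeta>. - u (dpart b \<zeta>))"

definition ddiv :: "('a::euclidean_space \<Rightarrow> 'a distr) \<Rightarrow> 'a distr" where
  "ddiv F = (\<lambda>\<zeta>. \<Sum>b\<in>Basis. dderiv b (F b) \<zeta>)"

text \<open>
  The product of two elements of \<open>\<Z>'\<close> in the sense of Bony, \<open>u v = \<Sum>\<^sub>j\<^sub>,\<^sub>k \<Delta>\<^sub>j u \<Delta>\<^sub>k v\<close> (this series comprises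
  the two paraproducts and the remainder), unconditionally convergent in \<open>\<Z>'\<close> (weakly). As usual,
  the product is not to depend on the dyadic partition of unity used to compute it.
\<close>

definition is_product :: "('a::euclidean_space) distr \<Rightarrow> 'a distr \<Rightarrow> 'a distr \<Rightarrow> bool" where
  "is_product u v P \<longleftrightarrow> P \<in> Z_dual \<and>
     (\<forall>\<theta> a b. 0 < a \<and> a < b \<and> dyadic_partition a b \<theta> \<longrightarrow>
        (\<exists>f g. (\<forall>j. represented_by (lp_block \<theta> j u) (f j)) \<and>
               (\<forall>k. represented_by (lp_block \<theta> k v) (g k)) \<and>
               (\<forall>\<zeta>\<in>Z_test.
                  (\<forall>j k. integrable lborel (\<lambda>x. f j x * g k x * \<zeta> x)) \<and>
                  ((\<lambda>(j::int, k::int). LINT x|lborel. f j x * g k x * \<zeta> x) has_sum P \<zeta>) UNIV)))"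

section \<open>The Debye-Hueckel system\<close>

text \<open>
  \<open>U \<in> \<D>'((0,\<infinity>), \<Z>')\<close> is given by the weakly measurable, weakly locally integrable \<open>\<Z>'\<close>-valued
  function \<open>u\<close> of time. Every element of a Chemin-Lerner space is of this form.
\<close>

definition time_slices :: "('a::euclidean_space) tdistr \<Rightarrow> (real \<Rightarrow> 'a distr) \<Rightarrow> bool" where
  "time_slices U u \<longleftrightarrow> (\<forall>t>0. u t \<in> Z_dual) \<and>
     (\<forall>\<eta>\<in>D_test {0<..}. \<forall>\<zeta>\<in>Z_test.
        set_integrable lborel {0<..} (\<lambda>t. \<eta> t * u t \<zeta>) \<and>
        U \<eta> \<zeta> = (LINT t:{0<..}|lborel. \<eta> t * u t \<zeta>))"

definition potential_slice :: "('a::euclidean_space) distr \<Rightarrow> 'a distr \<Rightarrow> 'a distr" where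
  "potential_slice v w = inv_neg_laplace (\<lambda>\<zeta>. w \<zeta> - v \<zeta>)"

text \<open>
  The Duhamel equations as identities in \<open>\<Z>'\<close> for almost every \<open>t > 0\<close>, with weak integrals in
  \<open>\<tau>\<close>; \<open>F\<close> and \<open>G\<close> are the vector fields \<open>v \<nabla>(-\<Delta>)\<^sup>-\<^sup>1(w - v)\<close> and \<open>w \<nabla>(-\<Delta>)\<^sup>-\<^sup>1(w - v)\<close>.
\<close>

definition duhamel_system ::
    "('a::euclidean_space) distr \<Rightarrow> 'a distr \<Rightarrow> (real \<Rightarrow> 'a distr) \<Rightarrow> (real \<Rightarrow> 'a distr) \<Rightarrow> bool" where
  "duhamel_system v0 w0 v w \<longleftrightarrow> (\<exists>F G :: real \<Rightarrow> 'a \<Rightarrow> 'a distr.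
     (AE \<tau> in lborel. 0 < \<tau> \<longrightarrow> (\<forall>b\<in>Basis.
        is_product (v \<tau>) (dderiv b (potential_slice (v \<tau>) (w \<tau>))) (F \<tau> b) \<and>
        is_product (w \<tau>) (dderiv b (potential_slice (v \<tau>) (w \<tau>))) (G \<tau> b))) \<and>
     (AE t in lborel. 0 < t \<longrightarrow> (\<forall>\<zeta>\<in>Z_test.
        set_integrable lborel {0<..<t} (\<lambda>\<tau>. heat (t - \<tau>) (ddiv (F \<tau>)) \<zeta>) \<and>
        v t \<zeta> = heat t v0 \<zeta> - (LINT \<tau>:{0<..<t}|lborel. heat (t - \<tau>) (ddiv (F \<tau>)) \<zeta>) \<and>
        set_integrable lborel {0<..<t} (\<lambda>\<tau>. heat (t - \<tau>) (ddiv (G \<tau>)) \<zeta>) \<and>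
        w t \<zeta> = heat t w0 \<zeta> + (LINT \<tau>:{0<..<t}|lborel. heat (t - \<tau>) (ddiv (G \<tau>)) \<zeta>))))"

definition solution_class :: "('a::euclidean_space \<Rightarrow> real) \<Rightarrow> real \<Rightarrow> 'a tdistr set" where
  "solution_class \<phi> p =
     (\<Inter>r\<in>{r::ennreal. 1 < r \<and> r \<le> \<infinity>}.
        chemin_lerner \<phi> \<infinity> r (- 2 + real DIM('a) / p + enn2real (2 / r)) (ennreal p))"

definition global_solutions ::
    "('a::euclidean_space \<Rightarrow> real) \<Rightarrow> real \<Rightarrow> 'a distr \<Rightarrow> 'a distr \<Rightarrow> ('a tdistr \<times> 'a tdistr) set" where
  "global_solutions \<phi> p v0 w0 =
     {(V, W). V \<in> solution_class \<phi> p \<and> W \<in> solution_class \<phi> p \<and>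
        (\<exists>v w. time_slices V v \<and> time_slices W w \<and> duhamel_system v0 w0 v w)}"

definition potential :: "('a::euclidean_space) tdistr \<Rightarrow> 'a tdistr \<Rightarrow> 'a tdistr" where
  "potential V W = (\<lambda>\<eta>. inv_neg_laplace (\<lambda>\<zeta>. W \<eta> \<zeta> - V \<eta> \<zeta>))"

text \<open>The product norm on \<open>X \<times> X\<close>, for a Besov space \<open>X\<close>, is taken to be the sum of the norms.\<close>

definition data_norm ::
    "('a::euclidean_space \<Rightarrow> real) \<Rightarrow> real \<Rightarrow> 'a distr \<Rightarrow> 'a distr \<Rightarrow> ennreal" where
  "data_norm \<phi> p v0 w0 =
     besov_norm \<phi> (- 2 + real DIM('a) / p) (ennreal p) v0 +
     besov_norm \<phi> (- 2 + real DIM('a) / p) (ennreal p) w0"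

definition data_space :: "('a::euclidean_space \<Rightarrow> real) \<Rightarrow> real \<Rightarrow> 'a distr set" where
  "data_space \<phi> p = besov \<phi> (- 2 + real DIM('a) / p) (ennreal p)"

definition smallness_constant :: "('a::euclidean_space \<Rightarrow> real) \<Rightarrow> real \<Rightarrow> real \<Rightarrow> bool" where
  "smallness_constant \<phi> p \<epsilon> \<longleftrightarrow> 0 < \<epsilon> \<and>
     (\<forall>v0\<in>data_space \<phi> p. \<forall>w0\<in>data_space \<phi> p. data_norm \<phi> p v0 w0 \<le> ennreal \<epsilon> \<longrightarrow>
        (\<exists>!VW. VW \<in> global_solutions \<phi> p v0 w0))"

section \<open>Dilations\<close>

text \<open>
  \<open>dilate c a u\<close> is \<open>c u(a x)\<close> and \<open>tdilate c a b U\<close> is \<open>c U(a x, b t)\<close>; the other factors are the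
  Jacobians of the change of variables.
\<close>

definition dilate :: "real \<Rightarrow> real \<Rightarrow> ('a::euclidean_space) distr \<Rightarrow> 'a distr" where
  "dilate c a u = (\<lambda>\<zeta>. of_real (c / a ^ DIM('a)) * u (\<lambda>x. \<zeta> (x /\<^sub>R a)))"

definition tdilate ::
    "real \<Rightarrow> real \<Rightarrow> real \<Rightarrow> ('a::euclidean_space) tdistr \<Rightarrow> 'a tdistr" where
  "tdilate c a b U =
     (\<lambda>\<eta> \<zeta>. of_real (c / (a ^ DIM('a) * b)) * U (\<lambda>t. \<eta> (t / b)) (\<lambda>x. \<zeta> (x /\<^sub>R a)))"

end

theory Submission
  imports Defs "HOL-Probability.Probability"
begin

text \<open>
  If \<open>(v, w)\<close> solves the system, then so does \<open>(\<mu>\<^sup>2 v(\<mu> x, \<mu>\<^sup>2 t), \<mu>\<^sup>2 w(\<mu> x, \<mu>\<^sup>2 t))\<close>, with the data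
  \<open>\<mu>\<^sup>2 v\<^sub>0(\<mu> x)\<close>, \<open>\<mu>\<^sup>2 w\<^sub>0(\<mu> x)\<close>. For data homogeneous of degree \<open>-2\<close> these are the same data, so uniqueness
  yields self-similarity. The Duhamel equations and the product of distributions (which does not depend
  on the dyadic partition) are covariant under dilations by changes of variables. The solution class
  is defined with a fixed dyadic partition, and \<open>\<mu>\<close> need not be a power of 2: a block of the dilated
  distribution is a convolution of boundedly many blocks of the original one with kernels whose
  \<open>L\<^sup>1\<close> norm does not depend on the frequency, so Young's inequality bounds its norm.
\<close>

section \<open>Affine changes of variables\<close>

text \<open>Three difficulties shape the argument. The Chemin-Lerner norm is an infimum over
  representing functions, so every estimate is carried by a concrete representative with a bound
  (\<open>trep_bounded\<close>). Only finiteness, uniform in the frequency, is at stake; hence the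
  crude constants 4 and 16 in the triangle inequalities. Next, the operators evaluate a functional
  at functions such as \<open>conv laplace_kernel \<zeta>\<close>, whose membership in
  \<open>Z_test\<close> is left open. The dilation laws survive this because nonzero multiples and
  dilations neither enter nor leave \<open>Z_test\<close>, so an element of \<open>Z_dual\<close>
  commutes with nonzero scalars at every argument. Finally, integrals are total, with value 0 for
  non-integrable functions, so changes of variables are proved in a form that covers this case. The
  exponents match by counting weights: \<open>v\<close> and \<open>w\<close> have weight 2, the
  inverse Laplacian lowers the weight by 2 and each derivative raises it by 1. The product of
  \<open>v\<close> with the field thus has weight 3, its divergence weight 4, and the time integral
  brings 4 back to 2.\<close>

lemma nn_integral_lborel_affine:
  fixes t :: "'a::euclidean_space"
  assumes c: "c \<noteq> 0" and f [measurable]: "f \<in> borel_measurable borel"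
  shows "(\<integral>\<^sup>+x. f (t + c *\<^sub>R x) \<partial>lborel) = ennreal (1 / \<bar>c\<bar> ^ DIM('a)) * (\<integral>\<^sup>+x. f x \<partial>lborel)"
proof -
  have "(\<integral>\<^sup>+x. f x \<partial>lborel) = ennreal (\<bar>c\<bar> ^ DIM('a)) * (\<integral>\<^sup>+x. f (t + c *\<^sub>R x) \<partial>lborel)"
    by (subst lborel_affine[OF c, of t])
      (simp add: nn_integral_density nn_integral_distr nn_integral_cmult)
  then show ?thesis
    using c by (simp flip: mult.assoc ennreal_mult)
qed

text \<open>The two directions are one implication, \<open>*\<close>: the converse applies it to the
  composed function and the inverse affine map.\<close>

lemma integrable_lborel_affine_iff:
  fixes f :: "'a::euclidean_space \<Rightarrow> 'b::{banach, second_countable_topology}"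
  assumes c: "c \<noteq> 0"
  shows "integrable lborel (\<lambda>x. f (t + c *\<^sub>R x)) \<longleftrightarrow> integrable lborel f"
proof -
  have *: "integrable lborel (\<lambda>x. g (t + c *\<^sub>R x))"
    if "integrable lborel g" "c \<noteq> 0" for g :: "'a \<Rightarrow> 'b" and c t
  proof -
    have [measurable]: "g \<in> borel_measurable borel" using that by auto
    show ?thesis
      using that nn_integral_lborel_affine[of c "\<lambda>x. ennreal (norm (g x))" t]
      by (auto simp: integrable_iff_bounded ennreal_mult_less_top)
  qed
  show ?thesis
    using *[of f c t] *[of "\<lambda>x. f (t + c *\<^sub>R x)" "1 / c" "- (1/c) *\<^sub>R t"] c
    by (auto simp: algebra_simps)
qed

text \<open>Valid for every \<open>f\<close>: if \<open>f\<close> is not integrable, neither is the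
  composed function, and both integrals take the default value 0. This allows rescaling convolutions
  such as \<open>conv laplace_kernel \<zeta>\<close> whose integrability is not established.\<close>

lemma integral_lborel_affine:
  fixes f :: "'a::euclidean_space \<Rightarrow> 'b::{banach, second_countable_topology}"
  assumes c: "c \<noteq> 0"
  shows "(LINT x|lborel. f (t + c *\<^sub>R x)) = (1 / \<bar>c\<bar> ^ DIM('a)) *\<^sub>R (LINT x|lborel. f x)"
proof cases
  assume f: "integrable lborel f"
  then have [measurable]: "f \<in> borel_measurable borel" by auto
  have "(\<lambda>x. f (t + c *\<^sub>R x)) \<in> borel_measurable borel" by measurable
  then have "(LINT x|lborel. f x) = \<bar>c\<bar> ^ DIM('a) *\<^sub>R (LINT x|lborel. f (t + c *\<^sub>R x))"
    by (subst lborel_affine[OF c, of t]) (simp add: integral_density integral_distr)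
  then show ?thesis using c by simp
next
  assume "\<not> integrable lborel f"
  then show ?thesis
    using integrable_lborel_affine_iff[OF c, of f t] by (simp add: not_integrable_integral_eq)
qed

lemmas nn_integral_lborel_scaleR = nn_integral_lborel_affine[where t = 0, simplified]
  and integrable_lborel_scaleR_iff = integrable_lborel_affine_iff[where t = 0, simplified]
  and integral_lborel_scaleR = integral_lborel_affine[where t = 0, simplified]

text \<open>Multiplication by a nonzero constant preserves null sets. The set where \<open>P\<close>
  fails may be non-measurable, so it is enlarged to a measurable null set \<open>N\<close> before
  the change of variables.\<close>

lemma AE_lborel_mult:
  fixes c :: real
  assumes c: "c \<noteq> 0" and P: "AE x in lborel. P x"
  shows "AE x in lborel. P (c * x)"
proof -
  obtain N where N: "N \<in> sets lborel" "emeasure lborel N = 0" "{x. \<not> P x} \<subseteq> N"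
    using P by (auto elim!: AE_E)
  have "AE x in lborel. x \<notin> N"
    using N by (intro AE_not_in) (auto simp: null_sets_def)
  moreover have "Measurable.pred borel (\<lambda>x. x \<notin> N)"
    using N(1) by measurable
  ultimately have "AE x in lborel. 0 + c * x \<notin> N"
    by (intro AE_borel_affine[OF c]) auto
  then show ?thesis
    using N(3) by (auto elim!: eventually_mono)
qed

section \<open>Schwartz functions\<close>

lemma dpart_eqI: "(f has_derivative f') (at x) \<Longrightarrow> dpart b f x = f' b"
  unfolding dpart_def using frechet_derivative_at by metis

lemma dparts_simps [simp]:
  "dparts [] f = f" "dparts (b # bs) f = dpart b (dparts bs f)"
  "dparts (bs @ cs) f = dparts bs (dparts cs f)"
  by (simp_all add: dparts_def)

definition rapidly_decaying :: "('a::euclidean_space \<Rightarrow> complex) \<Rightarrow> bool" where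
  "rapidly_decaying f \<longleftrightarrow> (\<forall>k. \<exists>C. \<forall>x. (1 + norm x) ^ k * cmod (f x) \<le> C)"

lemma bounded_weighted_iff:
  "bounded (range (\<lambda>x. of_real ((1 + norm x) ^ k) * f x :: complex)) \<longleftrightarrow>
    (\<exists>C. \<forall>x. (1 + norm x) ^ k * cmod (f x) \<le> C)"
proof -
  have "norm (of_real ((1 + norm x) ^ k) * f x :: complex) = (1 + norm x) ^ k * cmod (f x)" for x
    by (simp only: norm_mult norm_of_real abs_of_nonneg) simp
  then show ?thesis by (simp only: bounded_iff) auto
qed

lemma schwartz_iff:
  "f \<in> schwartz \<longleftrightarrow> (\<forall>bs. set bs \<subseteq> Basis \<longrightarrow>
     (\<forall>x. dparts bs f differentiable (at x)) \<and> rapidly_decaying (dparts bs f))"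
  unfolding schwartz_def smooth_fun_def rapidly_decaying_def bounded_weighted_iff by blast

text \<open>The Schwartz space is the largest space of differentiable, rapidly decaying functions that is
  closed under partial derivatives; its closure properties are proved by coinduction.\<close>

lemma schwartz_coinduct:
  assumes "f \<in> S"
    and "\<And>f x. f \<in> S \<Longrightarrow> f differentiable (at x)"
    and "\<And>f b. f \<in> S \<Longrightarrow> b \<in> Basis \<Longrightarrow> dpart b f \<in> S"
    and "\<And>f. f \<in> S \<Longrightarrow> rapidly_decaying f"
  shows "f \<in> schwartz"
proof -
  have "dparts bs f \<in> S" if "set bs \<subseteq> Basis" for bs
    using that by (induction bs) (auto intro: assms)
  then show ?thesis
    unfolding schwartz_iff using assms by blast
qed

lemma schwartz_differentiable: "f \<in> schwartz \<Longrightarrow> f differentiable (at x)"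
  unfolding schwartz_iff by (drule spec[of _ "[]"]) simp

lemma schwartz_rapidly_decaying: "f \<in> schwartz \<Longrightarrow> rapidly_decaying f"
  unfolding schwartz_iff by (drule spec[of _ "[]"]) simp

lemma schwartz_dparts: "f \<in> schwartz \<Longrightarrow> set bs \<subseteq> Basis \<Longrightarrow> dparts bs f \<in> schwartz"
  unfolding schwartz_iff by (metis dparts_simps(3) set_append Un_subset_iff)

lemma schwartz_dpart: "f \<in> schwartz \<Longrightarrow> b \<in> Basis \<Longrightarrow> dpart b f \<in> schwartz"
  using schwartz_dparts[of f "[b]"] by simp

lemma schwartz_continuous: "f \<in> schwartz \<Longrightarrow> continuous_on A f"
  by (meson continuous_at_imp_continuous_on differentiable_imp_continuous_within schwartz_differentiable)

lemma schwartz_measurable [measurable (raw)]: "f \<in> schwartz \<Longrightarrow> f \<in> borel_measurable borel"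
  by (intro borel_measurable_continuous_onI schwartz_continuous)

lemma rapidly_decayingE:
  assumes "rapidly_decaying f"
  obtains C where "0 \<le> C" "\<And>x. (1 + norm x) ^ k * cmod (f x) \<le> C"
proof -
  obtain C where "\<And>x. (1 + norm x) ^ k * cmod (f x) \<le> C"
    using assms unfolding rapidly_decaying_def by blast
  then have "\<And>x. (1 + norm x) ^ k * cmod (f x) \<le> max 0 C" by (simp add: le_max_iff_disj)
  with that show ?thesis by (metis max.cobounded1)
qed

lemma rapidly_decaying_add:
  assumes "rapidly_decaying f" "rapidly_decaying g"
  shows "rapidly_decaying (\<lambda>x. f x + g x)"
  unfolding rapidly_decaying_def
proof
  fix k
  obtain C where C: "\<And>x. (1 + norm x) ^ k * cmod (f x) \<le> C"
    using rapidly_decayingE[OF assms(1)] by metis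
  obtain D where D: "\<And>x. (1 + norm x) ^ k * cmod (g x) \<le> D"
    using rapidly_decayingE[OF assms(2)] by metis
  have "(1 + norm x) ^ k * cmod (f x + g x) \<le> C + D" for x
  proof -
    have "(1 + norm x) ^ k * cmod (f x + g x) \<le> (1 + norm x) ^ k * (cmod (f x) + cmod (g x))"
      by (intro mult_left_mono norm_triangle_ineq) auto
    also have "\<dots> \<le> C + D"
      unfolding distrib_left by (intro add_mono C D)
    finally show ?thesis .
  qed
  then show "\<exists>C. \<forall>x. (1 + norm x) ^ k * cmod (f x + g x) \<le> C" by blast
qed

text \<open>A factor of growth order \<open>m\<close> uses up \<open>m\<close> powers of the weight:
  the bound of order \<open>m + k\<close> on \<open>f\<close> yields the one of order
  \<open>k\<close> on the product.\<close>

lemma rapidly_decaying_mult_bound: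
  assumes f: "rapidly_decaying f" and g: "\<And>x. cmod (g x) \<le> B * (1 + norm x) ^ m"
  shows "rapidly_decaying (\<lambda>x. g x * f x)"
  unfolding rapidly_decaying_def
proof
  fix k
  obtain C where C: "\<And>x. (1 + norm x) ^ (m + k) * cmod (f x) \<le> C"
    using rapidly_decayingE[OF f] by metis
  have B: "0 \<le> B" using g[of 0] norm_ge_zero[of "g 0"] by (simp del: norm_ge_zero)
  have "(1 + norm x) ^ k * cmod (g x * f x) \<le> B * C" for x
  proof -
    have "(1 + norm x) ^ k * cmod (g x * f x) \<le> (1 + norm x) ^ k * ((B * (1 + norm x) ^ m) * cmod (f x))"
      unfolding norm_mult by (intro mult_left_mono mult_right_mono g) auto
    also have "\<dots> = B * ((1 + norm x) ^ (m + k) * cmod (f x))"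
      by (simp add: power_add)
    also have "\<dots> \<le> B * C" by (intro mult_left_mono C B)
    finally show ?thesis .
  qed
  then show "\<exists>C. \<forall>x. (1 + norm x) ^ k * cmod (g x * f x) \<le> C" by blast
qed

lemma rapidly_decaying_cmult: "rapidly_decaying f \<Longrightarrow> rapidly_decaying (\<lambda>x. c * f x)"
  by (rule rapidly_decaying_mult_bound[where m = 0 and B = "cmod c"]) auto

lemma rapidly_decaying_bounded: "rapidly_decaying f \<Longrightarrow> \<exists>B\<ge>0. \<forall>x. cmod (f x) \<le> B"
  by (erule rapidly_decayingE[where k = 0]) auto

lemma rapidly_decaying_mult:
  assumes "rapidly_decaying f" "rapidly_decaying g"
  shows "rapidly_decaying (\<lambda>x. f x * g x)"
proof -
  obtain B where "\<And>x. cmod (f x) \<le> B"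
    using rapidly_decaying_bounded[OF assms(1)] by blast
  then show ?thesis
    by (intro rapidly_decaying_mult_bound[where m = 0 and B = B] assms(2)) auto
qed

lemma rapidly_decaying_scaleR:
  assumes f: "rapidly_decaying f" and a: "a \<noteq> 0"
  shows "rapidly_decaying (\<lambda>x. f (a *\<^sub>R x))"
  unfolding rapidly_decaying_def
proof
  fix k
  \<comment> \<open>\<open>K\<close> absorbs the change of weight,
    \<open>1 + norm x \<le> K * (1 + norm (a *\<^sub>R x))\<close>, whether \<open>a\<close> is
    small or large.\<close>
  define K where "K = 1 + 1 / \<bar>a\<bar>"
  obtain C where C: "\<And>x. (1 + norm x) ^ k * cmod (f x) \<le> C"
    using rapidly_decayingE[OF f] by metis
  have K: "1 + norm x \<le> K * (1 + norm (a *\<^sub>R x))" for x :: 'a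
    using a by (simp add: K_def field_simps)
  have "0 \<le> K" using a by (simp add: K_def)
  have "(1 + norm x) ^ k * cmod (f (a *\<^sub>R x)) \<le> K ^ k * C" for x
  proof -
    have "(1 + norm x) ^ k * cmod (f (a *\<^sub>R x)) \<le> (K * (1 + norm (a *\<^sub>R x))) ^ k * cmod (f (a *\<^sub>R x))"
      by (intro mult_right_mono power_mono K) auto
    also have "\<dots> = K ^ k * ((1 + norm (a *\<^sub>R x)) ^ k * cmod (f (a *\<^sub>R x)))"
      by (simp add: power_mult_distrib)
    also have "\<dots> \<le> K ^ k * C" by (intro mult_left_mono C zero_le_power \<open>0 \<le> K\<close>)
    finally show ?thesis .
  qed
  then show "\<exists>C. \<forall>x. (1 + norm x) ^ k * cmod (f (a *\<^sub>R x)) \<le> C" by blast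
qed

lemma differentiable_has_derivative:
  "f differentiable (at x) \<Longrightarrow> (f has_derivative (\<lambda>h. dpart h f x)) (at x)"
  unfolding dpart_def using frechet_derivative_works by blast

lemma dpart_lincomb:
  assumes "f differentiable (at x)" "g differentiable (at x)"
  shows "dpart b (\<lambda>x. c * f x + d * g x) x = c * dpart b f x + d * dpart b g x"
  by (rule dpart_eqI) (auto intro!: derivative_eq_intros differentiable_has_derivative assms)

lemma schwartz_lincomb:
  assumes "f \<in> schwartz" "g \<in> schwartz"
  shows "(\<lambda>x. c * f x + d * g x) \<in> schwartz"
proof (rule schwartz_coinduct[where S = "{\<lambda>x. c * f x + d * g x | f g. f \<in> schwartz \<and> g \<in> schwartz}"])
  show "(\<lambda>x. c * f x + d * g x) \<in> {\<lambda>x. c * f x + d * g x | f g. f \<in> schwartz \<and> g \<in> schwartz}"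
    using assms by blast
next
  fix h :: "'a \<Rightarrow> complex" and x b :: 'a
  assume "h \<in> {\<lambda>x. c * f x + d * g x | f g. f \<in> schwartz \<and> g \<in> schwartz}"
  then obtain f g where h: "h = (\<lambda>x. c * f x + d * g x)" and fg: "f \<in> schwartz" "g \<in> schwartz"
    by blast
  show "h differentiable (at x)"
    unfolding h by (intro derivative_intros schwartz_differentiable fg)
  show "rapidly_decaying h"
    unfolding h by (intro rapidly_decaying_add rapidly_decaying_cmult schwartz_rapidly_decaying fg)
  assume "b \<in> Basis"
  moreover have "dpart b h = (\<lambda>x. c * dpart b f x + d * dpart b g x)"
    unfolding h using fg by (intro ext dpart_lincomb schwartz_differentiable)
  ultimately show "dpart b h \<in> {\<lambda>x. c * f x + d * g x | f g. f \<in> schwartz \<and> g \<in> schwartz}"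
    using fg schwartz_dpart by blast
qed

lemma schwartz_add: "f \<in> schwartz \<Longrightarrow> g \<in> schwartz \<Longrightarrow> (\<lambda>x. f x + g x) \<in> schwartz"
  using schwartz_lincomb[of f g 1 1] by simp

lemma schwartz_cmult: "f \<in> schwartz \<Longrightarrow> (\<lambda>x. c * f x) \<in> schwartz"
  using schwartz_lincomb[of f f c 0] by simp

lemma schwartz_zero: "(\<lambda>x. 0) \<in> schwartz"
  by (rule schwartz_coinduct[where S = "{\<lambda>x. 0}"]) (auto simp: rapidly_decaying_def dpart_def)

section \<open>Scaling and products of Schwartz functions\<close>

lemma dpart_scaleR:
  fixes f :: "'a::euclidean_space \<Rightarrow> complex"
  assumes "f differentiable (at (a *\<^sub>R x))"
  shows "dpart b (\<lambda>x. f (a *\<^sub>R x)) x = of_real a * dpart b f (a *\<^sub>R x)"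
proof -
  have "(f has_derivative (\<lambda>h. dpart h f (a *\<^sub>R x))) (at (a *\<^sub>R x))"
    using assms by (rule differentiable_has_derivative)
  then have "((\<lambda>x. f (a *\<^sub>R x)) has_derivative (\<lambda>h. dpart (a *\<^sub>R h) f (a *\<^sub>R x))) (at x)"
    by (rule has_derivative_compose[rotated]) (auto intro!: derivative_eq_intros)
  moreover have "dpart (a *\<^sub>R b) f (a *\<^sub>R x) = of_real a * dpart b f (a *\<^sub>R x)"
    using linear_frechet_derivative[OF assms]
    by (simp add: dpart_def linear_scale scaleR_conv_of_real)
  ultimately show ?thesis by (simp add: dpart_eqI)
qed

lemma differentiable_scaleR:
  fixes f :: "'a::euclidean_space \<Rightarrow> complex"
  assumes "f differentiable (at (a *\<^sub>R x))"
  shows "(\<lambda>x. f (a *\<^sub>R x)) differentiable (at x)"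
  using differentiable_chain_at[of "\<lambda>x. a *\<^sub>R x" x f] assms by (auto simp: o_def)

lemma dparts_scaleR:
  fixes f :: "'a::euclidean_space \<Rightarrow> complex"
  assumes "smooth_fun f" "set bs \<subseteq> Basis"
  shows "dparts bs (\<lambda>x. f (a *\<^sub>R x)) = (\<lambda>x. of_real (a ^ length bs) * dparts bs f (a *\<^sub>R x))"
  using assms(2)
proof (induction bs)
  case (Cons b bs)
  have d: "dparts bs f differentiable (at y)" for y
    using assms(1) Cons.prems unfolding smooth_fun_def by auto
  \<comment> \<open>The vanishing summand only brings the function into the two-term shape of
    \<open>dpart_lincomb\<close>.\<close>
  have "dpart b (\<lambda>x. of_real (a ^ length bs) * dparts bs f (a *\<^sub>R x) + 0 * dparts bs f (a *\<^sub>R x)) x =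
    of_real (a ^ length bs) * (of_real a * dpart b (dparts bs f) (a *\<^sub>R x)) + 0 * (of_real a * dpart b (dparts bs f) (a *\<^sub>R x))" for x
    by (subst dpart_lincomb) (auto simp: dpart_scaleR d intro!: differentiable_scaleR d)
  then have "dpart b (\<lambda>x. of_real (a ^ length bs) * dparts bs f (a *\<^sub>R x)) =
      (\<lambda>x. of_real (a ^ length (b # bs)) * dparts (b # bs) f (a *\<^sub>R x))"
    by (auto simp: fun_eq_iff)
  then show ?case using Cons.IH Cons.prems by simp
qed simp

lemma smooth_fun_scaleR:
  assumes "smooth_fun f"
  shows "smooth_fun (\<lambda>x. f (a *\<^sub>R x))"
  unfolding smooth_fun_def
proof (intro allI impI)
  fix bs :: "'a list" and x assume bs: "set bs \<subseteq> Basis"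
  have "(\<lambda>x. dparts bs f (a *\<^sub>R x)) differentiable (at x)"
    using assms bs by (intro differentiable_scaleR) (auto simp: smooth_fun_def)
  then show "dparts bs (\<lambda>x. f (a *\<^sub>R x)) differentiable (at x)"
    unfolding dparts_scaleR[OF assms bs] by (auto intro!: differentiable_mult)
qed

lemma schwartz_smooth: "f \<in> schwartz \<Longrightarrow> smooth_fun f"
  by (simp add: schwartz_def)

lemma schwartz_scaleR:
  assumes f: "f \<in> schwartz" and a: "a \<noteq> 0"
  shows "(\<lambda>x. f (a *\<^sub>R x)) \<in> schwartz"
  unfolding schwartz_iff
proof (intro allI impI conjI)
  fix bs :: "'a list" and x assume bs: "set bs \<subseteq> Basis"
  show "dparts bs (\<lambda>x. f (a *\<^sub>R x)) differentiable (at x)"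
    using smooth_fun_scaleR[OF schwartz_smooth[OF f]] bs by (auto simp: smooth_fun_def)
  show "rapidly_decaying (dparts bs (\<lambda>x. f (a *\<^sub>R x)))"
    unfolding dparts_scaleR[OF schwartz_smooth[OF f] bs]
    using schwartz_rapidly_decaying[OF schwartz_dparts[OF f bs]] a
    by (intro rapidly_decaying_cmult rapidly_decaying_scaleR)
qed

text \<open>Products alone are not closed under partial derivatives, since the Leibniz rule yields a
  sum of two products. Closing under sums gives an invariant fit for
  \<open>schwartz_coinduct\<close>.\<close>

inductive_set schwartz_products :: "('a::euclidean_space \<Rightarrow> complex) set" where
  mult: "f \<in> schwartz \<Longrightarrow> g \<in> schwartz \<Longrightarrow> (\<lambda>x. f x * g x) \<in> schwartz_products"
| add: "f \<in> schwartz_products \<Longrightarrow> g \<in> schwartz_products \<Longrightarrow> (\<lambda>x. f x + g x) \<in> schwartz_products"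

lemma schwartz_products_aux:
  assumes "f \<in> schwartz_products"
  shows "(\<forall>x. f differentiable (at x)) \<and> rapidly_decaying f \<and> (\<forall>b\<in>Basis. dpart b f \<in> schwartz_products)"
  using assms
proof induction
  case (mult f g)
  have "dpart b (\<lambda>x. f x * g x) = (\<lambda>x. f x * dpart b g x + dpart b f x * g x)" for b
    by (intro ext dpart_eqI)
      (auto intro!: derivative_eq_intros differentiable_has_derivative schwartz_differentiable mult)
  then show ?case
    using mult by (intro conjI allI ballI differentiable_mult schwartz_differentiable rapidly_decaying_mult
        schwartz_rapidly_decaying) (auto intro!: schwartz_products.intros schwartz_dpart)
next
  case (add f g)
  have "dpart b (\<lambda>x. f x + g x) = (\<lambda>x. dpart b f x + dpart b g x)" for b
    using dpart_lincomb[of f _ g b 1 1] add.IH by (auto simp: fun_eq_iff)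
  then show ?case
    using add by (auto intro!: derivative_intros rapidly_decaying_add schwartz_products.intros)
qed

lemma schwartz_mult: "f \<in> schwartz \<Longrightarrow> g \<in> schwartz \<Longrightarrow> (\<lambda>x. f x * g x) \<in> schwartz"
  by (rule schwartz_coinduct[where S = schwartz_products])
    (auto simp: schwartz_products_aux intro: schwartz_products.intros)

text \<open>Differentiating the coordinate factor leaves a multiple of \<open>f\<close> without that
  factor. The coinduction invariant \<open>S\<close> therefore carries an additional Schwartz
  summand that collects these terms.\<close>

lemma schwartz_coordinate_mult:
  assumes "f \<in> schwartz"
  shows "(\<lambda>x. of_real (x \<bullet> b) * f x) \<in> schwartz"
proof -
  define S :: "('a \<Rightarrow> complex) set" where
    "S = {\<lambda>x. of_real (x \<bullet> b) * f x + g x | f g. f \<in> schwartz \<and> g \<in> schwartz}"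
  have "(\<lambda>x. of_real (x \<bullet> b) * f x + 0) \<in> S"
    unfolding S_def using assms schwartz_zero
    by (intro CollectI exI[of _ f] exI[of _ "\<lambda>x. 0"] conjI refl)
  then have "(\<lambda>x. of_real (x \<bullet> b) * f x + 0) \<in> schwartz"
  proof (rule schwartz_coinduct)
    fix h :: "'a \<Rightarrow> complex" and x c :: 'a assume "h \<in> S"
    then obtain f g where h: "h = (\<lambda>x. of_real (x \<bullet> b) * f x + g x)" and fg: "f \<in> schwartz" "g \<in> schwartz"
      unfolding S_def by blast
    have deriv: "(h has_derivative (\<lambda>k. of_real (x \<bullet> b) * dpart k f x + of_real (k \<bullet> b) * f x + dpart k g x)) (at x)" for x
      unfolding h by (auto intro!: derivative_eq_intros differentiable_has_derivative schwartz_differentiable fg)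
    then show "h differentiable (at x)" unfolding differentiable_def by blast
    show "rapidly_decaying h"
      unfolding h
    proof (intro rapidly_decaying_add rapidly_decaying_mult_bound[where B = "norm b" and m = 1]
        schwartz_rapidly_decaying fg)
      show "cmod (of_real (x \<bullet> b)) \<le> norm b * (1 + norm x) ^ 1" for x
        using Cauchy_Schwarz_ineq2[of x b] by (simp add: algebra_simps add_increasing)
    qed
    assume c: "c \<in> Basis"
    have "dpart c h = (\<lambda>x. of_real (x \<bullet> b) * dpart c f x + (of_real (c \<bullet> b) * f x + 1 * dpart c g x))"
      by (intro ext dpart_eqI[OF deriv, THEN trans]) simp
    moreover have "(\<lambda>x. of_real (c \<bullet> b) * f x + 1 * dpart c g x) \<in> schwartz"
      by (intro schwartz_lincomb schwartz_dpart fg c)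
    ultimately show "dpart c h \<in> S"
      unfolding S_def using schwartz_dpart[OF fg(1) c]
      by (intro CollectI exI[of _ "dpart c f"] exI[of _ "\<lambda>x. of_real (c \<bullet> b) * f x + 1 * dpart c g x"] conjI)
  qed
  then show ?thesis by simp
qed

section \<open>The Fourier transform on the Schwartz space\<close>

lemma integrable_inverse_1_plus_square_UNIV: "integrable lborel (\<lambda>x::real. inverse (1 + x\<^sup>2))"
  using integrable_inverse_1_plus_square by (simp add: set_integrable_def)

text \<open>Each coordinate satisfies
  \<open>1 + (x \<bullet> b)\<^sup>2 \<le> (1 + norm x)\<^sup>2\<close>; multiplying over the basis
  gives the exponent \<open>2 * DIM('a)\<close> and a majorant that is a product of integrable
  functions of one variable.\<close>

lemma integrable_decay: "integrable lborel (\<lambda>x::'a::euclidean_space. 1 / (1 + norm x) ^ (2 * DIM('a)))"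
proof -
  have fin: "integral\<^sup>N lborel (\<lambda>x::'a. ennreal (\<Prod>b\<in>Basis. inverse (1 + (x \<bullet> b)\<^sup>2))) < \<infinity>"
  proof -
    have "integral\<^sup>N lborel (\<lambda>x::'a. ennreal (\<Prod>b\<in>Basis. inverse (1 + (x \<bullet> b)\<^sup>2))) =
      integral\<^sup>N lborel (\<lambda>x::'a. \<Prod>b\<in>Basis. ennreal (inverse (1 + (x \<bullet> b)\<^sup>2)))"
      by (simp add: prod_ennreal)
    also have "\<dots> = (\<Prod>b\<in>(Basis::'a set). (\<integral>\<^sup>+x. ennreal (inverse (1 + x\<^sup>2)) \<partial>lborel))"
      by (rule nn_integral_lborel_prod) auto
    also have "\<dots> < \<infinity>"
      using integrable_inverse_1_plus_square_UNIV
      by (auto simp: less_top[symmetric] power_eq_top_ennreal integrable_iff_bounded)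
    finally show ?thesis .
  qed
  have "1 / (1 + norm x) ^ (2 * DIM('a)) \<le> (\<Prod>b\<in>Basis. inverse (1 + (x \<bullet> b)\<^sup>2))" for x :: 'a
  proof -
    have "(\<Prod>b\<in>Basis. 1 + (x \<bullet> b)\<^sup>2) \<le> (\<Prod>b\<in>(Basis::'a set). (1 + norm x)\<^sup>2)"
    proof (intro prod_mono conjI)
      fix b :: 'a assume "b \<in> Basis"
      then have "\<bar>x \<bullet> b\<bar> \<le> norm x" by (rule Basis_le_norm)
      then have "(x \<bullet> b)\<^sup>2 \<le> (norm x)\<^sup>2" by (metis abs_le_square_iff abs_norm_cancel)
      then show "1 + (x \<bullet> b)\<^sup>2 \<le> (1 + norm x)\<^sup>2" by (simp add: power2_eq_square algebra_simps add_increasing2)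
    qed auto
    also have "\<dots> = (1 + norm x) ^ (2 * DIM('a))" by (simp add: power_mult)
    finally have "1 / (1 + norm x) ^ (2 * DIM('a)) \<le> 1 / (\<Prod>b\<in>Basis. 1 + (x \<bullet> b)\<^sup>2)"
      by (intro divide_left_mono) (auto intro!: mult_pos_pos prod_pos zero_less_power add_pos_nonneg)
    then show ?thesis using prod_inversef[of "\<lambda>b. 1 + (x \<bullet> b)\<^sup>2" Basis] by (simp add: inverse_eq_divide comp_def)
  qed
  then have "integral\<^sup>N lborel (\<lambda>x::'a. ennreal (1 / (1 + norm x) ^ (2 * DIM('a)))) \<le>
      integral\<^sup>N lborel (\<lambda>x::'a. ennreal (\<Prod>b\<in>Basis. inverse (1 + (x \<bullet> b)\<^sup>2)))"
    by (intro nn_integral_mono ennreal_leI)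
  also note fin
  finally show ?thesis by (simp add: integrable_iff_bounded)
qed

lemma integrable_rapidly_decaying:
  fixes f :: "'a::euclidean_space \<Rightarrow> complex"
  assumes [measurable]: "f \<in> borel_measurable borel" and f: "rapidly_decaying f"
  shows "integrable lborel f"
proof -
  obtain C where C: "\<And>x. (1 + norm x) ^ (2 * DIM('a)) * cmod (f x) \<le> C"
    using rapidly_decayingE[OF f] by metis
  have "integrable lborel (\<lambda>x::'a. C * (1 / (1 + norm x) ^ (2 * DIM('a))))"
    by (intro integrable_mult_right integrable_decay)
  then show ?thesis
  proof (rule Bochner_Integration.integrable_bound)
    have "cmod (f x) \<le> C / (1 + norm x) ^ (2 * DIM('a))" for x
      using C[of x] by (subst pos_le_divide_eq) (auto simp: mult.commute add_pos_nonneg)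
    then have "cmod (f x) \<le> C * (1 / (1 + norm x) ^ (2 * DIM('a)))" for x by simp
    then have "cmod (f x) \<le> norm (C * (1 / (1 + norm x) ^ (2 * DIM('a))))" for x
      unfolding real_norm_def using abs_ge_self order_trans by blast
    then show "AE x in lborel. cmod (f x) \<le> norm (C * (1 / (1 + norm x) ^ (2 * DIM('a))))"
      by (intro AE_I2)
  qed simp
qed

lemma schwartz_integrable: "f \<in> schwartz \<Longrightarrow> integrable lborel f"
  by (intro integrable_rapidly_decaying schwartz_measurable schwartz_rapidly_decaying)

lemma norm_exp_ii [simp]: "cmod (exp (\<i> * of_real t)) = 1" "cmod (exp (- (\<i> * of_real t))) = 1"
  by (auto simp: norm_exp_eq_Re)

lemma integrable_mult_exp:
  fixes f :: "'a::euclidean_space \<Rightarrow> complex"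
  assumes f: "integrable lborel f"
  shows "integrable lborel (\<lambda>x. f x * exp (- \<i> * of_real (x \<bullet> \<xi>)))"
proof (rule Bochner_Integration.integrable_bound[OF f])
  have [measurable]: "f \<in> borel_measurable borel" using f by auto
  show "(\<lambda>x. f x * exp (- \<i> * of_real (x \<bullet> \<xi>))) \<in> borel_measurable lborel" by measurable
qed (simp add: norm_mult)

lemma fourier_inv_eq: "fourier_inv f x = fourier f (- x)"
  by (simp add: fourier_inv_def fourier_def inner_commute)

lemma fourier_add:
  assumes "integrable lborel f" "integrable lborel g"
  shows "fourier (\<lambda>x. f x + g x) \<xi> = fourier f \<xi> + fourier g \<xi>"
  unfolding fourier_def using assms[THEN integrable_mult_exp]
  by (simp add: distrib_right distrib_left)

lemma fourier_cmult: "fourier (\<lambda>x. c * f x) \<xi> = c * fourier f \<xi>"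
  by (simp add: fourier_def mult.assoc)

lemma fourier_sum:
  assumes "\<And>i. i \<in> I \<Longrightarrow> integrable lborel (f i)"
  shows "fourier (\<lambda>x. \<Sum>i\<in>I. f i x) \<xi> = (\<Sum>i\<in>I. fourier (f i) \<xi>)"
  using assms
proof (induction I rule: infinite_finite_induct)
  case (insert i I)
  then show ?case by (simp add: fourier_add)
qed (auto simp: fourier_def)

lemma fourier_bounded:
  "cmod (fourier f \<xi>) \<le> (2 * pi) powr (- real DIM('a) / 2) * (LINT x|lborel. cmod (f (x::'a::euclidean_space)))"
proof -
  have "cmod (LINT x|lborel. f x * exp (- \<i> * of_real (x \<bullet> \<xi>))) \<le>
      (LINT x|lborel. cmod (f x * exp (- \<i> * of_real (x \<bullet> \<xi>))))"
    by (rule integral_norm_bound)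
  then show ?thesis
    by (simp add: fourier_def norm_mult mult_left_mono)
qed

lemma integrable_norm_power_mult:
  assumes f: "f \<in> schwartz"
  shows "integrable lborel (\<lambda>x. norm x ^ k * cmod (f x))"
proof -
  have [measurable]: "f \<in> borel_measurable borel" using f by measurable
  have "integrable lborel (\<lambda>x. of_real (norm x ^ k) * f x)"
  proof (rule integrable_rapidly_decaying)
    show "rapidly_decaying (\<lambda>x. of_real (norm x ^ k) * f x)"
      by (rule rapidly_decaying_mult_bound[OF schwartz_rapidly_decaying[OF f], where B = 1 and m = k])
        (auto simp: norm_power intro!: power_mono)
  qed simp
  then have "integrable lborel (\<lambda>x. cmod (of_real (norm x ^ k) * f x))" by (rule integrable_norm)
  then show ?thesis by (simp add: norm_mult norm_power)
qed

text \<open>The first-order Taylor expansion of the phase is inserted under the integral. Its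
  remainder is quadratic in the increment and in \<open>norm x\<close>, so integrability of the
  second moment of \<open>f\<close> makes the error vanish faster than the increment.\<close>

lemma fourier_has_derivative:
  fixes f :: "'a::euclidean_space \<Rightarrow> complex"
  assumes f: "f \<in> schwartz"
  shows "(fourier f has_derivative (\<lambda>h. fourier (\<lambda>x. - \<i> * of_real (x \<bullet> h) * f x) \<xi>)) (at \<xi>)"
proof -
  define c where "c = (2 * pi) powr (- real DIM('a) / 2)"
  have c0: "c \<ge> 0" by (simp add: c_def)
  have [measurable]: "f \<in> borel_measurable borel" using f by measurable
  have i0: "integrable lborel f" using f by (rule schwartz_integrable)
  have i1: "integrable lborel (\<lambda>x. - \<i> * of_real (x \<bullet> h) * f x)" for h
    using schwartz_integrable[OF schwartz_cmult[OF schwartz_coordinate_mult[OF f, of h], of "- \<i>"]]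
    by (simp add: mult.assoc)
  \<comment> \<open>Up to the factor \<open>c\<close>, these are the first and second absolute
    moments of \<open>f\<close>: \<open>M1\<close> bounds the candidate derivative,
    \<open>M2\<close> the quadratic remainder.\<close>
  define M1 where "M1 = c * (LINT x|lborel. norm x ^ 1 * cmod (f x))"
  define M2 where "M2 = c * (LINT x|lborel. norm x ^ 2 * cmod (f x))"
  define L where "L h = fourier (\<lambda>x. - \<i> * of_real (x \<bullet> h) * f x) \<xi>" for h
  have "bounded_linear L"
  proof (rule bounded_linear_intro)
    show "L (h + k) = L h + L k" for h k
      unfolding L_def using fourier_add[OF i1[of h] i1[of k]]
      by (simp add: inner_add_right algebra_simps)
    show "L (r *\<^sub>R h) = r *\<^sub>R L h" for r h
      unfolding L_def using fourier_cmult[of "of_real r" "\<lambda>x. - \<i> * of_real (x \<bullet> h) * f x" \<xi>]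
      by (simp add: scaleR_conv_of_real algebra_simps)
    show "norm (L h) \<le> norm h * M1" for h
    proof -
      have "norm (L h) \<le> c * (LINT x|lborel. cmod (- \<i> * of_real (x \<bullet> h) * f x))"
        unfolding L_def c_def by (rule fourier_bounded)
      also have "\<dots> \<le> c * (LINT x|lborel. norm h * (norm x ^ 1 * cmod (f x)))"
      proof (intro mult_left_mono c0 integral_mono integrable_norm i1 integrable_mult_right integrable_norm_power_mult f)
        show "cmod (- \<i> * of_real (x \<bullet> h) * f x) \<le> norm h * (norm x ^ 1 * cmod (f x))" for x
          using mult_right_mono[OF Cauchy_Schwarz_ineq2[of x h] norm_ge_zero[of "f x"]]
          by (simp add: norm_mult mult_ac)
      qed
      also have "\<dots> = norm h * M1"
        by (simp only: integral_mult_right_zero M1_def mult.left_commute)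
      finally show ?thesis .
    qed
  qed
  moreover have "norm (fourier f \<eta> - fourier f \<xi> - L (\<eta> - \<xi>)) / norm (\<eta> - \<xi>) \<le> M2 * norm (\<eta> - \<xi>)"
    if "\<eta> \<noteq> \<xi>" for \<eta>
  proof -
    define h where "h = \<eta> - \<xi>"
    define g where "g x = f x * exp (- \<i> * of_real (x \<bullet> \<xi>)) * (iexp (- (x \<bullet> h)) - 1 - \<i> * of_real (- (x \<bullet> h)))" for x
    have split: "exp (- \<i> * of_real (x \<bullet> \<eta>)) = exp (- \<i> * of_real (x \<bullet> \<xi>)) * iexp (- (x \<bullet> h))" for x
      by (simp add: h_def inner_diff_right ring_distribs exp_add[symmetric])
    have g: "g x = f x * exp (- \<i> * of_real (x \<bullet> \<eta>)) - f x * exp (- \<i> * of_real (x \<bullet> \<xi>))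
        - (- \<i> * of_real (x \<bullet> h) * f x) * exp (- \<i> * of_real (x \<bullet> \<xi>))" for x
      unfolding split g_def by (simp add: algebra_simps)
    have "fourier f \<eta> - fourier f \<xi> - L h = of_real c * (LINT x|lborel. g x)"
      unfolding g L_def fourier_def c_def
      using integrable_mult_exp[OF i0] integrable_mult_exp[OF i1]
      by (simp add: algebra_simps)
    moreover have "cmod (LINT x|lborel. g x) \<le> (LINT x|lborel. (norm h)\<^sup>2 * (norm x ^ 2 * cmod (f x)))"
    proof (rule Bochner_Integration.integral_norm_bound_integral)
      show "integrable lborel g"
        unfolding g by (intro Bochner_Integration.integrable_diff integrable_mult_exp i0 i1)
      show "integrable lborel (\<lambda>x. (norm h)\<^sup>2 * (norm x ^ 2 * cmod (f x)))"
        by (intro integrable_mult_right integrable_norm_power_mult f)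
      fix x
      have "cmod (iexp (- (x \<bullet> h)) - 1 - \<i> * of_real (- (x \<bullet> h))) \<le> \<bar>- (x \<bullet> h)\<bar> ^ 2 / 2"
        using iexp_approx1[of "- (x \<bullet> h)" 1] by (simp add: numeral_2_eq_2 algebra_simps)
      also have "\<dots> \<le> (norm x * norm h) ^ 2"
        using power_mono[OF Cauchy_Schwarz_ineq2[of x h], of 2] zero_le_power2[of "norm x * norm h"]
        by (simp only: abs_minus_cancel power2_abs) linarith
      finally show "norm (g x) \<le> (norm h)\<^sup>2 * (norm x ^ 2 * cmod (f x))"
        unfolding g_def norm_mult by (simp add: power_mult_distrib mult_left_mono mult_ac)
    qed
    ultimately have "norm (fourier f \<eta> - fourier f \<xi> - L h) \<le> c * ((norm h)\<^sup>2 * (LINT x|lborel. norm x ^ 2 * cmod (f x)))"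
      using c0 by (simp add: norm_mult mult_left_mono)
    then show ?thesis
      using that unfolding h_def[symmetric] M2_def
      by (subst pos_divide_le_eq) (auto simp: h_def power2_eq_square mult_ac)
  qed
  moreover have "((\<lambda>\<eta>. M2 * norm (\<eta> - \<xi>)) \<longlongrightarrow> 0) (at \<xi>)"
    by (auto intro!: tendsto_eq_intros)
  ultimately show ?thesis
    unfolding L_def[abs_def] by (intro has_derivativeI_sandwich[where e = 1]) auto
qed

lemma dpart_fourier:
  assumes "f \<in> schwartz"
  shows "dpart b (fourier f) = fourier (\<lambda>x. - \<i> * of_real (x \<bullet> b) * f x)"
  by (rule ext, rule dpart_eqI[OF fourier_has_derivative[OF assms]])

text \<open>The mean value inequality along a segment. The derivative is bounded on that segment
  alone, so that \<open>B\<close> may decay with the position of \<open>x\<close> and serve in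
  dominated convergence.\<close>

lemma difference_quotient_bound:
  fixes f :: "'a::euclidean_space \<Rightarrow> complex"
  assumes d: "\<And>x. f differentiable (at x)" and t: "0 \<le> t"
    and B: "\<And>s. 0 \<le> s \<Longrightarrow> s \<le> t \<Longrightarrow> cmod (dpart b f (x + s *\<^sub>R b)) \<le> B"
  shows "cmod (f (x + t *\<^sub>R b) - f x) \<le> B * t"
proof -
  have "norm (f (x + t *\<^sub>R b) - f (x + 0 *\<^sub>R b)) \<le> B * norm (t - 0)"
  proof (rule differentiable_bound[where S = "{0..t}" and f = "\<lambda>s. f (x + s *\<^sub>R b)" and
        f' = "\<lambda>s h. h *\<^sub>R dpart b f (x + s *\<^sub>R b)"])
    fix s assume s: "s \<in> {0..t}"
    have "(f has_derivative (\<lambda>h. dpart h f (x + s *\<^sub>R b))) (at (x + s *\<^sub>R b))"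
      using d by (rule differentiable_has_derivative)
    then have "((\<lambda>s. f (x + s *\<^sub>R b)) has_derivative (\<lambda>h. dpart (h *\<^sub>R b) f (x + s *\<^sub>R b))) (at s within {0..t})"
      by (rule has_derivative_compose[rotated]) (auto intro!: derivative_eq_intros)
    moreover have "dpart (h *\<^sub>R b) f (x + s *\<^sub>R b) = h *\<^sub>R dpart b f (x + s *\<^sub>R b)" for h
      using linear_frechet_derivative[OF d] by (simp add: dpart_def linear_scale)
    ultimately show "((\<lambda>s. f (x + s *\<^sub>R b)) has_derivative (\<lambda>h. h *\<^sub>R dpart b f (x + s *\<^sub>R b))) (at s within {0..t})"
      by simp
    show "onorm (\<lambda>h. h *\<^sub>R dpart b f (x + s *\<^sub>R b)) \<le> B"
      using B[of s] s by (intro onorm_le) (auto simp: mult.commute[of B] mult_left_mono)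
  qed (use t in auto)
  then show ?thesis using t by simp
qed

text \<open>The derivative is written as a limit of difference quotients and the limit is taken
  outside the integral. For a difference quotient the claim is translation invariance of Lebesgue
  measure.\<close>

lemma fourier_dpart:
  fixes f :: "'a::euclidean_space \<Rightarrow> complex"
  assumes f: "f \<in> schwartz" and b: "b \<in> Basis"
  shows "fourier (dpart b f) \<xi> = \<i> * of_real (\<xi> \<bullet> b) * fourier f \<xi>"
proof -
  have db: "dpart b f \<in> schwartz" using f b by (rule schwartz_dpart)
  have [measurable]: "f \<in> borel_measurable borel" "dpart b f \<in> borel_measurable borel"
    using f db by (auto intro: schwartz_measurable)
  \<comment> \<open>Dominated convergence runs along a sequence; \<open>t m\<close> is positive,
    tends to 0, and stays below 1, which enters the domination below.\<close>
  define t :: "nat \<Rightarrow> real" where "t m = 1 / (real m + 1)" for m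
  have t: "0 < t m" "t m \<le> 1" for m by (auto simp: t_def)
  have t0: "t \<longlonglongrightarrow> 0"
    unfolding t_def using LIMSEQ_inverse_real_of_nat by (simp add: inverse_eq_divide add.commute)
  define e where "e x = exp (- \<i> * complex_of_real (x \<bullet> \<xi>))" for x
  have [measurable]: "e \<in> borel_measurable borel" unfolding e_def by measurable
  have e1: "cmod (e x) = 1" for x by (simp add: e_def)
  define q where "q m x = (f (x + t m *\<^sub>R b) - f x) / of_real (t m)" for m x
  have [measurable]: "q m \<in> borel_measurable borel" for m unfolding q_def by measurable
  let ?N = "2 * DIM('a)"
  obtain C where C: "0 \<le> C" "\<And>x. (1 + norm x) ^ ?N * cmod (dpart b f x) \<le> C"
    using rapidly_decayingE[OF schwartz_rapidly_decaying[OF db]] by metis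
  have qb: "cmod (q m x) \<le> 2 ^ ?N * C * (1 / (1 + norm x) ^ ?N)" for m x
  proof -
    have "cmod (f (x + t m *\<^sub>R b) - f x) \<le> 2 ^ ?N * C * (1 / (1 + norm x) ^ ?N) * t m"
    proof (rule difference_quotient_bound)
      fix s assume s: "0 \<le> s" "s \<le> t m"
      \<comment> \<open>The factor 2 comes from \<open>s \<le> 1\<close> and
        \<open>norm b = 1\<close>: moving the point by at most 1 at most doubles
        \<open>1 + norm x\<close>. This transfers the decay of the derivative from the segment to
        \<open>x\<close>.\<close>
      have "norm x - norm (s *\<^sub>R b) \<le> norm (x + s *\<^sub>R b)" by (rule norm_diff_ineq)
      then have "1 + norm x \<le> 2 * (1 + norm (x + s *\<^sub>R b))"
        using s t(2)[of m] norm_Basis[OF b] norm_ge_zero[of "x + s *\<^sub>R b"] 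
        unfolding norm_scaleR by (simp del: norm_ge_zero)
      then have "(1 + norm x) ^ ?N * cmod (dpart b f (x + s *\<^sub>R b)) \<le>
          (2 * (1 + norm (x + s *\<^sub>R b))) ^ ?N * cmod (dpart b f (x + s *\<^sub>R b))"
        by (intro mult_right_mono power_mono) auto
      also have "\<dots> \<le> 2 ^ ?N * C"
        using C(2)[of "x + s *\<^sub>R b"] by (simp only: power_mult_distrib mult.assoc) (intro mult_left_mono, auto)
      finally show "cmod (dpart b f (x + s *\<^sub>R b)) \<le> 2 ^ ?N * C * (1 / (1 + norm x) ^ ?N)"
        by (simp add: pos_le_divide_eq add_pos_nonneg mult.commute)
    qed (use t[of m] f schwartz_differentiable in auto)
    then show ?thesis
      using t(1)[of m] by (simp add: q_def norm_divide divide_le_eq)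
  qed
  have ql: "(\<lambda>m. q m x) \<longlonglongrightarrow> dpart b f x" for x
  proof -
    have "(f has_derivative (\<lambda>h. dpart h f x)) (at x)"
      using f by (intro differentiable_has_derivative schwartz_differentiable)
    moreover have "((\<lambda>s. x + s *\<^sub>R b) has_derivative (\<lambda>h. h *\<^sub>R b)) (at 0)"
      by (auto intro!: derivative_eq_intros)
    ultimately have "((\<lambda>s. f (x + s *\<^sub>R b)) has_derivative (\<lambda>h. dpart (h *\<^sub>R b) f x)) (at 0)"
      using has_derivative_compose[of "\<lambda>s. x + s *\<^sub>R b" "\<lambda>h. h *\<^sub>R b" 0 UNIV f "\<lambda>h. dpart h f x"]
      by simp
    moreover have "dpart (h *\<^sub>R b) f x = h *\<^sub>R dpart b f x" for h
      using linear_frechet_derivative[OF schwartz_differentiable[OF f]] by (simp add: dpart_def linear_scale)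
    ultimately have "((\<lambda>s. f (x + s *\<^sub>R b)) has_vector_derivative dpart b f x) (at 0)"
      by (simp add: has_vector_derivative_def)
    then have lim: "((\<lambda>s. norm (f (x + s *\<^sub>R b) - f x - s *\<^sub>R dpart b f x) / norm s) \<longlongrightarrow> 0) (at 0)"
      by (simp add: has_vector_derivative_def has_derivative_iff_norm)
    have "((\<lambda>s. norm ((f (x + s *\<^sub>R b) - f x) /\<^sub>R s - dpart b f x)) \<longlongrightarrow> 0) (at 0)"
    proof (rule Lim_transform_eventually[OF lim])
      have "norm (u - s *\<^sub>R v) / norm s = norm (u /\<^sub>R s - v)" if "s \<noteq> 0" for s :: real and u v :: complex
      proof -
        have "norm (u /\<^sub>R s - v) = norm ((u - s *\<^sub>R v) /\<^sub>R s)"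
          using that by (simp add: scaleR_diff_right)
        then show ?thesis by (simp only: norm_scaleR norm_inverse divide_inverse mult.commute real_norm_def abs_inverse)
      qed
      then show "\<forall>\<^sub>F s in at 0. norm (f (x + s *\<^sub>R b) - f x - s *\<^sub>R dpart b f x) / norm s =
          norm ((f (x + s *\<^sub>R b) - f x) /\<^sub>R s - dpart b f x)"
        by (intro eventually_mono[OF eventually_neq_at_within[of "0::real" 0 UNIV]])
    qed
    then have "((\<lambda>s. (f (x + s *\<^sub>R b) - f x) /\<^sub>R s) \<longlongrightarrow> dpart b f x) (at 0)"
      by (rule LIM_zero_cancel[OF tendsto_norm_zero_cancel])
    moreover have "filterlim t (at 0) sequentially"
      using t0 t(1) by (auto simp: filterlim_at less_imp_neq[symmetric])
    ultimately have "(\<lambda>m. (f (x + t m *\<^sub>R b) - f x) /\<^sub>R t m) \<longlonglongrightarrow> dpart b f x"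
      by (rule filterlim_compose)
    then show ?thesis
      unfolding q_def by (simp add: divide_inverse scaleR_conv_of_real mult.commute)
  qed
  have "(\<lambda>m. LINT x|lborel. q m x * e x) \<longlonglongrightarrow> (LINT x|lborel. dpart b f x * e x)"
  proof (rule integral_dominated_convergence[where w = "\<lambda>x. 2 ^ ?N * C * (1 / (1 + norm x) ^ ?N)"])
    show "integrable lborel (\<lambda>x::'a. 2 ^ ?N * C * (1 / (1 + norm x) ^ ?N))"
      by (intro integrable_mult_right integrable_decay)
  qed (auto simp: norm_mult e1 intro!: AE_I2 tendsto_mult ql tendsto_const qb[simplified])
  \<comment> \<open>A translation of \<open>f\<close> multiplies its transform by a phase. The
    transform of the quotient is thus the transform of \<open>f\<close> times the difference
    quotient of the exponential at 0.\<close>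
  moreover have "(LINT x|lborel. q m x * e x) =
      (iexp (t m * (\<xi> \<bullet> b)) - 1) / of_real (t m) * (LINT x|lborel. f x * e x)" for m
  proof -
    have i: "integrable lborel (\<lambda>x. f x * e x)"
      unfolding e_def by (intro integrable_mult_exp schwartz_integrable f)
    have sh: "f (x + t m *\<^sub>R b) * e x = iexp (t m * (\<xi> \<bullet> b)) * (f (t m *\<^sub>R b + 1 *\<^sub>R x) * e (t m *\<^sub>R b + 1 *\<^sub>R x))" for x
      by (simp add: e_def inner_add_left inner_commute[of b] algebra_simps flip: exp_add)
    have i': "integrable lborel (\<lambda>x. f (t m *\<^sub>R b + 1 *\<^sub>R x) * e (t m *\<^sub>R b + 1 *\<^sub>R x))"
      using integrable_lborel_affine_iff[of 1 "\<lambda>x. f x * e x" "t m *\<^sub>R b"] i by simp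
    have "(LINT x|lborel. q m x * e x) =
        (LINT x|lborel. (f (x + t m *\<^sub>R b) * e x - f x * e x) / of_real (t m))"
      by (simp add: q_def algebra_simps diff_divide_distrib)
    also have "\<dots> = ((LINT x|lborel. f (x + t m *\<^sub>R b) * e x) - (LINT x|lborel. f x * e x)) / of_real (t m)"
      unfolding sh using i i' by (simp del: scaleR_one)
    also have "(LINT x|lborel. f (x + t m *\<^sub>R b) * e x) = iexp (t m * (\<xi> \<bullet> b)) * (LINT x|lborel. f x * e x)"
      unfolding sh using integral_lborel_affine[of 1 "\<lambda>x. f x * e x" "t m *\<^sub>R b"] by simp
    finally show ?thesis by (simp add: algebra_simps diff_divide_distrib)
  qed
  moreover have "(\<lambda>m. (iexp (t m * (\<xi> \<bullet> b)) - 1) / of_real (t m) * (LINT x|lborel. f x * e x)) \<longlonglongrightarrow>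
      \<i> * of_real (\<xi> \<bullet> b) * (LINT x|lborel. f x * e x)"
  proof (intro tendsto_mult tendsto_const)
    have "((\<lambda>z. exp (\<i> * of_real (\<xi> \<bullet> b) * z)) has_field_derivative \<i> * of_real (\<xi> \<bullet> b)) (at 0)"
      by (auto intro!: derivative_eq_intros)
    then have "((\<lambda>z. (exp (\<i> * of_real (\<xi> \<bullet> b) * z) - 1) / z) \<longlongrightarrow> \<i> * of_real (\<xi> \<bullet> b)) (at 0)"
      by (simp add: has_field_derivative_iff)
    moreover have "filterlim (\<lambda>m. complex_of_real (t m)) (at 0) sequentially"
      using tendsto_of_real[OF t0, where 'a = complex] t(1) by (auto simp: filterlim_at less_imp_neq[symmetric])
    ultimately have "(\<lambda>m. (exp (\<i> * of_real (\<xi> \<bullet> b) * of_real (t m)) - 1) / of_real (t m)) \<longlonglongrightarrow> \<i> * of_real (\<xi> \<bullet> b)"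
      by (rule filterlim_compose)
    then show "(\<lambda>m. (iexp (t m * (\<xi> \<bullet> b)) - 1) / of_real (t m)) \<longlonglongrightarrow> \<i> * of_real (\<xi> \<bullet> b)"
      by (simp add: mult_ac)
  qed
  ultimately have "(LINT x|lborel. dpart b f x * e x) = \<i> * of_real (\<xi> \<bullet> b) * (LINT x|lborel. f x * e x)"
    by (simp add: LIMSEQ_unique)
  then show ?thesis
    by (simp add: fourier_def e_def)
qed

lemma fourier_schwartz:
  assumes "f \<in> schwartz"
  shows "fourier f \<in> schwartz"
proof (rule schwartz_coinduct[where S = "fourier ` schwartz"])
  fix g :: "'a \<Rightarrow> complex" and x b :: 'a
  assume "g \<in> fourier ` schwartz"
  then obtain f where g: "g = fourier f" and f: "f \<in> schwartz" by blast
  show "g differentiable (at x)"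
    unfolding g differentiable_def using fourier_has_derivative[OF f] by blast
  have "(\<lambda>x. - \<i> * of_real (x \<bullet> b) * f x) \<in> schwartz"
    using schwartz_cmult[OF schwartz_coordinate_mult[OF f, of b], of "- \<i>"] by (simp add: mult.assoc)
  then show "dpart b g \<in> fourier ` schwartz"
    unfolding g dpart_fourier[OF f] by blast
  \<comment> \<open>The induction generalizes over \<open>f\<close>: one more power of the weight is
    bounded by the coordinates of the frequency, and each of these is paid for by passing to a
    partial derivative of \<open>f\<close>.\<close>
  have "\<exists>C. \<forall>\<xi>. (1 + norm \<xi>) ^ k * cmod (fourier f \<xi>) \<le> C" for k
    using f
  proof (induction k arbitrary: f)
    case 0
    then show ?case using fourier_bounded[of f] by auto
  next
    case (Suc k)
    obtain C where C: "\<And>\<xi>. (1 + norm \<xi>) ^ k * cmod (fourier f \<xi>) \<le> C"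
      using Suc by blast
    have "\<forall>b\<in>Basis. \<exists>D. \<forall>\<xi>. (1 + norm \<xi>) ^ k * cmod (fourier (dpart b f) \<xi>) \<le> D"
      using Suc.IH[OF schwartz_dpart[OF Suc.prems]] by blast
    then obtain D where D: "\<And>b \<xi>. b \<in> Basis \<Longrightarrow> (1 + norm \<xi>) ^ k * cmod (fourier (dpart b f) \<xi>) \<le> D b"
      by metis
    have "(1 + norm \<xi>) ^ Suc k * cmod (fourier f \<xi>) \<le> C + (\<Sum>b\<in>Basis. D b)" for \<xi>
    proof -
      have "(1 + norm \<xi>) * cmod (fourier f \<xi>) \<le> (1 + (\<Sum>b\<in>Basis. \<bar>\<xi> \<bullet> b\<bar>)) * cmod (fourier f \<xi>)"
        by (intro mult_right_mono add_left_mono norm_le_l1) auto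
      also have "\<dots> = cmod (fourier f \<xi>) + (\<Sum>b\<in>Basis. cmod (fourier (dpart b f) \<xi>))"
        by (simp add: fourier_dpart[OF Suc.prems] norm_mult distrib_right sum_distrib_right)
      finally have "(1 + norm \<xi>) ^ k * ((1 + norm \<xi>) * cmod (fourier f \<xi>)) \<le>
          (1 + norm \<xi>) ^ k * (cmod (fourier f \<xi>) + (\<Sum>b\<in>Basis. cmod (fourier (dpart b f) \<xi>)))"
        by (intro mult_left_mono) auto
      also have "\<dots> = (1 + norm \<xi>) ^ k * cmod (fourier f \<xi>) +
          (\<Sum>b\<in>Basis. (1 + norm \<xi>) ^ k * cmod (fourier (dpart b f) \<xi>))"
        by (simp add: distrib_left sum_distrib_left)
      also have "\<dots> \<le> C + (\<Sum>b\<in>Basis. D b)"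
        by (intro add_mono sum_mono C D)
      finally show ?thesis by (simp add: mult_ac)
    qed
    then show ?case by blast
  qed
  then show "rapidly_decaying g"
    unfolding g rapidly_decaying_def by blast
qed (use assms in auto)

section \<open>Gaussian integrals and Fourier inversion\<close>

lemma integrable_lborel_prod_mult:
  fixes f :: "'a::euclidean_space \<Rightarrow> complex" and g :: "'b::euclidean_space \<Rightarrow> complex"
  assumes f: "integrable lborel f" and g: "integrable lborel g"
  shows "integrable (lborel \<Otimes>\<^sub>M lborel) (\<lambda>(x, y). f x * g y)"
proof -
  have [measurable]: "f \<in> borel_measurable borel" "g \<in> borel_measurable borel" using f g by auto
  show ?thesis
    using f g by (intro lborel_pair.Fubini_integrable) (auto simp: norm_mult)
qed

text \<open>Apart from the factor \<open>sqrt (2 * pi)\<close>, the integral is the characteristic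
  function of the standard normal distribution.\<close>

lemma integral_gaussian_real:
  "(LINT x|lborel. iexp (t * x) * of_real (exp (- x\<^sup>2 / 2))) = of_real (sqrt (2 * pi) * exp (- t\<^sup>2 / 2))"
  "integrable lborel (\<lambda>x. iexp (t * x) * of_real (exp (- x\<^sup>2 / 2)))"
proof -
  have d: "complex_of_real (exp (- x\<^sup>2 / 2)) = of_real (sqrt (2 * pi)) * of_real (std_normal_density x)" for x
    by (simp add: std_normal_density_def)
  have "of_real (exp (- t\<^sup>2 / 2)) = char std_normal_distribution t"
    by (simp add: char_std_normal_distribution)
  also have "\<dots> = (LINT x|lborel. std_normal_density x *\<^sub>R iexp (t * x))"
    unfolding char_def by (rule integral_density) auto
  finally have char: "of_real (exp (- t\<^sup>2 / 2)) = (LINT x|lborel. std_normal_density x *\<^sub>R iexp (t * x))" .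
  have "(LINT x|lborel. iexp (t * x) * of_real (exp (- x\<^sup>2 / 2))) =
      (LINT x|lborel. of_real (sqrt (2 * pi)) * (std_normal_density x *\<^sub>R iexp (t * x)))"
    unfolding d scaleR_conv_of_real by (intro Bochner_Integration.integral_cong refl) (simp only: mult_ac)
  then show "(LINT x|lborel. iexp (t * x) * of_real (exp (- x\<^sup>2 / 2))) = of_real (sqrt (2 * pi) * exp (- t\<^sup>2 / 2))"
    unfolding integral_mult_right_zero char[symmetric] by (simp only: of_real_mult)
  have "integrable lborel (\<lambda>x. complex_of_real (sqrt (2 * pi)) * of_real (std_normal_density x))"
    by (intro integrable_mult_right integrable_of_real) simp
  then show "integrable lborel (\<lambda>x. iexp (t * x) * of_real (exp (- x\<^sup>2 / 2)))"
    unfolding d by (rule Bochner_Integration.integrable_bound) (auto simp: norm_mult)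
qed

interpretation lborel_product: product_sigma_finite "\<lambda>_::'b. lborel :: real measure" ..

text \<open>Phase and Gaussian both factor over the coordinates, and Lebesgue measure is the image
  under \<open>T\<close> of the product of its one-dimensional versions. The integral becomes a
  product of one-dimensional ones.\<close>

lemma integral_gaussian:
  fixes \<xi> :: "'a::euclidean_space"
  shows "(LINT x|lborel. iexp (x \<bullet> \<xi>) * of_real (exp (- (norm x)\<^sup>2 / 2))) =
      of_real ((2 * pi) powr (real DIM('a) / 2) * exp (- (norm \<xi>)\<^sup>2 / 2))"
    and integrable_gaussian: "integrable lborel (\<lambda>x. iexp (x \<bullet> \<xi>) * of_real (exp (- (norm x)\<^sup>2 / 2)))"
proof -
  define G where "G b x = iexp ((\<xi> \<bullet> b) * x) * of_real (exp (- x\<^sup>2 / 2))" for b x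
  define T where "T f = (\<Sum>b\<in>Basis. f b *\<^sub>R b :: 'a)" for f
  have norm: "(norm x)\<^sup>2 = (\<Sum>b\<in>Basis. (x \<bullet> b)\<^sup>2)" for x :: 'a
    unfolding power2_norm_eq_inner euclidean_inner[of x x] by (simp add: power2_eq_square)
  have prod: "iexp (x \<bullet> \<xi>) * of_real (exp (- (norm x)\<^sup>2 / 2)) = (\<Prod>b\<in>Basis. G b (x \<bullet> b))" for x :: 'a
  proof -
    have "(\<Prod>b\<in>Basis. G b (x \<bullet> b)) =
        (\<Prod>b\<in>Basis. iexp ((\<xi> \<bullet> b) * (x \<bullet> b))) * of_real (\<Prod>b\<in>Basis. exp (- (x \<bullet> b)\<^sup>2 / 2))"
      by (simp add: G_def prod.distrib)
    also have "\<dots> = exp (\<Sum>b\<in>Basis. \<i> * of_real ((\<xi> \<bullet> b) * (x \<bullet> b))) * of_real (exp (\<Sum>b\<in>Basis. - (x \<bullet> b)\<^sup>2 / 2))"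
      by (simp add: exp_sum)
    also have "(\<Sum>b\<in>Basis. \<i> * complex_of_real ((\<xi> \<bullet> b) * (x \<bullet> b))) = \<i> * of_real (x \<bullet> \<xi>)"
      by (simp add: euclidean_inner[of x \<xi>] sum_distrib_left mult_ac)
    also have "(\<Sum>b\<in>Basis. - (x \<bullet> b)\<^sup>2 / 2) = - (norm x)\<^sup>2 / 2"
      by (simp add: norm sum_divide_distrib sum_negf)
    finally show ?thesis by simp
  qed
  have G: "integrable lborel (G b)" "integral\<^sup>L lborel (G b) = of_real (sqrt (2 * pi) * exp (- (\<xi> \<bullet> b)\<^sup>2 / 2))" for b
    unfolding G_def using integral_gaussian_real[of "\<xi> \<bullet> b"] by auto
  have T: "T \<in> (\<Pi>\<^sub>M b\<in>Basis. lborel) \<rightarrow>\<^sub>M borel"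
    unfolding T_def by measurable
  have eq: "lborel = distr (\<Pi>\<^sub>M b\<in>Basis. lborel) borel T"
    unfolding T_def by (rule lborel_eq)
  have inner_T: "T f \<bullet> b = f b" if "b \<in> Basis" for f b
    using that by (simp add: T_def inner_sum_left inner_Basis if_distrib cong: if_cong)
  have prodT: "iexp (T f \<bullet> \<xi>) * of_real (exp (- (norm (T f))\<^sup>2 / 2)) = (\<Prod>b\<in>Basis. G b (f b))" for f
    unfolding prod by (intro prod.cong) (auto simp: inner_T)
  have meas [measurable]: "(\<lambda>x::'a. iexp (x \<bullet> \<xi>) * of_real (exp (- (norm x)\<^sup>2 / 2))) \<in> borel_measurable borel"
    by measurable
  have "integrable (\<Pi>\<^sub>M b\<in>(Basis::'a set). lborel) (\<lambda>f. \<Prod>b\<in>Basis. G b (f b))"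
    by (intro lborel_product.product_integrable_prod G) auto
  then show "integrable lborel (\<lambda>x. iexp (x \<bullet> \<xi>) * of_real (exp (- (norm x)\<^sup>2 / 2)))"
    unfolding eq integrable_distr_eq[OF T meas] prodT .
  have "(LINT x|lborel. iexp (x \<bullet> \<xi>) * of_real (exp (- (norm x)\<^sup>2 / 2))) =
      integral\<^sup>L (\<Pi>\<^sub>M b\<in>(Basis::'a set). lborel) (\<lambda>f. \<Prod>b\<in>Basis. G b (f b))"
    unfolding eq integral_distr[OF T meas] prodT ..
  also have "\<dots> = (\<Prod>b\<in>(Basis::'a set). integral\<^sup>L lborel (G b))"
    by (intro lborel_product.product_integral_prod G) auto
  also have "\<dots> = of_real ((\<Prod>b\<in>(Basis::'a set). sqrt (2 * pi)) * (\<Prod>b\<in>Basis. exp (- (\<xi> \<bullet> b)\<^sup>2 / 2)))"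
    by (simp add: G prod.distrib)
  also have "(\<Prod>b\<in>Basis. exp (- (\<xi> \<bullet> b)\<^sup>2 / 2)) = exp (- (norm \<xi>)\<^sup>2 / 2)"
    by (simp add: norm sum_divide_distrib sum_negf flip: exp_sum)
  also have "(\<Prod>b\<in>(Basis::'a set). sqrt (2 * pi)) = (2 * pi) powr (real DIM('a) / 2)"
    by (simp add: powr_half_sqrt[symmetric] powr_powr flip: powr_realpow)
  finally show "(LINT x|lborel. iexp (x \<bullet> \<xi>) * of_real (exp (- (norm x)\<^sup>2 / 2))) =
      of_real ((2 * pi) powr (real DIM('a) / 2) * exp (- (norm \<xi>)\<^sup>2 / 2))" .
qed

text \<open>Gaussian regularization: inserting \<open>exp (- \<epsilon>\<^sup>2 |\<xi>|\<^sup>2 / 2)\<close> into the inversion integral turns it into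
  the convolution of \<open>f\<close> with an approximate identity.\<close>

lemma fourier_inversion:
  fixes f :: "'a::euclidean_space \<Rightarrow> complex"
  assumes f: "f \<in> schwartz"
  shows "fourier_inv (fourier f) x = f x"
proof -
  define c where "c = (2 * pi) powr (- real DIM('a) / 2)"
  have c: "c * (2 * pi) powr (real DIM('a) / 2) = 1"
    by (simp add: c_def flip: powr_add)
  have [measurable]: "f \<in> borel_measurable borel" "fourier f \<in> borel_measurable borel"
    using f fourier_schwartz[OF f] by (auto intro: schwartz_measurable)
  have iF: "integrable lborel (fourier f)" and if': "integrable lborel f"
    using f by (auto intro!: schwartz_integrable fourier_schwartz)
  define g where "g z = exp (- (norm z)\<^sup>2 / 2)" for z :: 'a
  have [measurable]: "g \<in> borel_measurable borel" unfolding g_def by measurable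
  have ig: "integrable lborel (\<lambda>z. complex_of_real (g z))"
    using integrable_gaussian[of "0::'a"] by (simp add: g_def)
  have g1: "0 \<le> g z" "g z \<le> 1" for z by (auto simp: g_def)
  define t :: "nat \<Rightarrow> real" where "t m = 1 / (real m + 1)" for m
  have t: "0 < t m" for m by (simp add: t_def)
  have t0: "t \<longlonglongrightarrow> 0"
    unfolding t_def using LIMSEQ_inverse_real_of_nat by (simp add: inverse_eq_divide add.commute)
  have cont_g: "isCont g z" for z
    unfolding g_def by (intro continuous_intros) auto
  have cont_f: "isCont f z" for z
    using schwartz_differentiable[OF f] differentiable_imp_continuous_within by blast
  define I where "I m = (LINT \<xi>|lborel. fourier f \<xi> * iexp (x \<bullet> \<xi>) * of_real (g (t m *\<^sub>R \<xi>)))" for m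
  have "I \<longlonglongrightarrow> (LINT \<xi>|lborel. fourier f \<xi> * iexp (x \<bullet> \<xi>))"
    unfolding I_def
  proof (rule integral_dominated_convergence[where w = "\<lambda>\<xi>. cmod (fourier f \<xi>)"])
    show "AE \<xi> in lborel. (\<lambda>m. fourier f \<xi> * iexp (x \<bullet> \<xi>) * of_real (g (t m *\<^sub>R \<xi>))) \<longlonglongrightarrow> fourier f \<xi> * iexp (x \<bullet> \<xi>)"
    proof (intro AE_I2)
      fix \<xi> :: 'a
      have "(\<lambda>m. g (t m *\<^sub>R \<xi>)) \<longlonglongrightarrow> g (0 *\<^sub>R \<xi>)"
        by (intro isCont_tendsto_compose[OF cont_g] tendsto_intros t0)
      then have "(\<lambda>m. fourier f \<xi> * iexp (x \<bullet> \<xi>) * of_real (g (t m *\<^sub>R \<xi>))) \<longlonglongrightarrow> fourier f \<xi> * iexp (x \<bullet> \<xi>) * of_real (g (0 *\<^sub>R \<xi>))"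
        by (intro tendsto_intros)
      then show "(\<lambda>m. fourier f \<xi> * iexp (x \<bullet> \<xi>) * of_real (g (t m *\<^sub>R \<xi>))) \<longlonglongrightarrow> fourier f \<xi> * iexp (x \<bullet> \<xi>)"
        by (simp add: g_def)
    qed
    show "AE \<xi> in lborel. norm (fourier f \<xi> * iexp (x \<bullet> \<xi>) * of_real (g (t m *\<^sub>R \<xi>))) \<le> cmod (fourier f \<xi>)" for m
      using g1 by (auto simp: norm_mult intro!: mult_left_le)
  qed (use iF in auto)
  \<comment> \<open>Fubini exposes the Gaussian integral in the frequency, which is again a
    Gaussian, in \<open>(x - y) /\<^sub>R t m\<close>. Substituting
    \<open>y = x + t m *\<^sub>R z\<close> removes the scale, and the powers of
    \<open>2 * pi\<close> cancel against \<open>c\<close>.\<close>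
  moreover have "I = (\<lambda>m. LINT z|lborel. f (x + t m *\<^sub>R z) * of_real (g z))"
  proof (rule ext)
    fix m
    let ?G = "\<lambda>y. complex_of_real (1 / \<bar>t m\<bar> ^ DIM('a) * (2 * pi) powr (real DIM('a) / 2) * g ((x - y) /\<^sub>R t m))"
    define h where "h \<xi> y = f y * exp (- \<i> * of_real (y \<bullet> \<xi>)) * (iexp (x \<bullet> \<xi>) * of_real (g (t m *\<^sub>R \<xi>)))" for \<xi> y
    have ig': "integrable lborel (\<lambda>\<xi>. complex_of_real (g (t m *\<^sub>R \<xi>)))"
      using integrable_lborel_scaleR_iff[of "t m" "\<lambda>z. complex_of_real (g z)"] ig t[of m] by simp
    have int: "integrable (lborel \<Otimes>\<^sub>M lborel) (case_prod h)"
    proof (rule Bochner_Integration.integrable_bound[OF integrable_lborel_prod_mult[OF ig' if']])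
      show "case_prod h \<in> borel_measurable (lborel \<Otimes>\<^sub>M lborel)"
        unfolding h_def by measurable
    qed (auto simp: h_def norm_mult)
    have "I m = of_real c * (LINT \<xi>|lborel. LINT y|lborel. h \<xi> y)"
    proof -
      have "(LINT y|lborel. h \<xi> y) = (LINT y|lborel. f y * exp (- \<i> * of_real (y \<bullet> \<xi>))) *
          (iexp (x \<bullet> \<xi>) * of_real (g (t m *\<^sub>R \<xi>)))" for \<xi>
        unfolding h_def by (rule integral_mult_left_zero)
      then have "of_real c * (LINT y|lborel. h \<xi> y) = fourier f \<xi> * iexp (x \<bullet> \<xi>) * of_real (g (t m *\<^sub>R \<xi>))" for \<xi>
        by (simp only: fourier_def c_def mult.assoc)
      then show ?thesis
        unfolding I_def by (simp only: integral_mult_right_zero[symmetric])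
    qed
    also have "(LINT \<xi>|lborel. LINT y|lborel. h \<xi> y) = (LINT y|lborel. LINT \<xi>|lborel. h \<xi> y)"
      using lborel_pair.Fubini_integral[OF int] by simp
    also have "\<dots> = (LINT y|lborel. f y * ?G y)"
    proof (intro Bochner_Integration.integral_cong refl)
      fix y
      have "(LINT \<xi>|lborel. h \<xi> y) = (LINT \<xi>|lborel. f y * (iexp ((t m *\<^sub>R \<xi>) \<bullet> ((x - y) /\<^sub>R t m)) * of_real (g (t m *\<^sub>R \<xi>))))"
      proof (intro Bochner_Integration.integral_cong refl)
        fix \<xi>
        have "(t m *\<^sub>R \<xi>) \<bullet> ((x - y) /\<^sub>R t m) = x \<bullet> \<xi> - y \<bullet> \<xi>"
          using t[of m] by (simp add: inner_diff_right inner_commute)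
        then show "h \<xi> y = f y * (iexp ((t m *\<^sub>R \<xi>) \<bullet> ((x - y) /\<^sub>R t m)) * of_real (g (t m *\<^sub>R \<xi>)))"
          by (simp add: h_def right_diff_distrib flip: exp_add)
      qed
      also have "\<dots> = f y * ((1 / \<bar>t m\<bar> ^ DIM('a)) *\<^sub>R (LINT \<xi>|lborel. iexp (\<xi> \<bullet> ((x - y) /\<^sub>R t m)) * of_real (g \<xi>)))"
        using integral_lborel_scaleR[of "t m" "\<lambda>\<xi>. iexp (\<xi> \<bullet> ((x - y) /\<^sub>R t m)) * of_real (g \<xi>)"] t[of m] by simp
      also have "\<dots> = f y * ?G y"
        unfolding g_def integral_gaussian by (simp add: scaleR_conv_of_real)
      finally show "(LINT \<xi>|lborel. h \<xi> y) = f y * ?G y" .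
    qed
    also have "\<dots> = of_real ((2 * pi) powr (real DIM('a) / 2)) *
        ((1 / \<bar>t m\<bar> ^ DIM('a)) *\<^sub>R (LINT y|lborel. f y * of_real (g ((x - y) /\<^sub>R t m))))"
      by (simp add: scaleR_conv_of_real mult_ac flip: integral_mult_right_zero)
    also have "(1 / \<bar>t m\<bar> ^ DIM('a)) *\<^sub>R (LINT y|lborel. f y * of_real (g ((x - y) /\<^sub>R t m))) =
        (LINT z|lborel. f (x + t m *\<^sub>R z) * of_real (g z))"
      using integral_lborel_affine[of "t m" "\<lambda>y. f y * complex_of_real (g ((x - y) /\<^sub>R t m))" x] t[of m]
      by (simp add: g_def)
    finally show "I m = (LINT z|lborel. f (x + t m *\<^sub>R z) * of_real (g z))"
      using c by (simp flip: mult.assoc of_real_mult)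
  qed
  moreover have "(\<lambda>m. LINT z|lborel. f (x + t m *\<^sub>R z) * of_real (g z)) \<longlonglongrightarrow> (LINT z|lborel. f x * of_real (g z))"
  proof -
    obtain B where B: "\<And>x. cmod (f x) \<le> B"
      using rapidly_decaying_bounded[OF schwartz_rapidly_decaying[OF f]] by blast
    show ?thesis
    proof (rule integral_dominated_convergence[where w = "\<lambda>z. B * g z"])
      show "AE z in lborel. (\<lambda>m. f (x + t m *\<^sub>R z) * of_real (g z)) \<longlonglongrightarrow> f x * of_real (g z)"
      proof (intro AE_I2)
        fix z :: 'a
        have "(\<lambda>m. f (x + t m *\<^sub>R z)) \<longlonglongrightarrow> f (x + 0 *\<^sub>R z)"
          by (intro isCont_tendsto_compose[OF cont_f] tendsto_intros t0)
        then show "(\<lambda>m. f (x + t m *\<^sub>R z) * of_real (g z)) \<longlonglongrightarrow> f x * of_real (g z)"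
          by (intro tendsto_intros) simp
      qed
      show "AE z in lborel. norm (f (x + t m *\<^sub>R z) * of_real (g z)) \<le> B * g z" for m
        using g1 B by (auto simp: norm_mult intro!: mult_right_mono)
      show "integrable lborel (\<lambda>z. B * g z)"
        using ig by (intro integrable_mult_right) (simp only: complex_of_real_integrable_eq)
    qed auto
  qed
  ultimately have "(LINT \<xi>|lborel. fourier f \<xi> * iexp (x \<bullet> \<xi>)) = (LINT z|lborel. f x * of_real (g z))"
    by (metis LIMSEQ_unique)
  also have "\<dots> = f x * of_real ((2 * pi) powr (real DIM('a) / 2))"
    using integral_gaussian[of "0::'a"] by (simp add: g_def)
  finally show ?thesis
    using c unfolding fourier_inv_def c_def[symmetric] by (simp flip: mult.assoc of_real_mult)
qed

lemma fourier_scaleR: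
  fixes f :: "'a::euclidean_space \<Rightarrow> complex"
  assumes a: "a \<noteq> 0"
  shows "fourier (\<lambda>x. f (a *\<^sub>R x)) \<xi> = of_real (1 / \<bar>a\<bar> ^ DIM('a)) * fourier f (\<xi> /\<^sub>R a)"
proof -
  have "x \<bullet> \<xi> = (a *\<^sub>R x) \<bullet> (\<xi> /\<^sub>R a)" for x :: 'a
    using a by simp
  then have "(LINT x|lborel. f (a *\<^sub>R x) * exp (- \<i> * of_real (x \<bullet> \<xi>))) =
      (LINT x|lborel. f (a *\<^sub>R x) * exp (- \<i> * of_real ((a *\<^sub>R x) \<bullet> (\<xi> /\<^sub>R a))))"
    by presburger
  also have "\<dots> = (1 / \<bar>a\<bar> ^ DIM('a)) *\<^sub>R (LINT x|lborel. f x * exp (- \<i> * of_real (x \<bullet> (\<xi> /\<^sub>R a))))"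
    by (rule integral_lborel_scaleR[OF a])
  finally show ?thesis by (simp add: fourier_def scaleR_conv_of_real)
qed

lemma fourier_inv_scaleR:
  fixes f :: "'a::euclidean_space \<Rightarrow> complex"
  assumes a: "a \<noteq> 0"
  shows "fourier_inv (\<lambda>x. f (a *\<^sub>R x)) \<xi> = of_real (1 / \<bar>a\<bar> ^ DIM('a)) * fourier_inv f (\<xi> /\<^sub>R a)"
  by (simp add: fourier_inv_eq fourier_scaleR[OF a])

lemma fourier_inv_schwartz:
  assumes "f \<in> schwartz"
  shows "fourier_inv f \<in> schwartz"
proof -
  have "(\<lambda>x. fourier f ((- 1) *\<^sub>R x)) \<in> schwartz"
    by (intro schwartz_scaleR fourier_schwartz assms) simp
  then show ?thesis by (simp add: fourier_inv_eq[abs_def])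
qed

text \<open>The left side is the test function at which \<open>lp_block\<close> evaluates its
  distribution, that is, the transposed multiplier. Fubini exhibits it as convolution of
  \<open>\<zeta>\<close> with the transform of the symbol, which is how Young's inequality reaches
  the blocks.\<close>

lemma fourier_mult_fourier_inv:
  fixes m \<zeta> :: "'a::euclidean_space \<Rightarrow> complex"
  assumes m: "m \<in> schwartz" and \<zeta>: "\<zeta> \<in> schwartz"
  shows "fourier (\<lambda>\<xi>. m \<xi> * fourier_inv \<zeta> \<xi>) x =
    (LINT y|lborel. of_real ((2 * pi) powr (- real DIM('a) / 2)) * fourier m (x - y) * \<zeta> y)"
proof -
  define c where "c = complex_of_real ((2 * pi) powr (- real DIM('a) / 2))"
  have [measurable]: "m \<in> borel_measurable borel" "\<zeta> \<in> borel_measurable borel"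
    using m \<zeta> by (auto intro: schwartz_measurable)
  define h where "h \<xi> y = m \<xi> * \<zeta> y * exp (- \<i> * of_real ((x - y) \<bullet> \<xi>))" for \<xi> y
  have int: "integrable (lborel \<Otimes>\<^sub>M lborel) (case_prod h)"
  proof (rule Bochner_Integration.integrable_bound[OF integrable_lborel_prod_mult[OF schwartz_integrable[OF m] schwartz_integrable[OF \<zeta>]]])
    show "case_prod h \<in> borel_measurable (lborel \<Otimes>\<^sub>M lborel)"
      unfolding h_def by measurable
  qed (auto simp: h_def norm_mult)
  have "m \<xi> * fourier_inv \<zeta> \<xi> * exp (- \<i> * of_real (\<xi> \<bullet> x)) = c * (LINT y|lborel. h \<xi> y)" for \<xi>
  proof -
    have "h \<xi> y = (m \<xi> * exp (- \<i> * of_real (\<xi> \<bullet> x))) * (\<zeta> y * exp (\<i> * of_real (\<xi> \<bullet> y)))" for y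
      by (simp add: h_def inner_commute inner_diff_right right_diff_distrib mult_ac flip: exp_add)
    then have "(LINT y|lborel. h \<xi> y) = (m \<xi> * exp (- \<i> * of_real (\<xi> \<bullet> x))) * (LINT y|lborel. \<zeta> y * exp (\<i> * of_real (\<xi> \<bullet> y)))"
      by (simp only: integral_mult_right_zero)
    then show ?thesis
      unfolding fourier_inv_def c_def[symmetric] by (simp only: mult_ac)
  qed
  then have "fourier (\<lambda>\<xi>. m \<xi> * fourier_inv \<zeta> \<xi>) x = c * (c * (LINT \<xi>|lborel. LINT y|lborel. h \<xi> y))"
    unfolding fourier_def c_def[symmetric] \<zeta> by simp
  also have "(LINT \<xi>|lborel. LINT y|lborel. h \<xi> y) = (LINT y|lborel. LINT \<xi>|lborel. h \<xi> y)"
    using lborel_pair.Fubini_integral[OF int] by simp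
  also have "c * (c * (LINT y|lborel. LINT \<xi>|lborel. h \<xi> y)) = (LINT y|lborel. c * (c * (LINT \<xi>|lborel. h \<xi> y)))"
    by (simp only: integral_mult_right_zero)
  also have "\<dots> = (LINT y|lborel. c * fourier m (x - y) * \<zeta> y)"
  proof (intro Bochner_Integration.integral_cong refl)
    fix y
    have "(LINT \<xi>|lborel. h \<xi> y) = (LINT \<xi>|lborel. m \<xi> * exp (- \<i> * of_real (\<xi> \<bullet> (x - y)))) * \<zeta> y"
      unfolding integral_mult_left_zero[symmetric]
      by (intro Bochner_Integration.integral_cong refl) (simp add: h_def inner_commute mult_ac)
    then show "c * (c * (LINT \<xi>|lborel. h \<xi> y)) = c * fourier m (x - y) * \<zeta> y"
      by (simp add: fourier_def c_def)
  qed
  finally show ?thesis unfolding c_def .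
qed

section \<open>The test spaces \<open>Z_test\<close> and \<open>D_test\<close>\<close>

lemma dparts_zero_on_open:
  assumes S: "open S" and f: "\<And>x. x \<in> S \<Longrightarrow> f x = 0" and "x \<in> S"
  shows "dparts bs f x = 0"
  using \<open>x \<in> S\<close>
proof (induction bs arbitrary: x)
  case (Cons b bs)
  have "((\<lambda>x. 0) has_derivative (\<lambda>h. 0)) (at x)" by simp
  then have "(dparts bs f has_derivative (\<lambda>h. 0)) (at x)"
    by (rule has_derivative_transform_within_open[OF _ S Cons.prems]) (simp add: Cons.IH)
  then show ?case by (simp add: dpart_eqI)
qed (use f in simp)

lemma Z_testD: "\<zeta> \<in> Z_test \<Longrightarrow> \<zeta> \<in> schwartz"
  by (simp add: Z_test_def)

text \<open>By inversion, transforming twice is a reflection. The derivatives at 0 of the transform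
  of \<open>fourier m\<close> are therefore those of \<open>m\<close> up to sign, and
  \<open>m\<close> vanishes near 0.\<close>

lemma fourier_mem_Z_test:
  assumes m: "m \<in> schwartz" and "0 < e" and z: "\<And>\<xi>. norm \<xi> < e \<Longrightarrow> m \<xi> = 0"
  shows "fourier m \<in> Z_test"
  unfolding Z_test_def
proof (intro CollectI conjI allI impI fourier_schwartz m)
  fix bs :: "'a list" assume bs: "set bs \<subseteq> Basis"
  have "fourier (fourier m) = (\<lambda>x. m ((- 1) *\<^sub>R x))"
  proof
    fix x
    show "fourier (fourier m) x = m ((- 1) *\<^sub>R x)"
      using fourier_inversion[OF m, of "- x"] by (simp add: fourier_inv_eq)
  qed
  moreover have "dparts bs m 0 = 0"
    by (rule dparts_zero_on_open[of "ball 0 e"]) (use \<open>0 < e\<close> z in auto)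
  ultimately show "dparts bs (fourier (fourier m)) 0 = 0"
    by (simp only: dparts_scaleR[OF schwartz_smooth[OF m] bs]) simp
qed

lemma dparts_cmult:
  assumes "smooth_fun f" "set bs \<subseteq> Basis"
  shows "dparts bs (\<lambda>x. c * f x) = (\<lambda>x. c * dparts bs f x)"
  using assms(2)
proof (induction bs)
  case (Cons b bs)
  have d: "dparts bs f differentiable (at x)" for x
    using assms(1) Cons.prems unfolding smooth_fun_def by auto
  have "dpart b (\<lambda>x. c * dparts bs f x) = (\<lambda>x. c * dpart b (dparts bs f) x)"
    using dpart_lincomb[OF d d, of b c 0] by auto
  then show ?case using Cons by simp
qed simp

lemma Z_test_cmult:
  assumes "\<zeta> \<in> Z_test"
  shows "(\<lambda>x. c * \<zeta> x) \<in> Z_test"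
proof -
  have "fourier (\<lambda>x. c * \<zeta> x) = (\<lambda>\<xi>. c * fourier \<zeta> \<xi>)"
    by (simp add: fun_eq_iff fourier_cmult)
  then show ?thesis
    using assms unfolding Z_test_def
    by (auto intro: schwartz_cmult simp: dparts_cmult schwartz_smooth fourier_schwartz)
qed

lemma Z_test_scaleR:
  assumes \<zeta>: "\<zeta> \<in> Z_test" and a: "a \<noteq> 0"
  shows "(\<lambda>x. \<zeta> (a *\<^sub>R x)) \<in> Z_test"
proof -
  have F: "fourier \<zeta> \<in> schwartz" using \<zeta> by (intro fourier_schwartz Z_testD)
  have "fourier (\<lambda>x. \<zeta> (a *\<^sub>R x)) = (\<lambda>\<xi>. of_real (1 / \<bar>a\<bar> ^ DIM('a)) * fourier \<zeta> (inverse a *\<^sub>R \<xi>))"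
    by (simp add: fun_eq_iff fourier_scaleR[OF a])
  then have "dparts bs (fourier (\<lambda>x. \<zeta> (a *\<^sub>R x))) 0 = 0" if bs: "set bs \<subseteq> Basis" for bs
    using \<zeta> bs by (simp only: dparts_cmult[OF smooth_fun_scaleR[OF schwartz_smooth[OF F]] bs]
        dparts_scaleR[OF schwartz_smooth[OF F] bs]) (simp add: Z_test_def)
  then show ?thesis
    unfolding Z_test_def using schwartz_scaleR[OF Z_testD[OF \<zeta>] a] by blast
qed

lemma Z_test_scaleR_iff:
  assumes a: "a \<noteq> 0"
  shows "(\<lambda>x. \<zeta> (a *\<^sub>R x)) \<in> Z_test \<longleftrightarrow> \<zeta> \<in> Z_test"
  using Z_test_scaleR[OF _ a, of \<zeta>] Z_test_scaleR[of "\<lambda>x. \<zeta> (a *\<^sub>R x)" "inverse a"] a by auto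

lemma schwartz_scaleR_iff:
  assumes a: "a \<noteq> 0"
  shows "(\<lambda>x. \<zeta> (a *\<^sub>R x)) \<in> schwartz \<longleftrightarrow> \<zeta> \<in> schwartz"
  using schwartz_scaleR[OF _ a, of \<zeta>] schwartz_scaleR[of "\<lambda>x. \<zeta> (a *\<^sub>R x)" "inverse a"] a by auto

lemma Z_test_cmult_iff:
  assumes "c \<noteq> 0"
  shows "(\<lambda>x. c * \<zeta> x) \<in> Z_test \<longleftrightarrow> \<zeta> \<in> Z_test"
  using Z_test_cmult[of \<zeta> c] Z_test_cmult[of "\<lambda>x. c * \<zeta> x" "1 / c"] assms by auto

text \<open>The integral is the derivative of order zero of the transform at the origin, up to a
  constant. This is why an additive constant in the logarithmic kernel has no effect.\<close>

lemma Z_test_integral_eq_0: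
  fixes \<zeta> :: "'a::euclidean_space \<Rightarrow> complex"
  assumes "\<zeta> \<in> Z_test"
  shows "(LINT x|lborel. \<zeta> x) = 0"
proof -
  have "dparts [] (fourier \<zeta>) 0 = 0"
    using assms unfolding Z_test_def by (auto dest!: spec[of _ "[]"])
  then show ?thesis by (simp add: fourier_def)
qed

text \<open>All derivatives vanish on the open complement of \<open>K\<close>, and on
  \<open>K\<close> the weighted derivatives are continuous, hence bounded.\<close>

lemma smooth_supp_in_schwartz:
  assumes K: "compact K" and f: "f \<in> smooth_supp_in K"
  shows "f \<in> schwartz"
  unfolding schwartz_iff
proof (intro allI impI conjI)
  fix bs :: "real list" and x assume bs: "set bs \<subseteq> Basis"
  have smooth: "smooth_fun f" and supp: "\<And>t. t \<notin> K \<Longrightarrow> f t = 0"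
    using f by (auto simp: smooth_supp_in_def)
  have d: "dparts bs f differentiable (at x)" for x
    using smooth bs unfolding smooth_fun_def by blast
  then show "dparts bs f differentiable (at x)" .
  have z: "dparts bs f x = 0" if "x \<notin> K" for x
    by (rule dparts_zero_on_open[of "- K"]) (use that K supp in \<open>auto simp: compact_imp_closed\<close>)
  have "continuous_on K (dparts bs f)"
    by (meson continuous_at_imp_continuous_on differentiable_imp_continuous_within d)
  then have "compact ((\<lambda>x. (1 + norm x) ^ k * cmod (dparts bs f x)) ` K)" for k
    by (intro compact_continuous_image continuous_intros K)
  then have "bounded ((\<lambda>x. (1 + norm x) ^ k * cmod (dparts bs f x)) ` K)" for k
    by (rule compact_imp_bounded)
  then have "\<exists>C. \<forall>x\<in>K. (1 + norm x) ^ k * cmod (dparts bs f x) \<le> C" for k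
    using bounded_imp_bdd_above[of "(\<lambda>x. (1 + norm x) ^ k * cmod (dparts bs f x)) ` K"]
    by (simp add: bdd_above_def)
  then have "\<exists>C. \<forall>x. (1 + norm x) ^ k * cmod (dparts bs f x) \<le> C" for k
  proof -
    obtain C where "\<forall>x\<in>K. (1 + norm x) ^ k * cmod (dparts bs f x) \<le> C"
      using \<open>\<exists>C. \<forall>x\<in>K. (1 + norm x) ^ k * cmod (dparts bs f x) \<le> C\<close> by blast
    then have "\<forall>x. (1 + norm x) ^ k * cmod (dparts bs f x) \<le> max 0 C"
      using z by (metis max.cobounded1 max.coboundedI2 mult_zero_right norm_zero)
    then show ?thesis by blast
  qed
  then show "rapidly_decaying (dparts bs f)" unfolding rapidly_decaying_def by blast
qed

lemma D_test_schwartz: "\<eta> \<in> D_test I \<Longrightarrow> \<eta> \<in> schwartz"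
  unfolding D_test_def using smooth_supp_in_schwartz by blast

lemma D_test_eq_0: "\<eta> \<in> D_test I \<Longrightarrow> t \<notin> I \<Longrightarrow> \<eta> t = 0"
  unfolding D_test_def smooth_supp_in_def by blast

section \<open>Dilations\<close>

text \<open>A real supremum is an upper bound only for a set that is bounded above. Boundedness
  follows since there are finitely many lists of length at most \<open>N\<close> over the basis,
  each giving a bounded weighted derivative.\<close>

lemma schwartz_seminorm_upper:
  assumes f: "f \<in> schwartz" and bs: "set bs \<subseteq> Basis" "length bs \<le> N"
  shows "(1 + norm x) ^ N * cmod (dparts bs f x) \<le> schwartz_seminorm N f"
proof -
  define A where "A = {bs :: 'a list. set bs \<subseteq> Basis \<and> length bs \<le> N}"
  have fin: "finite A" unfolding A_def by (rule finite_lists_length_le[OF finite_Basis])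
  have "\<exists>C. \<forall>x. (1 + norm x) ^ N * cmod (dparts bs f x) \<le> C" if "bs \<in> A" for bs
    using schwartz_rapidly_decaying[OF schwartz_dparts[OF f]] that
    unfolding rapidly_decaying_def A_def by blast
  then obtain C where C: "\<And>bs x. bs \<in> A \<Longrightarrow> (1 + norm x) ^ N * cmod (dparts bs f x) \<le> C bs"
    by metis
  have "bdd_above ((\<lambda>(bs, x). (1 + norm x) ^ N * cmod (dparts bs f x)) ` (A \<times> UNIV))"
  proof (rule bdd_aboveI2)
    fix p assume p: "p \<in> A \<times> (UNIV :: 'a set)"
    obtain bs x where p_eq: "p = (bs, x)" by fastforce
    have "(1 + norm x) ^ N * cmod (dparts bs f x) \<le> Max (C ` A)"
      using C[of bs x] p fin unfolding p_eq by (intro order_trans[OF C Max_ge]) auto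
    then show "(case p of (bs, x) \<Rightarrow> (1 + norm x) ^ N * cmod (dparts bs f x)) \<le> Max (C ` A)"
      by (simp add: p_eq)
  qed
  then have "(case (bs, x) of (bs, x) \<Rightarrow> (1 + norm x) ^ N * cmod (dparts bs f x)) \<le> schwartz_seminorm N f"
    unfolding schwartz_seminorm_def A_def[symmetric]
    by (rule cSUP_upper[rotated]) (use bs in \<open>auto simp: A_def\<close>)
  then show ?thesis by simp
qed

lemma schwartz_seminorm_least:
  assumes "\<And>bs x. set bs \<subseteq> Basis \<Longrightarrow> length bs \<le> N \<Longrightarrow> (1 + norm x) ^ N * cmod (dparts bs f x) \<le> C"
  shows "schwartz_seminorm N f \<le> C"
  unfolding schwartz_seminorm_def
proof (rule cSUP_least)
  have "([], 0) \<in> {bs. set bs \<subseteq> Basis \<and> length bs \<le> N} \<times> (UNIV :: 'a set)" by simp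
  then show "{bs. set bs \<subseteq> Basis \<and> length bs \<le> N} \<times> (UNIV :: 'a set) \<noteq> {}" by blast
qed (use assms in auto)

lemma schwartz_seminorm_nonneg: "f \<in> schwartz \<Longrightarrow> 0 \<le> schwartz_seminorm N f"
  using schwartz_seminorm_upper[of f "[]" N 0] by (auto intro: order_trans[OF norm_ge_zero])

text \<open>The constant is independent of \<open>f\<close>: at most \<open>N\<close> derivatives
  contribute powers of \<open>a\<close>, and the comparison of weights costs
  \<open>K ^ N\<close>.\<close>

lemma schwartz_seminorm_scaleR:
  assumes a: "a \<noteq> 0"
  obtains C where "0 \<le> C" "\<And>f :: 'a::euclidean_space \<Rightarrow> complex. f \<in> schwartz \<Longrightarrow>
    schwartz_seminorm N (\<lambda>x. f (a *\<^sub>R x)) \<le> C * schwartz_seminorm N f"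
proof
  define K where "K = 1 + 1 / \<bar>a\<bar>"
  have K: "1 + norm x \<le> K * (1 + norm (a *\<^sub>R x))" "0 \<le> K" for x :: 'a
    using a by (simp_all add: K_def field_simps)
  show "0 \<le> (1 + \<bar>a\<bar>) ^ N * K ^ N" using K by simp
  fix f :: "'a \<Rightarrow> complex" assume f: "f \<in> schwartz"
  show "schwartz_seminorm N (\<lambda>x. f (a *\<^sub>R x)) \<le> (1 + \<bar>a\<bar>) ^ N * K ^ N * schwartz_seminorm N f"
  proof (rule schwartz_seminorm_least)
    fix bs :: "'a list" and x assume bs: "set bs \<subseteq> Basis" "length bs \<le> N"
    have "\<bar>a\<bar> ^ length bs \<le> (1 + \<bar>a\<bar>) ^ length bs" by (intro power_mono) auto
    also have "\<dots> \<le> (1 + \<bar>a\<bar>) ^ N" by (intro power_increasing bs) auto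
    finally have a_le: "\<bar>a\<bar> ^ length bs \<le> (1 + \<bar>a\<bar>) ^ N" .
    have "(1 + norm x) ^ N * cmod (dparts bs (\<lambda>x. f (a *\<^sub>R x)) x) =
        (1 + norm x) ^ N * (\<bar>a\<bar> ^ length bs * cmod (dparts bs f (a *\<^sub>R x)))"
      by (simp add: dparts_scaleR[OF schwartz_smooth[OF f] bs(1)] norm_mult norm_power)
    also have "\<dots> \<le> (K * (1 + norm (a *\<^sub>R x))) ^ N * ((1 + \<bar>a\<bar>) ^ N * cmod (dparts bs f (a *\<^sub>R x)))"
      by (intro mult_mono power_mono K a_le mult_right_mono) (auto intro!: mult_nonneg_nonneg zero_le_power K)
    also have "\<dots> = (1 + \<bar>a\<bar>) ^ N * K ^ N * ((1 + norm (a *\<^sub>R x)) ^ N * cmod (dparts bs f (a *\<^sub>R x)))"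
      by (simp add: power_mult_distrib)
    also have "\<dots> \<le> (1 + \<bar>a\<bar>) ^ N * K ^ N * schwartz_seminorm N f"
      by (intro mult_left_mono schwartz_seminorm_upper f bs) (use K in auto)
    finally show "(1 + norm x) ^ N * cmod (dparts bs (\<lambda>x. f (a *\<^sub>R x)) x) \<le>
      (1 + \<bar>a\<bar>) ^ N * K ^ N * schwartz_seminorm N f" .
  qed
qed

text \<open>Holds at arguments outside \<open>Z_test\<close> as well: a nonzero multiple stays
  outside, where the functional is 0. Hence scalars can be pulled out at convolutions whose
  membership in \<open>Z_test\<close> is open.\<close>

lemma Z_dual_scalar:
  assumes u: "u \<in> Z_dual" and k: "k \<noteq> 0"
  shows "u (\<lambda>x. k * \<zeta> x) = k * u \<zeta>"
proof (cases "\<zeta> \<in> Z_test")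
  case True
  have "u (\<lambda>x. k * \<zeta> x + 0 * \<zeta> x) = k * u \<zeta> + 0 * u \<zeta>"
    using u True unfolding Z_dual_def lin_on_def by blast
  then show ?thesis by simp
next
  case False
  then show ?thesis
    using u Z_test_cmult_iff[OF k, of \<zeta>] by (simp add: Z_dual_def)
qed

lemma dilate_Z_dual:
  fixes u :: "'a::euclidean_space distr"
  assumes u: "u \<in> Z_dual" and a: "a \<noteq> 0"
  shows "dilate c a u \<in> Z_dual"
  unfolding Z_dual_def
proof (intro CollectI conjI allI impI)
  have a': "inverse a \<noteq> 0" using a by simp
  have lin: "\<And>f g c d. f \<in> Z_test \<Longrightarrow> g \<in> Z_test \<Longrightarrow> u (\<lambda>x. c * f x + d * g x) = c * u f + d * u g"
    using u unfolding Z_dual_def lin_on_def by blast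
  show "lin_on Z_test (dilate c a u)"
    unfolding lin_on_def dilate_def
  proof (intro ballI allI)
    fix f g :: "'a \<Rightarrow> complex" and k l assume "f \<in> Z_test" "g \<in> Z_test"
    then have "u (\<lambda>x. k * f (x /\<^sub>R a) + l * g (x /\<^sub>R a)) = k * u (\<lambda>x. f (x /\<^sub>R a)) + l * u (\<lambda>x. g (x /\<^sub>R a))"
      by (intro lin Z_test_scaleR a')
    then show "of_real (c / a ^ DIM('a)) * u (\<lambda>x. k * f (x /\<^sub>R a) + l * g (x /\<^sub>R a)) =
        k * (of_real (c / a ^ DIM('a)) * u (\<lambda>x. f (x /\<^sub>R a))) + l * (of_real (c / a ^ DIM('a)) * u (\<lambda>x. g (x /\<^sub>R a)))"
      by (simp only: distrib_left mult.left_commute)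
  qed
  obtain N C where C: "\<And>f. f \<in> Z_test \<Longrightarrow> cmod (u f) \<le> C * schwartz_seminorm N f"
    using u unfolding Z_dual_def by blast
  obtain D where D: "0 \<le> D" "\<And>f :: 'a \<Rightarrow> complex. f \<in> schwartz \<Longrightarrow>
      schwartz_seminorm N (\<lambda>x. f (inverse a *\<^sub>R x)) \<le> D * schwartz_seminorm N f"
    using schwartz_seminorm_scaleR[OF a'] by metis
  have "cmod (dilate c a u f) \<le> (\<bar>c / a ^ DIM('a)\<bar> * (\<bar>C\<bar> * D)) * schwartz_seminorm N f" if f: "f \<in> Z_test" for f
  proof -
    have "cmod (u (\<lambda>x. f (x /\<^sub>R a))) \<le> C * schwartz_seminorm N (\<lambda>x. f (x /\<^sub>R a))"
      by (intro C Z_test_scaleR f a')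
    \<comment> \<open>Nothing fixes the sign of \<open>C\<close>, so its absolute value is taken
      before the seminorm is estimated from above.\<close>
    also have "\<dots> \<le> \<bar>C\<bar> * schwartz_seminorm N (\<lambda>x. f (x /\<^sub>R a))"
      by (intro mult_right_mono schwartz_seminorm_nonneg Z_testD Z_test_scaleR f a') auto
    also have "\<dots> \<le> \<bar>C\<bar> * (D * schwartz_seminorm N f)"
      by (intro mult_left_mono D Z_testD f) auto
    finally have "\<bar>c / a ^ DIM('a)\<bar> * cmod (u (\<lambda>x. f (x /\<^sub>R a))) \<le>
        \<bar>c / a ^ DIM('a)\<bar> * (\<bar>C\<bar> * (D * schwartz_seminorm N f))"
      by (intro mult_left_mono) auto
    then show ?thesis by (simp only: dilate_def norm_mult norm_of_real mult.assoc)
  qed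
  then show "\<exists>N C. \<forall>f\<in>Z_test. cmod (dilate c a u f) \<le> C * schwartz_seminorm N f" by blast
  fix f :: "'a \<Rightarrow> complex" assume "f \<notin> Z_test"
  then have "(\<lambda>x. f (x /\<^sub>R a)) \<notin> Z_test"
    using Z_test_scaleR_iff[OF a', of f] by simp
  then show "dilate c a u f = 0"
    using u by (simp add: dilate_def Z_dual_def)
qed

section \<open>Kernels, operators, blocks and products under dilation of space\<close>

lemma conv_dilated:
  fixes \<zeta> :: "'a::euclidean_space \<Rightarrow> complex"
  assumes a: "0 < a"
  shows "conv k (\<lambda>y. \<zeta> (y /\<^sub>R a)) x = of_real (a ^ DIM('a)) * conv (\<lambda>z. k (a *\<^sub>R z)) \<zeta> (x /\<^sub>R a)"
proof -
  have "(LINT y|lborel. of_real (k (x - a *\<^sub>R y)) * \<zeta> ((a *\<^sub>R y) /\<^sub>R a)) =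
      (1 / \<bar>a\<bar> ^ DIM('a)) *\<^sub>R (LINT y|lborel. of_real (k (x - y)) * \<zeta> (y /\<^sub>R a))"
    using a by (intro integral_lborel_scaleR) auto
  moreover have "a *\<^sub>R (x /\<^sub>R a - y) = x - a *\<^sub>R y" "(a *\<^sub>R y) /\<^sub>R a = y" for y
    using a by (simp_all add: scaleR_diff_right)
  ultimately show ?thesis
    using a by (simp add: conv_def scaleR_conv_of_real field_simps)
qed

lemma conv_cmult_kernel: "conv (\<lambda>z. r * k z) \<zeta> x = of_real r * conv k \<zeta> x"
  by (simp add: conv_def mult.assoc)

lemma heat_kernel_dilated:
  fixes z :: "'a::euclidean_space"
  assumes a: "0 < a" and t: "0 < t"
  shows "heat_kernel (a\<^sup>2 * t) (a *\<^sub>R z) = 1 / a ^ DIM('a) * heat_kernel t z"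
proof -
  have "(4 * pi * (a\<^sup>2 * t)) powr (- real DIM('a) / 2) = (a\<^sup>2) powr (- real DIM('a) / 2) * (4 * pi * t) powr (- real DIM('a) / 2)"
    using a t by (subst powr_mult[symmetric]) (auto simp: mult_ac)
  also have "(a\<^sup>2) powr (- real DIM('a) / 2) = a powr (- real DIM('a))"
  proof -
    have "a\<^sup>2 = a powr 2" using a by simp
    then show ?thesis by (simp only: powr_powr) simp
  qed
  also have "\<dots> = 1 / a ^ DIM('a)"
    using a by (simp add: powr_minus_divide powr_realpow)
  finally show ?thesis
    using a t by (simp add: heat_kernel_def power_mult_distrib)
qed

lemma conv_heat_kernel_dilated:
  fixes \<zeta> :: "'a::euclidean_space \<Rightarrow> complex"
  assumes a: "0 < a" and t: "0 < t"
  shows "(\<lambda>x. conv (heat_kernel t) \<zeta> (x /\<^sub>R a)) = conv (heat_kernel (a\<^sup>2 * t)) (\<lambda>x. \<zeta> (x /\<^sub>R a))"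
proof
  fix x
  show "conv (heat_kernel t) \<zeta> (x /\<^sub>R a) = conv (heat_kernel (a\<^sup>2 * t)) (\<lambda>x. \<zeta> (x /\<^sub>R a)) x"
    unfolding conv_dilated[OF a] heat_kernel_dilated[OF a t] conv_cmult_kernel
    using a by (simp flip: mult.assoc of_real_mult)
qed

lemma borel_measurable_laplace_kernel [measurable]: "laplace_kernel \<in> borel_measurable borel"
  unfolding laplace_kernel_def by measurable

text \<open>In dimension 2 a dilation changes the kernel by a constant, which is annihilated by \<open>\<Z>\<close>.\<close>

lemma conv_laplace_kernel_dilated:
  fixes \<zeta> :: "'a::euclidean_space \<Rightarrow> complex"
  assumes a: "0 < a" and n: "2 \<le> DIM('a)" and \<zeta>: "\<zeta> \<in> Z_test"
  shows "conv laplace_kernel (\<lambda>x. \<zeta> (x /\<^sub>R a)) x = of_real (a\<^sup>2) * conv laplace_kernel \<zeta> (x /\<^sub>R a)"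
proof (cases "DIM('a) = 2")
  case True
  define \<kappa> where "\<kappa> = ln a / (2 * pi)"
  have [measurable]: "\<zeta> \<in> borel_measurable borel" using \<zeta> by (intro schwartz_measurable Z_testD)
  have int: "integrable lborel (\<lambda>y. of_real \<kappa> * \<zeta> y)"
    using \<zeta> by (intro integrable_mult_right schwartz_integrable Z_testD)
  have ker: "laplace_kernel (a *\<^sub>R z) = laplace_kernel z - \<kappa>" if "z \<noteq> 0" for z :: 'a
    using True that a by (simp add: laplace_kernel_def \<kappa>_def ln_mult field_simps)
  have "conv (\<lambda>z. laplace_kernel (a *\<^sub>R z)) \<zeta> x = conv laplace_kernel \<zeta> x" for x
  proof -
    let ?f = "\<lambda>y. of_real (laplace_kernel (x - y)) * \<zeta> y"
    have "conv (\<lambda>z. laplace_kernel (a *\<^sub>R z)) \<zeta> x = (LINT y|lborel. ?f y - of_real \<kappa> * \<zeta> y)"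
      unfolding conv_def
    proof (rule integral_cong_AE)
      \<comment> \<open>The point \<open>y = x\<close> is left out: there the logarithm has its
        default value and \<open>ker\<close> does not apply.\<close>
      show "AE y in lborel. of_real (laplace_kernel (a *\<^sub>R (x - y))) * \<zeta> y = ?f y - of_real \<kappa> * \<zeta> y"
        using AE_lborel_singleton[of x] by eventually_elim (simp add: ker left_diff_distrib)
    qed measurable
    \<comment> \<open>The subtracted term is integrable with integral 0. Either both integrands are
      integrable, with equal integrals, or neither is and both integrals are 0.\<close>
    also have "\<dots> = (LINT y|lborel. ?f y)"
    proof (cases "integrable lborel ?f")
      case True
      then show ?thesis using int Z_test_integral_eq_0[OF \<zeta>] by simp
    next
      case False
      moreover have "\<not> integrable lborel (\<lambda>y. ?f y - of_real \<kappa> * \<zeta> y)"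
      proof
        assume "integrable lborel (\<lambda>y. ?f y - of_real \<kappa> * \<zeta> y)"
        then have "integrable lborel (\<lambda>y. (?f y - of_real \<kappa> * \<zeta> y) + of_real \<kappa> * \<zeta> y)"
          using int by (rule Bochner_Integration.integrable_add)
        with False show False by simp
      qed
      ultimately show ?thesis by (simp add: not_integrable_integral_eq)
    qed
    finally show ?thesis by (simp add: conv_def)
  qed
  then show ?thesis using True by (simp add: conv_dilated[OF a])
next
  case False
  have "a powr (- (real DIM('a) - 2)) = a powr 2 / a powr real DIM('a)"
    by (simp flip: powr_diff)
  then have "a powr (- (real DIM('a) - 2)) = a\<^sup>2 / a ^ DIM('a)"
    using a by (simp only: powr_realpow powr_numeral)
  then have "laplace_kernel (a *\<^sub>R z) = (a\<^sup>2 / a ^ DIM('a)) * laplace_kernel z" for z :: 'a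
    using False a by (simp add: laplace_kernel_def powr_mult mult_ac)
  then have "conv (\<lambda>z. laplace_kernel (a *\<^sub>R z)) \<zeta> y = of_real (a\<^sup>2 / a ^ DIM('a)) * conv laplace_kernel \<zeta> y" for y
    by (simp only: conv_cmult_kernel)
  then show ?thesis
    using a by (simp add: conv_dilated[OF a])
qed

text \<open>Homogeneity at every argument is the form of linearity used here: the factor
  \<open>a\<^sup>2\<close> of the kernel is pulled out of \<open>u\<close> at
  \<open>conv laplace_kernel \<zeta>\<close>, which may or may not lie in \<open>Z_test\<close>.
  Differences of elements of \<open>Z_dual\<close>, to which this is applied, have it.\<close>

lemma inv_neg_laplace_dilate:
  fixes u :: "'a::euclidean_space distr"
  assumes a: "0 < a" and n: "2 \<le> DIM('a)" and u: "\<And>k \<zeta>. k \<noteq> 0 \<Longrightarrow> u (\<lambda>x. k * \<zeta> x) = k * u \<zeta>"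
  shows "inv_neg_laplace (dilate c a u) = dilate (c / a\<^sup>2) a (inv_neg_laplace u)"
proof
  fix \<zeta> :: "'a \<Rightarrow> complex"
  have Z: "(\<lambda>x. \<zeta> (x /\<^sub>R a)) \<in> Z_test \<longleftrightarrow> \<zeta> \<in> Z_test"
    using a by (intro Z_test_scaleR_iff) simp
  show "inv_neg_laplace (dilate c a u) \<zeta> = dilate (c / a\<^sup>2) a (inv_neg_laplace u) \<zeta>"
  proof (cases "\<zeta> \<in> Z_test")
    case True
    have "conv laplace_kernel (\<lambda>x. \<zeta> (x /\<^sub>R a)) = (\<lambda>x. of_real (a\<^sup>2) * conv laplace_kernel \<zeta> (x /\<^sub>R a))"
      using conv_laplace_kernel_dilated[OF a n True] by blast
    then have "u (conv laplace_kernel (\<lambda>x. \<zeta> (x /\<^sub>R a))) = of_real (a\<^sup>2) * u (\<lambda>x. conv laplace_kernel \<zeta> (x /\<^sub>R a))"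
      using u[of "of_real (a\<^sup>2)" "\<lambda>x. conv laplace_kernel \<zeta> (x /\<^sub>R a)"] a by simp
    then show ?thesis
      using True a by (simp add: inv_neg_laplace_def Z_restrict_def dilate_def Z)
  qed (simp add: inv_neg_laplace_def Z_restrict_def dilate_def Z)
qed

lemma dpart_dilated:
  assumes a: "a \<noteq> 0" and \<zeta>: "\<zeta> \<in> schwartz"
  shows "dpart b (\<lambda>x. \<zeta> (x /\<^sub>R a)) = (\<lambda>x. of_real (inverse a) * dpart b \<zeta> (x /\<^sub>R a))"
  by (intro ext dpart_scaleR schwartz_differentiable \<zeta>)

text \<open>Stated for homogeneous functionals because it is applied to
  \<open>potential_slice v w\<close>, of which homogeneity but not continuity has been
  established.\<close>

lemma dderiv_dilate:
  fixes u :: "'a::euclidean_space distr"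
  assumes a: "0 < a" and u: "\<And>k \<zeta>. k \<noteq> 0 \<Longrightarrow> u (\<lambda>x. k * \<zeta> x) = k * u \<zeta>"
  shows "dderiv b (dilate c a u) = dilate (c * a) a (dderiv b u)"
proof
  fix \<zeta> :: "'a \<Rightarrow> complex"
  have Z: "(\<lambda>x. \<zeta> (x /\<^sub>R a)) \<in> Z_test \<longleftrightarrow> \<zeta> \<in> Z_test"
    using a by (intro Z_test_scaleR_iff) simp
  show "dderiv b (dilate c a u) \<zeta> = dilate (c * a) a (dderiv b u) \<zeta>"
  proof (cases "\<zeta> \<in> Z_test")
    case True
    have "u (dpart b (\<lambda>x. \<zeta> (x /\<^sub>R a))) = of_real (inverse a) * u (\<lambda>x. dpart b \<zeta> (x /\<^sub>R a))"
      using u[of "of_real (inverse a)" "\<lambda>x. dpart b \<zeta> (x /\<^sub>R a)"] a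
        dpart_dilated[OF _ Z_testD[OF True], of a b] by simp
    then show ?thesis
      using True a by (simp add: dderiv_def Z_restrict_def dilate_def Z)
  qed (simp add: dderiv_def Z_restrict_def dilate_def Z)
qed

lemma heat_dilate:
  fixes u :: "'a::euclidean_space distr"
  assumes a: "0 < a" and t: "0 < t"
  shows "heat t (dilate c a u) = dilate c a (heat (a\<^sup>2 * t) u)"
proof
  fix \<zeta> :: "'a \<Rightarrow> complex"
  have Z: "(\<lambda>x. \<zeta> (x /\<^sub>R a)) \<in> Z_test \<longleftrightarrow> \<zeta> \<in> Z_test"
    using a by (intro Z_test_scaleR_iff) simp
  show "heat t (dilate c a u) \<zeta> = dilate c a (heat (a\<^sup>2 * t) u) \<zeta>"
    using conv_heat_kernel_dilated[OF a t, of \<zeta>] by (simp add: heat_def Z_restrict_def dilate_def Z)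
qed

text \<open>The Fourier transform turns a dilation of the test function into the inverse dilation of
  the frequency, so the dilation passes from \<open>u\<close> to the symbol of the block.\<close>

lemma lp_block_dilate:
  fixes u :: "'a::euclidean_space distr"
  assumes a: "0 < a"
  shows "lp_block \<theta> j (dilate c a u) = dilate c a (lp_block (\<lambda>\<xi>. \<theta> (a *\<^sub>R \<xi>)) j u)"
proof
  fix \<zeta> :: "'a \<Rightarrow> complex"
  define g where "g = (\<lambda>\<xi>. of_real (\<theta> (2 powi (- j) *\<^sub>R \<xi>)) * fourier_inv \<zeta> \<xi>)"
  have S: "(\<lambda>x. \<zeta> (x /\<^sub>R a)) \<in> schwartz \<longleftrightarrow> \<zeta> \<in> schwartz"
    using a by (intro schwartz_scaleR_iff) simp
  have "of_real (\<theta> (a *\<^sub>R (2 powi (- j) *\<^sub>R \<xi>))) * fourier_inv (\<lambda>x. \<zeta> (x /\<^sub>R a)) \<xi> =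
      of_real (a ^ DIM('a)) * g (a *\<^sub>R \<xi>)" for \<xi>
    using a fourier_inv_scaleR[of "inverse a" \<zeta> \<xi>] by (simp add: g_def power_inverse field_simps)
  then have "fourier (\<lambda>\<xi>. of_real (\<theta> (a *\<^sub>R (2 powi (- j) *\<^sub>R \<xi>))) * fourier_inv (\<lambda>x. \<zeta> (x /\<^sub>R a)) \<xi>) x =
      fourier g (x /\<^sub>R a)" for x
    using a by (simp add: fourier_cmult fourier_scaleR)
  then have "fourier (\<lambda>\<xi>. of_real (\<theta> (a *\<^sub>R (2 powi (- j) *\<^sub>R \<xi>))) * fourier_inv (\<lambda>x. \<zeta> (x /\<^sub>R a)) \<xi>) =
      (\<lambda>x. fourier g (x /\<^sub>R a))"
    by blast
  then show "lp_block \<theta> j (dilate c a u) \<zeta> = dilate c a (lp_block (\<lambda>\<xi>. \<theta> (a *\<^sub>R \<xi>)) j u) \<zeta>"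
    by (simp add: lp_block_def dilate_def S g_def)
qed

lemma tdilate_eq_dilate:
  "tdilate c a b U = (\<lambda>\<eta>. dilate (c / b) a (U (\<lambda>t. \<eta> (t / b))))"
  by (simp add: tdilate_def dilate_def fun_eq_iff field_simps)

lemma represented_by_dilate:
  fixes T :: "'a::euclidean_space distr"
  assumes a: "0 < a" and T: "represented_by T g"
  shows "represented_by (dilate c a T) (\<lambda>x. of_real c * g (a *\<^sub>R x))"
  unfolding represented_by_def
proof (intro conjI ballI)
  have [measurable]: "g \<in> borel_measurable borel" using T by (simp add: represented_by_def)
  show "(\<lambda>x. of_real c * g (a *\<^sub>R x)) \<in> borel_measurable lborel" by measurable
  fix \<zeta> :: "'a \<Rightarrow> complex" assume \<zeta>: "\<zeta> \<in> schwartz"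
  have S: "(\<lambda>x. \<zeta> (x /\<^sub>R a)) \<in> schwartz" using a \<zeta> by (intro schwartz_scaleR) auto
  have eq: "of_real c * g (a *\<^sub>R x) * \<zeta> x = of_real c * (g (a *\<^sub>R x) * \<zeta> ((a *\<^sub>R x) /\<^sub>R a))" for x
    using a by simp
  have "integrable lborel (\<lambda>x. g x * \<zeta> (x /\<^sub>R a))"
    using T S by (simp add: represented_by_def)
  then show "integrable lborel (\<lambda>x. of_real c * g (a *\<^sub>R x) * \<zeta> x)"
    unfolding eq using integrable_lborel_scaleR_iff[of a "\<lambda>x. g x * \<zeta> (x /\<^sub>R a)"] a
    by (intro integrable_mult_right) simp
  have "dilate c a T \<zeta> = of_real (c / a ^ DIM('a)) * (LINT x|lborel. g x * \<zeta> (x /\<^sub>R a))"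
    using T S by (simp add: represented_by_def dilate_def)
  also have "\<dots> = (LINT x|lborel. of_real c * (g (a *\<^sub>R x) * \<zeta> ((a *\<^sub>R x) /\<^sub>R a)))"
    using integral_lborel_scaleR[of a "\<lambda>x. g x * \<zeta> (x /\<^sub>R a)"] a
    by (simp add: scaleR_conv_of_real)
  finally show "dilate c a T \<zeta> = (LINT x|lborel. of_real c * g (a *\<^sub>R x) * \<zeta> x)"
    unfolding eq .
qed

lemma dyadic_partition_scaleR:
  assumes a: "0 < a" and \<theta>: "dyadic_partition r R \<theta>"
  shows "dyadic_partition (r / a) (R / a) (\<lambda>\<xi>. \<theta> (a *\<^sub>R \<xi>))"
  unfolding dyadic_partition_def
proof (intro conjI allI impI)
  note \<theta> = \<theta>[unfolded dyadic_partition_def]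
  have supp: "closure {\<xi>. \<theta> \<xi> \<noteq> 0} \<subseteq> {\<xi>. r \<le> norm \<xi> \<and> norm \<xi> \<le> R}"
    and sum: "\<xi> \<noteq> 0 \<Longrightarrow> ((\<lambda>j::int. \<theta> (2 powi (- j) *\<^sub>R \<xi>)) has_sum 1) UNIV" for \<xi>
    using \<theta> by simp_all
  show "(\<lambda>\<xi>. complex_of_real (\<theta> (a *\<^sub>R \<xi>))) \<in> schwartz"
    by (intro schwartz_scaleR[of "\<lambda>\<xi>. complex_of_real (\<theta> \<xi>)" a] \<theta>[THEN conjunct1]) (use a in simp)
  show "0 \<le> \<theta> (a *\<^sub>R \<xi>)" for \<xi> using \<theta> by blast
  have "closed {\<xi>::'a. r / a \<le> norm \<xi> \<and> norm \<xi> \<le> R / a}"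
    by (rule closed_Collect_conj; rule closed_Collect_le) (rule continuous_on_const continuous_on_norm_id)+
  moreover have "{\<xi>. \<theta> (a *\<^sub>R \<xi>) \<noteq> 0} \<subseteq> {\<xi>. r / a \<le> norm \<xi> \<and> norm \<xi> \<le> R / a}"
  proof
    fix \<xi> assume "\<xi> \<in> {\<xi>. \<theta> (a *\<^sub>R \<xi>) \<noteq> 0}"
    then have cl: "a *\<^sub>R \<xi> \<in> closure {\<xi>. \<theta> \<xi> \<noteq> 0}" by (intro closure_subset[THEN subsetD]) simp
    have "r \<le> norm (a *\<^sub>R \<xi>) \<and> norm (a *\<^sub>R \<xi>) \<le> R"
      using subsetD[OF supp cl] by (simp only: mem_Collect_eq)
    then show "\<xi> \<in> {\<xi>. r / a \<le> norm \<xi> \<and> norm \<xi> \<le> R / a}"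
      using a by (simp add: field_simps)
  qed
  ultimately show "closure {\<xi>. \<theta> (a *\<^sub>R \<xi>) \<noteq> 0} \<subseteq> {\<xi>. r / a \<le> norm \<xi> \<and> norm \<xi> \<le> R / a}"
    by (rule closure_minimal[rotated])
  fix \<xi> :: 'a assume "\<xi> \<noteq> 0"
  then have "((\<lambda>j::int. \<theta> (2 powi (- j) *\<^sub>R (a *\<^sub>R \<xi>))) has_sum 1) UNIV"
    using a by (intro sum) simp
  then show "((\<lambda>j::int. \<theta> (a *\<^sub>R (2 powi (- j) *\<^sub>R \<xi>))) has_sum 1) UNIV"
    by (simp only: scaleR_left_commute)
qed

text \<open>Testing the dilated factors with the partition \<open>\<theta>\<close> amounts to
  testing the original ones with its dilate, again a dyadic partition, of a different annulus. The
  quantification over all partitions and all annuli in \<open>is_product\<close> makes this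
  admissible for every \<open>a\<close>.\<close>

lemma is_product_dilate:
  fixes u v P :: "'a::euclidean_space distr"
  assumes a: "0 < a" and P: "is_product u v P"
  shows "is_product (dilate c a u) (dilate d a v) (dilate (c * d) a P)"
  unfolding is_product_def
proof (intro conjI allI impI)
  show "dilate (c * d) a P \<in> Z_dual"
    using a P by (intro dilate_Z_dual) (auto simp: is_product_def)
  fix \<theta> :: "'a \<Rightarrow> real" and r R :: real
  assume "0 < r \<and> r < R \<and> dyadic_partition r R \<theta>"
  then have "0 < r / a" "r / a < R / a" "dyadic_partition (r / a) (R / a) (\<lambda>\<xi>. \<theta> (a *\<^sub>R \<xi>))"
    using a by (auto simp: divide_strict_right_mono intro: dyadic_partition_scaleR)
  then have "\<exists>f g. (\<forall>j. represented_by (lp_block (\<lambda>\<xi>. \<theta> (a *\<^sub>R \<xi>)) j u) (f j)) \<and>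
      (\<forall>k. represented_by (lp_block (\<lambda>\<xi>. \<theta> (a *\<^sub>R \<xi>)) k v) (g k)) \<and>
      (\<forall>\<zeta>\<in>Z_test. (\<forall>j k. integrable lborel (\<lambda>x. f j x * g k x * \<zeta> x)) \<and>
        ((\<lambda>(j::int, k::int). LINT x|lborel. f j x * g k x * \<zeta> x) has_sum P \<zeta>) UNIV)"
    using P[unfolded is_product_def, THEN conjunct2, rule_format] by blast
  then obtain f g where
      f: "\<And>j. represented_by (lp_block (\<lambda>\<xi>. \<theta> (a *\<^sub>R \<xi>)) j u) (f j)" and
      g: "\<And>k. represented_by (lp_block (\<lambda>\<xi>. \<theta> (a *\<^sub>R \<xi>)) k v) (g k)" and
      int: "\<And>\<zeta> j k. \<zeta> \<in> Z_test \<Longrightarrow> integrable lborel (\<lambda>x. f j x * g k x * \<zeta> x)" and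
      sum: "\<And>\<zeta>. \<zeta> \<in> Z_test \<Longrightarrow> ((\<lambda>(j::int, k::int). LINT x|lborel. f j x * g k x * \<zeta> x) has_sum P \<zeta>) UNIV"
    by blast
  show "\<exists>f g. (\<forall>j. represented_by (lp_block \<theta> j (dilate c a u)) (f j)) \<and>
      (\<forall>k. represented_by (lp_block \<theta> k (dilate d a v)) (g k)) \<and>
      (\<forall>\<zeta>\<in>Z_test. (\<forall>j k. integrable lborel (\<lambda>x. f j x * g k x * \<zeta> x)) \<and>
        ((\<lambda>(j, k). LINT x|lborel. f j x * g k x * \<zeta> x) has_sum dilate (c * d) a P \<zeta>) UNIV)"
  proof (intro exI conjI allI ballI)
    show "represented_by (lp_block \<theta> j (dilate c a u)) (\<lambda>x. of_real c * f j (a *\<^sub>R x))" for j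
      unfolding lp_block_dilate[OF a] by (intro represented_by_dilate a f)
    show "represented_by (lp_block \<theta> k (dilate d a v)) (\<lambda>x. of_real d * g k (a *\<^sub>R x))" for k
      unfolding lp_block_dilate[OF a] by (intro represented_by_dilate a g)
    fix \<zeta> :: "'a \<Rightarrow> complex" assume \<zeta>: "\<zeta> \<in> Z_test"
    have Z: "(\<lambda>x. \<zeta> (x /\<^sub>R a)) \<in> Z_test" using a \<zeta> by (intro Z_test_scaleR) auto
    have eq: "of_real c * f j (a *\<^sub>R x) * (of_real d * g k (a *\<^sub>R x)) * \<zeta> x =
        of_real (c * d) * (f j (a *\<^sub>R x) * g k (a *\<^sub>R x) * \<zeta> ((a *\<^sub>R x) /\<^sub>R a))" for x j k
      using a by simp
    show "integrable lborel (\<lambda>x. of_real c * f j (a *\<^sub>R x) * (of_real d * g k (a *\<^sub>R x)) * \<zeta> x)" for j k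
      unfolding eq using integrable_lborel_scaleR_iff[of a "\<lambda>x. f j x * g k x * \<zeta> (x /\<^sub>R a)"] a int[OF Z, of j k]
      by (intro integrable_mult_right) simp
    have "(LINT x|lborel. of_real c * f j (a *\<^sub>R x) * (of_real d * g k (a *\<^sub>R x)) * \<zeta> x) =
        of_real (c * d / a ^ DIM('a)) * (LINT x|lborel. f j x * g k x * \<zeta> (x /\<^sub>R a))" for j k
      unfolding eq using integral_lborel_scaleR[of a "\<lambda>x. f j x * g k x * \<zeta> (x /\<^sub>R a)"] a
      by (simp add: scaleR_conv_of_real)
    then show "((\<lambda>(j, k). LINT x|lborel. of_real c * f j (a *\<^sub>R x) * (of_real d * g k (a *\<^sub>R x)) * \<zeta> x)
        has_sum dilate (c * d) a P \<zeta>) UNIV"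
      using has_sum_cmult_right[OF sum[OF Z], of "of_real (c * d / a ^ DIM('a))"]
      by (simp add: dilate_def case_prod_unfold)
  qed
qed

section \<open>Distributions in time under parabolic dilation\<close>

lemma smooth_supp_in_dilated:
  assumes b: "0 < b" and \<eta>: "\<eta> \<in> smooth_supp_in K"
  shows "(\<lambda>t. \<eta> (t / b)) \<in> smooth_supp_in ((\<lambda>t. b * t) ` K)"
proof -
  have "(\<lambda>t. \<eta> (inverse b *\<^sub>R t)) = (\<lambda>t. \<eta> (t / b))"
    by (simp add: divide_inverse mult.commute)
  moreover have "smooth_fun (\<lambda>t. \<eta> (inverse b *\<^sub>R t))"
    using \<eta> by (intro smooth_fun_scaleR) (simp add: smooth_supp_in_def)
  moreover have "\<eta> (t / b) = 0" if "t \<notin> (\<lambda>t. b * t) ` K" for t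
  proof -
    have "t / b \<notin> K"
    proof
      assume "t / b \<in> K"
      then have "b * (t / b) \<in> (\<lambda>t. b * t) ` K" by (rule imageI)
      with that b show False by simp
    qed
    then show ?thesis using \<eta> by (simp add: smooth_supp_in_def)
  qed
  ultimately show ?thesis by (simp add: smooth_supp_in_def)
qed

lemma compact_dilated:
  fixes K :: "real set"
  assumes "0 < b" "compact K" "K \<subseteq> {0<..}"
  shows "compact ((\<lambda>t. b * t) ` K)" "(\<lambda>t. b * t) ` K \<subseteq> {0<..}"
  using assms by (auto intro!: compact_continuous_image continuous_intros)

lemma D_test_dilated:
  assumes b: "0 < b" and \<eta>: "\<eta> \<in> D_test {0<..}"
  shows "(\<lambda>t. \<eta> (t / b)) \<in> D_test {0<..}"
proof -
  obtain K where K: "compact K" "K \<subseteq> {0<..}" "\<eta> \<in> smooth_supp_in K"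
    using \<eta> unfolding D_test_def by blast
  show ?thesis
    unfolding D_test_def using compact_dilated[OF b K(1,2)] smooth_supp_in_dilated[OF b K(3)] by blast
qed

lemma D_test_dilated_iff:
  assumes b: "0 < b"
  shows "(\<lambda>t. \<eta> (t / b)) \<in> D_test {0<..} \<longleftrightarrow> \<eta> \<in> D_test {0<..}"
  using D_test_dilated[OF b, of \<eta>] D_test_dilated[of "1 / b" "\<lambda>t. \<eta> (t / b)"] b by auto

lemma time_interval_infinity [simp]: "time_interval \<infinity> = {0<..}"
  by (auto simp: time_interval_def)

lemma lin_onD: "lin_on X u \<Longrightarrow> f \<in> X \<Longrightarrow> g \<in> X \<Longrightarrow> u (\<lambda>x. c * f x + d * g x) = c * u f + d * u g"
  unfolding lin_on_def by blast

lemma tdilate_Z_distributions: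
  fixes U :: "'a::euclidean_space tdistr"
  assumes U: "U \<in> Z_distributions {0<..}" and a: "0 < a" and b: "0 < b"
  shows "tdilate c a b U \<in> Z_distributions {0<..}"
  unfolding Z_distributions_def
proof (intro CollectI conjI ballI allI impI)
  note U = U[unfolded Z_distributions_def, THEN CollectD]
  have Z: "(\<lambda>x. \<zeta> (x /\<^sub>R a)) \<in> Z_test" if "\<zeta> \<in> Z_test" for \<zeta> :: "'a \<Rightarrow> complex"
    using a that by (intro Z_test_scaleR) auto
  show "tdilate c a b U \<eta> \<in> Z_dual" if "\<eta> \<in> D_test {0<..}" for \<eta>
    unfolding tdilate_eq_dilate using U D_test_dilated[OF b that] a by (intro dilate_Z_dual) auto
  show "lin_on (D_test {0<..}) (\<lambda>\<eta>. tdilate c a b U \<eta> \<zeta>)" if \<zeta>: "\<zeta> \<in> Z_test" for \<zeta>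
    unfolding lin_on_def tdilate_def
  proof (intro ballI allI)
    fix f g :: "real \<Rightarrow> complex" and k l
    assume fg: "f \<in> D_test {0<..}" "g \<in> D_test {0<..}"
    have "lin_on (D_test {0<..}) (\<lambda>\<eta>. U \<eta> (\<lambda>x. \<zeta> (x /\<^sub>R a)))"
      using U Z[OF \<zeta>] by blast
    note lin = lin_onD[where u = "\<lambda>\<eta>. U \<eta> (\<lambda>x. \<zeta> (x /\<^sub>R a))" and f = "\<lambda>t. f (t / b)" and g = "\<lambda>t. g (t / b)",
        OF this D_test_dilated[OF b fg(1)] D_test_dilated[OF b fg(2)]]
    have "U (\<lambda>t. k * f (t / b) + l * g (t / b)) (\<lambda>x. \<zeta> (x /\<^sub>R a)) =
        k * U (\<lambda>t. f (t / b)) (\<lambda>x. \<zeta> (x /\<^sub>R a)) + l * U (\<lambda>t. g (t / b)) (\<lambda>x. \<zeta> (x /\<^sub>R a))"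
      by (rule lin)
    then show "of_real (c / (a ^ DIM('a) * b)) * U (\<lambda>t. k * f (t / b) + l * g (t / b)) (\<lambda>x. \<zeta> (x /\<^sub>R a)) =
        k * (of_real (c / (a ^ DIM('a) * b)) * U (\<lambda>t. f (t / b)) (\<lambda>x. \<zeta> (x /\<^sub>R a))) +
        l * (of_real (c / (a ^ DIM('a) * b)) * U (\<lambda>t. g (t / b)) (\<lambda>x. \<zeta> (x /\<^sub>R a)))"
      by (simp only: distrib_left mult.left_commute)
  qed
  show "\<exists>N C. \<forall>\<eta>\<in>smooth_supp_in K. cmod (tdilate c a b U \<eta> \<zeta>) \<le> C * schwartz_seminorm N \<eta>"
    if K: "compact K \<and> K \<subseteq> {0<..}" and \<zeta>: "\<zeta> \<in> Z_test" for K \<zeta>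
  proof -
    obtain N C where C: "\<And>\<eta>. \<eta> \<in> smooth_supp_in ((\<lambda>t. b * t) ` K) \<Longrightarrow>
        cmod (U \<eta> (\<lambda>x. \<zeta> (x /\<^sub>R a))) \<le> C * schwartz_seminorm N \<eta>"
      using U[THEN conjunct2, THEN conjunct2, THEN conjunct1, THEN spec, THEN mp, THEN bspec,
          OF conjI[OF compact_dilated[OF b conjunct1[OF K] conjunct2[OF K]]] Z[OF \<zeta>]] by blast
    have ib: "inverse b \<noteq> 0" using b by simp
    obtain D where D: "0 \<le> D" "\<And>f :: real \<Rightarrow> complex. f \<in> schwartz \<Longrightarrow>
        schwartz_seminorm N (\<lambda>t. f (inverse b *\<^sub>R t)) \<le> D * schwartz_seminorm N f"
      using schwartz_seminorm_scaleR[OF ib] by metis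
    have "cmod (tdilate c a b U \<eta> \<zeta>) \<le> (\<bar>c / (a ^ DIM('a) * b)\<bar> * (\<bar>C\<bar> * D)) * schwartz_seminorm N \<eta>"
      if \<eta>: "\<eta> \<in> smooth_supp_in K" for \<eta>
    proof -
      have S: "\<eta> \<in> schwartz" by (rule smooth_supp_in_schwartz[OF conjunct1[OF K] \<eta>])
      have eq: "(\<lambda>t. \<eta> (inverse b *\<^sub>R t)) = (\<lambda>t. \<eta> (t / b))"
        by (simp add: divide_inverse mult.commute)
      have S': "(\<lambda>t. \<eta> (t / b)) \<in> schwartz"
        using schwartz_scaleR[OF S, of "inverse b"] b unfolding eq by simp
      have "cmod (U (\<lambda>t. \<eta> (t / b)) (\<lambda>x. \<zeta> (x /\<^sub>R a))) \<le> C * schwartz_seminorm N (\<lambda>t. \<eta> (t / b))"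
        by (intro C smooth_supp_in_dilated b \<eta>)
      also have "\<dots> \<le> \<bar>C\<bar> * schwartz_seminorm N (\<lambda>t. \<eta> (t / b))"
        by (intro mult_right_mono schwartz_seminorm_nonneg S') auto
      also have "\<dots> \<le> \<bar>C\<bar> * (D * schwartz_seminorm N \<eta>)"
        using D(2)[OF S] unfolding eq by (intro mult_left_mono) auto
      finally have "\<bar>c / (a ^ DIM('a) * b)\<bar> * cmod (U (\<lambda>t. \<eta> (t / b)) (\<lambda>x. \<zeta> (x /\<^sub>R a))) \<le>
          \<bar>c / (a ^ DIM('a) * b)\<bar> * (\<bar>C\<bar> * (D * schwartz_seminorm N \<eta>))"
        by (intro mult_left_mono) auto
      then show ?thesis by (simp only: tdilate_def norm_mult norm_of_real mult.assoc)
    qed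
    then show ?thesis by blast
  qed
  show "tdilate c a b U \<eta> = (\<lambda>_. 0)" if "\<eta> \<notin> D_test {0<..}" for \<eta>
  proof -
    have "U (\<lambda>t. \<eta> (t / b)) = (\<lambda>_. 0)"
      using U[THEN conjunct2, THEN conjunct2, THEN conjunct2, THEN spec, THEN mp] that D_test_dilated_iff[OF b, of \<eta>] by simp
    then show ?thesis by (simp add: tdilate_def)
  qed
qed

lemma integrable_mult_real_iff:
  fixes h :: "real \<Rightarrow> complex"
  shows "0 < b \<Longrightarrow> integrable lborel (\<lambda>t. h (b * t)) \<longleftrightarrow> integrable lborel h"
  using integrable_lborel_scaleR_iff[of b h] by simp

lemma integral_mult_real:
  fixes h :: "real \<Rightarrow> complex"
  shows "0 < b \<Longrightarrow> (LINT t|lborel. h (b * t)) = of_real (1 / b) * (LINT t|lborel. h t)"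
  using integral_lborel_scaleR[of b h] by (simp add: scaleR_conv_of_real)

lemma time_slices_tdilate:
  fixes U :: "'a::euclidean_space tdistr"
  assumes U: "time_slices U u" and a: "0 < a" and b: "0 < b"
  shows "time_slices (tdilate c a b U) (\<lambda>t. dilate c a (u (b * t)))"
  unfolding time_slices_def
proof (intro conjI allI impI ballI)
  show "dilate c a (u (b * t)) \<in> Z_dual" if "0 < t" for t
    using U a b that by (intro dilate_Z_dual) (auto simp: time_slices_def)
  fix \<eta> and \<zeta> :: "'a \<Rightarrow> complex"
  assume \<eta>: "\<eta> \<in> D_test {0<..}" and \<zeta>: "\<zeta> \<in> Z_test"
  \<comment> \<open>With the half line inside \<open>h\<close> as an indicator, the set integral
    becomes a plain one over the real line and \<open>s = b * t\<close> applies; the half line is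
    invariant under this substitution.\<close>
  define h where "h s = indicator {0<..} s *\<^sub>R (\<eta> (s / b) * u s (\<lambda>x. \<zeta> (x /\<^sub>R a)))" for s
  define k where "k = complex_of_real (c / a ^ DIM('a))"
  have "(\<lambda>x. \<zeta> (x /\<^sub>R a)) \<in> Z_test" using a \<zeta> by (intro Z_test_scaleR) auto
  then have h: "integrable lborel h" "U (\<lambda>t. \<eta> (t / b)) (\<lambda>x. \<zeta> (x /\<^sub>R a)) = integral\<^sup>L lborel h"
    using U D_test_dilated[OF b \<eta>]
    unfolding time_slices_def set_integrable_def set_lebesgue_integral_def h_def by auto
  have eq: "indicator {0<..} t *\<^sub>R (\<eta> t * dilate c a (u (b * t)) \<zeta>) = k * h (b * t)" for t
    using b by (auto simp: h_def k_def dilate_def indicator_def zero_less_mult_iff)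
  show "set_integrable lborel {0<..} (\<lambda>t. \<eta> t * dilate c a (u (b * t)) \<zeta>)"
    unfolding set_integrable_def eq using h(1) b by (intro integrable_mult_right) (simp add: integrable_mult_real_iff)
  show "tdilate c a b U \<eta> \<zeta> = (LINT t:{0<..}|lborel. \<eta> t * dilate c a (u (b * t)) \<zeta>)"
    unfolding set_lebesgue_integral_def eq integral_mult_right_zero integral_mult_real[OF b]
    using b by (simp add: tdilate_def h k_def)
qed

section \<open>Covariance of the Duhamel system\<close>

lemma conv_scalar: "conv k (\<lambda>x. c * \<zeta> x) = (\<lambda>x. c * conv k \<zeta> x)"
  by (simp add: conv_def[abs_def] mult.left_commute)

lemma inv_neg_laplace_scalar:
  assumes "\<And>k \<zeta>. k \<noteq> 0 \<Longrightarrow> u (\<lambda>x. k * \<zeta> x) = k * u \<zeta>" "k \<noteq> 0"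
  shows "inv_neg_laplace u (\<lambda>x. k * \<zeta> x) = k * inv_neg_laplace u \<zeta>"
  using assms by (simp add: inv_neg_laplace_def Z_restrict_def conv_scalar Z_test_cmult_iff)

lemma diff_scalar:
  assumes "v \<in> Z_dual" "w \<in> Z_dual" "k \<noteq> 0"
  shows "w (\<lambda>x. k * \<zeta> x) - v (\<lambda>x. k * \<zeta> x) = k * (w \<zeta> - v \<zeta>)"
  using assms by (simp add: Z_dual_scalar right_diff_distrib)

lemma diff_dilate: "(\<lambda>\<zeta>. dilate c a w \<zeta> - dilate c a v \<zeta>) = dilate c a (\<lambda>\<zeta>. w \<zeta> - v \<zeta>)"
  by (simp add: dilate_def right_diff_distrib)

text \<open>The weights are 2 for \<open>v\<close> and \<open>w\<close>, 2 - 2 = 0 for the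
  potential, and 1 for its gradient.\<close>

lemma dderiv_potential_slice_dilate:
  fixes v w :: "'a::euclidean_space distr"
  assumes a: "0 < a" and n: "2 \<le> DIM('a)" and vw: "v \<in> Z_dual" "w \<in> Z_dual"
  shows "dderiv b (potential_slice (dilate (a\<^sup>2) a v) (dilate (a\<^sup>2) a w)) =
    dilate a a (dderiv b (potential_slice v w))"
proof -
  have "potential_slice (dilate (a\<^sup>2) a v) (dilate (a\<^sup>2) a w) = dilate (a\<^sup>2 / a\<^sup>2) a (potential_slice v w)"
    unfolding potential_slice_def diff_dilate by (intro inv_neg_laplace_dilate a n diff_scalar vw)
  moreover have "potential_slice v w (\<lambda>x. k * \<zeta> x) = k * potential_slice v w \<zeta>" if "k \<noteq> 0" for k \<zeta>
    unfolding potential_slice_def by (intro inv_neg_laplace_scalar diff_scalar vw that)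
  ultimately show ?thesis
    using dderiv_dilate[OF a, of "potential_slice v w" b 1] a by simp
qed

text \<open>On \<open>\<Z>'\<close> this is \<open>a\<^sup>3 F(a\<^sup>2 \<tau>)(a x)\<close>. The factor inside the argument makes the transformation
  law of the Duhamel integrand hold even for the null set of times at which \<open>F \<tau>\<close> is arbitrary.\<close>

definition dilate_field :: "real \<Rightarrow> (real \<Rightarrow> 'a::euclidean_space \<Rightarrow> 'a distr) \<Rightarrow> real \<Rightarrow> 'a \<Rightarrow> 'a distr" where
  "dilate_field a F \<tau> b = (\<lambda>\<zeta>. of_real (a ^ 4 / a ^ DIM('a)) *
     F (a\<^sup>2 * \<tau>) b (\<lambda>x. of_real (inverse a) * \<zeta> (x /\<^sub>R a)))"

lemma dilate_field_eq_dilate: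
  fixes F :: "real \<Rightarrow> 'a::euclidean_space \<Rightarrow> 'a distr"
  assumes a: "0 < a" and F: "F (a\<^sup>2 * \<tau>) b \<in> Z_dual"
  shows "dilate_field a F \<tau> b = dilate (a\<^sup>2 * a) a (F (a\<^sup>2 * \<tau>) b)"
proof
  fix \<zeta> :: "'a \<Rightarrow> complex"
  have "F (a\<^sup>2 * \<tau>) b (\<lambda>x. of_real (inverse a) * \<zeta> (x /\<^sub>R a)) =
      of_real (inverse a) * F (a\<^sup>2 * \<tau>) b (\<lambda>x. \<zeta> (x /\<^sub>R a))"
    using a by (intro Z_dual_scalar F) simp
  moreover have "a ^ 4 / a ^ DIM('a) * inverse a = a\<^sup>2 * a / a ^ DIM('a)"
    using a by (simp add: power_numeral_reduce)
  ultimately show "dilate_field a F \<tau> b \<zeta> = dilate (a\<^sup>2 * a) a (F (a\<^sup>2 * \<tau>) b) \<zeta>"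
    unfolding dilate_field_def dilate_def by (simp only: mult.assoc[symmetric] of_real_mult[symmetric])
qed

text \<open>An exact identity for arbitrary \<open>F\<close>: differentiating
  \<open>\<zeta> (x /\<^sub>R a)\<close> produces the same inner factor \<open>inverse a\<close>
  that is built into \<open>dilate_field\<close>, so both sides evaluate \<open>F\<close> at the
  same function.\<close>

lemma ddiv_dilate_field:
  fixes F :: "real \<Rightarrow> 'a::euclidean_space \<Rightarrow> 'a distr"
  assumes a: "0 < a"
  shows "ddiv (dilate_field a F \<tau>) = dilate (a ^ 4) a (ddiv (F (a\<^sup>2 * \<tau>)))"
proof
  fix \<zeta> :: "'a \<Rightarrow> complex"
  have Z: "(\<lambda>x. \<zeta> (x /\<^sub>R a)) \<in> Z_test \<longleftrightarrow> \<zeta> \<in> Z_test"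
    using a by (intro Z_test_scaleR_iff) simp
  have "dderiv b (dilate_field a F \<tau> b) \<zeta> =
      of_real (a ^ 4 / a ^ DIM('a)) * dderiv b (F (a\<^sup>2 * \<tau>) b) (\<lambda>x. \<zeta> (x /\<^sub>R a))" for b
  proof (cases "\<zeta> \<in> Z_test")
    case True
    then show ?thesis
      using a dpart_dilated[OF _ Z_testD[OF True], of a b]
      by (simp add: dderiv_def Z_restrict_def dilate_field_def Z)
  qed (simp add: dderiv_def Z_restrict_def Z)
  then show "ddiv (dilate_field a F \<tau>) \<zeta> = dilate (a ^ 4) a (ddiv (F (a\<^sup>2 * \<tau>))) \<zeta>"
    by (simp add: ddiv_def dilate_def sum_distrib_left)
qed

text \<open>The divergence contributes \<open>a ^ 4\<close> and the substitution
  \<open>\<tau> \<mapsto> a\<^sup>2 * \<tau>\<close> the Jacobian \<open>1 / a\<^sup>2\<close>,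
  leaving the weight 2 of the solution. The heat operator fits because
  \<open>a\<^sup>2 * (t - \<tau>)\<close> is the elapsed time after the substitution.\<close>

lemma duhamel_integral_dilate:
  fixes F :: "real \<Rightarrow> 'a::euclidean_space \<Rightarrow> 'a distr" and \<zeta> :: "'a \<Rightarrow> complex"
  assumes a: "0 < a"
    and int: "set_integrable lborel {0<..<a\<^sup>2 * t} (\<lambda>\<tau>. heat (a\<^sup>2 * t - \<tau>) (ddiv (F \<tau>)) (\<lambda>x. \<zeta> (x /\<^sub>R a)))"
  shows "set_integrable lborel {0<..<t} (\<lambda>\<tau>. heat (t - \<tau>) (ddiv (dilate_field a F \<tau>)) \<zeta>)"
    and "(LINT \<tau>:{0<..<t}|lborel. heat (t - \<tau>) (ddiv (dilate_field a F \<tau>)) \<zeta>) =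
      of_real (a\<^sup>2 / a ^ DIM('a)) *
      (LINT \<tau>:{0<..<a\<^sup>2 * t}|lborel. heat (a\<^sup>2 * t - \<tau>) (ddiv (F \<tau>)) (\<lambda>x. \<zeta> (x /\<^sub>R a)))"
proof -
  have a2: "0 < a\<^sup>2" using a by simp
  define h where "h \<tau> = indicator {0<..<a\<^sup>2 * t} \<tau> *\<^sub>R heat (a\<^sup>2 * t - \<tau>) (ddiv (F \<tau>)) (\<lambda>x. \<zeta> (x /\<^sub>R a))" for \<tau>
  have h: "integrable lborel h" using int by (simp add: set_integrable_def h_def[abs_def])
  define k where "k = complex_of_real (a ^ 4 / a ^ DIM('a))"
  have eq: "indicator {0<..<t} \<tau> *\<^sub>R heat (t - \<tau>) (ddiv (dilate_field a F \<tau>)) \<zeta> = k * h (a\<^sup>2 * \<tau>)" for \<tau>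
  proof (cases "\<tau> \<in> {0<..<t}")
    case True
    then have "a\<^sup>2 * \<tau> \<in> {0<..<a\<^sup>2 * t}" using a by simp
    moreover have "heat (t - \<tau>) (ddiv (dilate_field a F \<tau>)) = dilate (a ^ 4) a (heat (a\<^sup>2 * (t - \<tau>)) (ddiv (F (a\<^sup>2 * \<tau>))))"
      unfolding ddiv_dilate_field[OF a] using True by (intro heat_dilate a) simp
    ultimately show ?thesis using True by (simp add: h_def k_def dilate_def right_diff_distrib)
  next
    case False
    then have "a\<^sup>2 * \<tau> \<notin> {0<..<a\<^sup>2 * t}" using a by (auto simp: zero_less_mult_iff)
    then show ?thesis using False by (simp add: h_def)
  qed
  show "set_integrable lborel {0<..<t} (\<lambda>\<tau>. heat (t - \<tau>) (ddiv (dilate_field a F \<tau>)) \<zeta>)"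
    unfolding set_integrable_def eq using h by (intro integrable_mult_right) (simp add: integrable_mult_real_iff[OF a2])
  have "a ^ 4 / a ^ DIM('a) * (1 / a\<^sup>2) = a\<^sup>2 / a ^ DIM('a)"
    using a by (simp add: power_numeral_reduce)
  then have "k * of_real (1 / a\<^sup>2) = of_real (a\<^sup>2 / a ^ DIM('a))"
    unfolding k_def of_real_mult[symmetric] by (rule arg_cong)
  then show "(LINT \<tau>:{0<..<t}|lborel. heat (t - \<tau>) (ddiv (dilate_field a F \<tau>)) \<zeta>) =
      of_real (a\<^sup>2 / a ^ DIM('a)) *
      (LINT \<tau>:{0<..<a\<^sup>2 * t}|lborel. heat (a\<^sup>2 * t - \<tau>) (ddiv (F \<tau>)) (\<lambda>x. \<zeta> (x /\<^sub>R a)))"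
    unfolding set_lebesgue_integral_def eq integral_mult_right_zero integral_mult_real[OF a2] h_def[symmetric]
    by (simp only: mult.assoc[symmetric])
qed

lemma duhamel_system_dilate:
  fixes v0 w0 :: "'a::euclidean_space distr"
  assumes a: "0 < a" and n: "2 \<le> DIM('a)"
    and v0: "v0 = dilate (a\<^sup>2) a v0" and w0: "w0 = dilate (a\<^sup>2) a w0"
    and Z: "\<And>t. 0 < t \<Longrightarrow> v t \<in> Z_dual" "\<And>t. 0 < t \<Longrightarrow> w t \<in> Z_dual"
    and vw: "duhamel_system v0 w0 v w"
  shows "duhamel_system v0 w0 (\<lambda>t. dilate (a\<^sup>2) a (v (a\<^sup>2 * t))) (\<lambda>t. dilate (a\<^sup>2) a (w (a\<^sup>2 * t)))"
proof -
  let ?v = "\<lambda>t. dilate (a\<^sup>2) a (v (a\<^sup>2 * t))" and ?w = "\<lambda>t. dilate (a\<^sup>2) a (w (a\<^sup>2 * t))"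
  have a2: "a\<^sup>2 \<noteq> 0" using a by simp
  obtain F G where
    FG: "AE \<tau> in lborel. 0 < \<tau> \<longrightarrow> (\<forall>b\<in>Basis.
        is_product (v \<tau>) (dderiv b (potential_slice (v \<tau>) (w \<tau>))) (F \<tau> b) \<and>
        is_product (w \<tau>) (dderiv b (potential_slice (v \<tau>) (w \<tau>))) (G \<tau> b))" and
    eqs: "AE t in lborel. 0 < t \<longrightarrow> (\<forall>\<zeta>\<in>Z_test.
        set_integrable lborel {0<..<t} (\<lambda>\<tau>. heat (t - \<tau>) (ddiv (F \<tau>)) \<zeta>) \<and>
        v t \<zeta> = heat t v0 \<zeta> - (LINT \<tau>:{0<..<t}|lborel. heat (t - \<tau>) (ddiv (F \<tau>)) \<zeta>) \<and>
        set_integrable lborel {0<..<t} (\<lambda>\<tau>. heat (t - \<tau>) (ddiv (G \<tau>)) \<zeta>) \<and>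
        w t \<zeta> = heat t w0 \<zeta> + (LINT \<tau>:{0<..<t}|lborel. heat (t - \<tau>) (ddiv (G \<tau>)) \<zeta>))"
    using vw unfolding duhamel_system_def by blast
  have prod: "is_product (dilate (a\<^sup>2) a u) (dderiv b (potential_slice (?v \<tau>) (?w \<tau>)))
      (dilate_field a H \<tau> b)"
    if "0 < \<tau>" "is_product u (dderiv b (potential_slice (v (a\<^sup>2 * \<tau>)) (w (a\<^sup>2 * \<tau>)))) (H (a\<^sup>2 * \<tau>) b)" for \<tau> b u H
  proof -
    have "H (a\<^sup>2 * \<tau>) b \<in> Z_dual" using that by (simp add: is_product_def)
    moreover have "dderiv b (potential_slice (?v \<tau>) (?w \<tau>)) =
        dilate a a (dderiv b (potential_slice (v (a\<^sup>2 * \<tau>)) (w (a\<^sup>2 * \<tau>))))"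
      using a that by (intro dderiv_potential_slice_dilate n Z) auto
    ultimately show ?thesis
      using is_product_dilate[OF a that(2), of "a\<^sup>2" a] by (simp add: dilate_field_eq_dilate[OF a])
  qed
  \<comment> \<open>The only place where homogeneity of the data enters: in the linear term the data
    are replaced by their own dilation, and the dilation is moved across the heat operator.\<close>
  have heat0: "heat t u0 \<zeta> = of_real (a\<^sup>2 / a ^ DIM('a)) * heat (a\<^sup>2 * t) u0 (\<lambda>x. \<zeta> (x /\<^sub>R a))"
    if "0 < t" "u0 = dilate (a\<^sup>2) a u0" for t \<zeta> and u0 :: "'a distr"
    using heat_dilate[OF a that(1), of "a\<^sup>2" u0] that(2) by (simp add: dilate_def)
  show ?thesis
    unfolding duhamel_system_def
  proof (rule exI[of _ "dilate_field a F"], rule exI[of _ "dilate_field a G"], rule conjI)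
    show "AE \<tau> in lborel. 0 < \<tau> \<longrightarrow> (\<forall>b\<in>Basis.
        is_product (?v \<tau>)
          (dderiv b (potential_slice (?v \<tau>) (?w \<tau>))) (dilate_field a F \<tau> b) \<and>
        is_product (?w \<tau>)
          (dderiv b (potential_slice (?v \<tau>) (?w \<tau>))) (dilate_field a G \<tau> b))"
      \<comment> \<open>The relations for the dilated fields at time \<open>\<tau>\<close> are those
        for the original ones at time \<open>a\<^sup>2 * \<tau>\<close>; the exceptional times form
        the preimage of a null set.\<close>
      using AE_lborel_mult[OF a2 FG]
    proof eventually_elim
      case (elim \<tau>)
      show ?case
      proof (intro impI ballI conjI)
        fix b :: 'a assume "0 < \<tau>" "b \<in> Basis"
        moreover from this have "0 < a\<^sup>2 * \<tau>" using a by simp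
        ultimately show "is_product (?v \<tau>)
            (dderiv b (potential_slice (?v \<tau>) (?w \<tau>))) (dilate_field a F \<tau> b)"
          "is_product (?w \<tau>)
            (dderiv b (potential_slice (?v \<tau>) (?w \<tau>))) (dilate_field a G \<tau> b)"
          using elim by (auto intro!: prod)
      qed
    qed
    show "AE t in lborel. 0 < t \<longrightarrow> (\<forall>\<zeta>\<in>Z_test.
        set_integrable lborel {0<..<t} (\<lambda>\<tau>. heat (t - \<tau>) (ddiv (dilate_field a F \<tau>)) \<zeta>) \<and>
        ?v t \<zeta> = heat t v0 \<zeta> -
          (LINT \<tau>:{0<..<t}|lborel. heat (t - \<tau>) (ddiv (dilate_field a F \<tau>)) \<zeta>) \<and>
        set_integrable lborel {0<..<t} (\<lambda>\<tau>. heat (t - \<tau>) (ddiv (dilate_field a G \<tau>)) \<zeta>) \<and>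
        ?w t \<zeta> = heat t w0 \<zeta> +
          (LINT \<tau>:{0<..<t}|lborel. heat (t - \<tau>) (ddiv (dilate_field a G \<tau>)) \<zeta>))"
      using AE_lborel_mult[OF a2 eqs]
    proof eventually_elim
      case (elim t)
      show ?case
      proof (intro impI ballI)
        fix \<zeta> :: "'a \<Rightarrow> complex" assume t: "0 < t" and "\<zeta> \<in> Z_test"
        then have "(\<lambda>x. \<zeta> (x /\<^sub>R a)) \<in> Z_test" "0 < a\<^sup>2 * t"
          using a by (auto intro!: Z_test_scaleR)
        note E = elim[THEN mp, OF this(2), THEN bspec, OF this(1)]
        note FE = duhamel_integral_dilate[OF a E[THEN conjunct1]]
        note GE = duhamel_integral_dilate[OF a E[THEN conjunct2, THEN conjunct2, THEN conjunct1]]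
        note v = E[THEN conjunct2, THEN conjunct1] and w = E[THEN conjunct2, THEN conjunct2, THEN conjunct2]
        show "set_integrable lborel {0<..<t} (\<lambda>\<tau>. heat (t - \<tau>) (ddiv (dilate_field a F \<tau>)) \<zeta>) \<and>
            ?v t \<zeta> = heat t v0 \<zeta> -
              (LINT \<tau>:{0<..<t}|lborel. heat (t - \<tau>) (ddiv (dilate_field a F \<tau>)) \<zeta>) \<and>
            set_integrable lborel {0<..<t} (\<lambda>\<tau>. heat (t - \<tau>) (ddiv (dilate_field a G \<tau>)) \<zeta>) \<and>
            ?w t \<zeta> = heat t w0 \<zeta> +
              (LINT \<tau>:{0<..<t}|lborel. heat (t - \<tau>) (ddiv (dilate_field a G \<tau>)) \<zeta>)"
          unfolding FE(2) GE(2) heat0[OF t v0] heat0[OF t w0] right_diff_distrib[symmetric] distrib_left[symmetric]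
            v[symmetric] w[symmetric]
          using FE(1) GE(1) by (simp add: dilate_def)
      qed
    qed
  qed
qed

section \<open>Mixed Lebesgue norms\<close>

lemma epowr_top [simp]: "epowr \<infinity> a = \<infinity>" "epowr top a = top"
  by (simp_all add: epowr_def)

lemma epowr_ennreal: "0 \<le> x \<Longrightarrow> epowr (ennreal x) a = ennreal (x powr a)"
  by (simp add: epowr_def)

lemma epowr_zero [simp]: "epowr 0 a = 0"
  by (simp add: epowr_def)

lemma epowr_one [simp]: "epowr x 1 = x"
  by (cases x) (auto simp: epowr_ennreal)

lemma epowr_mono: "x \<le> y \<Longrightarrow> 0 \<le> a \<Longrightarrow> epowr x a \<le> epowr y a"
  by (cases x; cases y) (auto simp: epowr_ennreal intro!: ennreal_leI powr_mono2 simp: top_unique)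

lemma epowr_eq_0_iff: "epowr x a = 0 \<longleftrightarrow> x = 0"
  by (cases x) (auto simp: epowr_ennreal ennreal_eq_0_iff)

lemma epowr_epowr: "epowr (epowr x a) b = epowr x (a * b)"
  by (cases x) (auto simp: epowr_ennreal powr_powr)

lemma epowr_mult: "epowr (x * y) a = epowr x a * epowr y a"
proof (cases "x = top \<or> y = top")
  case True
  then show ?thesis
    by (cases "x = 0"; cases "y = 0") (auto simp: ennreal_mult_top ennreal_top_mult epowr_eq_0_iff)
next
  case False
  then obtain r s where "x = ennreal r" "0 \<le> r" "y = ennreal s" "0 \<le> s"
    by (metis ennreal_cases)
  then show ?thesis by (simp add: epowr_ennreal powr_mult flip: ennreal_mult)
qed

text \<open>Follows from \<open>x + y \<le> 2 * max x y\<close> and monotonicity, for every positive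
  exponent. It is applied both with \<open>p\<close> and with \<open>1 / p\<close>.\<close>

lemma epowr_add_le:
  assumes "0 < a"
  shows "epowr (x + y) a \<le> ennreal (2 powr a) * (epowr x a + epowr y a)"
proof -
  have "x + y \<le> ennreal 2 * max x y"
  proof -
    have "x + y \<le> max x y + max x y" by (intro add_mono) auto
    then show ?thesis by (simp add: mult_2)
  qed
  then have "epowr (x + y) a \<le> epowr (ennreal 2 * max x y) a"
    using assms by (intro epowr_mono) auto
  also have "\<dots> = ennreal (2 powr a) * epowr (max x y) a"
    by (simp add: epowr_mult epowr_ennreal del: ennreal_numeral)
  also have "epowr (max x y) a \<le> epowr x a + epowr y a"
    by (simp add: max_def)
  finally show ?thesis by (simp add: mult_left_mono)
qed

lemma borel_measurable_epowr [measurable]: "(\<lambda>x. epowr x a) \<in> borel_measurable borel"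
  unfolding epowr_def by measurable

lemma Lp_norm_top: "Lp_norm \<infinity> M f = esssup M f" "Lp_norm top M f = esssup M f"
  by (simp_all add: Lp_norm_def)

lemma Lp_norm_ennreal: "0 \<le> p \<Longrightarrow> Lp_norm (ennreal p) M f = epowr (\<integral>\<^sup>+x. epowr (f x) p \<partial>M) (1 / p)"
  by (simp add: Lp_norm_def)

lemma exponent_cases:
  assumes "1 \<le> (q::ennreal)"
  obtains "q = \<infinity>" | p where "q = ennreal p" "1 \<le> p"
  using assms by (cases q) auto

lemma Lp_norm_mono:
  assumes q: "1 \<le> q" and [measurable]: "f \<in> borel_measurable M" and fg: "\<And>x. f x \<le> g x"
  shows "Lp_norm q M f \<le> Lp_norm q M g"
  using q
proof (cases rule: exponent_cases)
  case 1
  then show ?thesis using fg by (simp only: Lp_norm_top) (intro esssup_mono, auto)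
next
  case (2 p)
  then show ?thesis
    by (auto simp: Lp_norm_ennreal intro!: epowr_mono nn_integral_mono fg)
qed

lemma Lp_norm_cmult:
  assumes q: "1 \<le> q" and [measurable]: "f \<in> borel_measurable M" and c: "0 \<le> c"
  shows "Lp_norm q M (\<lambda>x. ennreal c * f x) \<le> ennreal c * Lp_norm q M f"
  using q
proof (cases rule: exponent_cases)
  case 1
  have "AE x in M. f x \<le> esssup M f" by (rule esssup_AE)
  then have "esssup M (\<lambda>x. ennreal c * f x) \<le> ennreal c * esssup M f"
    by (intro esssup_I) (auto intro: mult_left_mono elim!: eventually_mono)
  then show ?thesis using 1 by (simp add: Lp_norm_top)
next
  case (2 p)
  have "(\<integral>\<^sup>+x. epowr (ennreal c * f x) p \<partial>M) = ennreal (c powr p) * (\<integral>\<^sup>+x. epowr (f x) p \<partial>M)"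
    using c by (simp add: epowr_mult epowr_ennreal nn_integral_cmult)
  then show ?thesis
    using 2 c by (simp add: Lp_norm_ennreal epowr_mult epowr_ennreal powr_powr)
qed

text \<open>In the finite case \<open>epowr_add_le\<close> is used twice. Inside the integral it
  costs \<open>2 powr p\<close>, which becomes 2 after the root; on the root it costs
  \<open>2 powr (1 / p) \<le> 2\<close>. Together this gives 4.\<close>

lemma Lp_norm_add:
  assumes q: "1 \<le> q" and [measurable]: "f \<in> borel_measurable M" "g \<in> borel_measurable M"
  shows "Lp_norm q M (\<lambda>x. f x + g x) \<le> 4 * (Lp_norm q M f + Lp_norm q M g)"
  using q
proof (cases rule: exponent_cases)
  case 1
  have "AE x in M. f x + g x \<le> 4 * (esssup M f + esssup M g)"
    using esssup_AE[of f M] esssup_AE[of g M]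
  proof eventually_elim
    case (elim x)
    then have "f x + g x \<le> 1 * (esssup M f + esssup M g)" by (simp add: add_mono)
    also have "\<dots> \<le> 4 * (esssup M f + esssup M g)"
      by (intro mult_right_mono) auto
    finally show ?case .
  qed
  then show ?thesis using 1 by (simp only: Lp_norm_top) (intro esssup_I, auto)
next
  case (2 p)
  then have p: "0 < p" by simp
  let ?F = "\<integral>\<^sup>+x. epowr (f x) p \<partial>M" and ?G = "\<integral>\<^sup>+x. epowr (g x) p \<partial>M"
  have "(\<integral>\<^sup>+x. epowr (f x + g x) p \<partial>M) \<le> (\<integral>\<^sup>+x. ennreal (2 powr p) * (epowr (f x) p + epowr (g x) p) \<partial>M)"
    by (intro nn_integral_mono epowr_add_le p)
  also have "\<dots> = ennreal (2 powr p) * (?F + ?G)"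
    by (simp add: nn_integral_cmult nn_integral_add)
  finally have "epowr (\<integral>\<^sup>+x. epowr (f x + g x) p \<partial>M) (1 / p) \<le> epowr (ennreal (2 powr p) * (?F + ?G)) (1 / p)"
    using p by (intro epowr_mono) auto
  also have "\<dots> = ennreal 2 * epowr (?F + ?G) (1 / p)"
    using p by (simp add: epowr_mult epowr_ennreal powr_powr)
  also have "\<dots> \<le> ennreal 2 * (ennreal (2 powr (1 / p)) * (epowr ?F (1 / p) + epowr ?G (1 / p)))"
    using p by (intro mult_left_mono epowr_add_le) auto
  also have "\<dots> \<le> ennreal 2 * (ennreal (2 powr 1) * (epowr ?F (1 / p) + epowr ?G (1 / p)))"
    using 2 by (intro mult_left_mono mult_right_mono ennreal_leI powr_mono) auto
  also have "\<dots> = 4 * (epowr ?F (1 / p) + epowr ?G (1 / p))"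
    by (simp flip: mult.assoc)
  finally show ?thesis using 2 by (simp add: Lp_norm_ennreal)
qed

lemma Lp_norm_zero:
  assumes "1 \<le> q"
  shows "Lp_norm q M (\<lambda>x. 0) = 0"
proof -
  have "esssup M (\<lambda>x. 0) \<le> (0::ennreal)" by (rule esssup_I) auto
  then show ?thesis
    by - (rule exponent_cases[OF assms], auto simp: Lp_norm_top Lp_norm_ennreal)
qed

text \<open>A crude form of Hoelder's inequality for bounded weights of finite mass; it suffices because
  only the finiteness of norms and the uniformity of constants matter.\<close>

lemma nn_integral_mult_le_Lp_norm:
  assumes q: "1 \<le> q" and [measurable]: "f \<in> borel_measurable M" "w \<in> borel_measurable M"
    and w: "\<And>x. w x \<le> B" and fin: "Lp_norm q M f < \<infinity>"
  shows "(\<integral>\<^sup>+x. f x * w x \<partial>M) \<le> Lp_norm q M f * ((\<integral>\<^sup>+x. w x \<partial>M) + B)"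
  using q
proof (cases rule: exponent_cases)
  case 1
  have "AE x in M. f x \<le> esssup M f" by (rule esssup_AE)
  then have "(\<integral>\<^sup>+x. f x * w x \<partial>M) \<le> (\<integral>\<^sup>+x. esssup M f * w x \<partial>M)"
    by (intro nn_integral_mono_AE) (auto intro: mult_right_mono elim!: eventually_mono)
  also have "\<dots> = esssup M f * (\<integral>\<^sup>+x. w x \<partial>M)"
    by (simp add: nn_integral_cmult)
  also have "\<dots> \<le> esssup M f * ((\<integral>\<^sup>+x. w x \<partial>M) + B)"
    by (intro mult_left_mono) auto
  finally show ?thesis using 1 by (simp add: Lp_norm_top)
next
  case (2 p)
  then have p: "0 < p" by simp
  define J where "J = (\<integral>\<^sup>+x. epowr (f x) p \<partial>M)"
  have norm: "Lp_norm q M f = epowr J (1 / p)" using 2 by (simp add: Lp_norm_ennreal J_def)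
  then have "J \<noteq> top" using fin by auto
  then obtain j where j: "J = ennreal j" "0 \<le> j" by (metis ennreal_cases)
  show ?thesis
  \<comment> \<open>The pointwise estimate below divides by \<open>j\<close>, so a function of norm
    0 is treated apart: it vanishes almost everywhere.\<close>
  proof (cases "j = 0")
    case True
    then have "(\<integral>\<^sup>+x. epowr (f x) p \<partial>M) = 0"
      using j unfolding J_def by simp
    then have "AE x in M. epowr (f x) p = 0"
      by (subst (asm) nn_integral_0_iff_AE) auto
    then have "AE x in M. f x * w x = 0"
      by eventually_elim (simp add: epowr_eq_0_iff)
    then have "(\<integral>\<^sup>+x. f x * w x \<partial>M) = 0"
      by (subst nn_integral_0_iff_AE) auto
    then show ?thesis by simp
  next
    case False
    define A where "A = j powr (1 / p)"
    have j0: "0 < j" and A: "0 < A" using False j by (auto simp: A_def)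
    have Ap: "A powr p = j" using p j by (simp add: A_def powr_powr)
    \<comment> \<open>With \<open>A\<close> the norm of \<open>f\<close>, so that
      \<open>A powr p = j\<close>, a value \<open>y\<close> above \<open>A\<close> satisfies
      \<open>y / A \<le> (y / A) powr p\<close>. Values below \<open>A\<close> are covered by the
      first summand.\<close>
    have pw: "f x \<le> ennreal A + ennreal (A / j) * epowr (f x) p" for x
    proof (cases "f x = top")
      case True
      moreover have "\<not> A / j \<le> 0" using A j0 by (simp add: not_le)
      ultimately show ?thesis by (simp add: ennreal_mult_top ennreal_eq_0_iff)
    next
      case False
      then obtain y where y: "f x = ennreal y" "0 \<le> y" by (metis ennreal_cases)
      have "y \<le> A + A / j * y powr p"
      proof (cases "y \<le> A")
        case True
        then show ?thesis using A j0 by (intro add_increasing2) auto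
      next
        case False
        then have "(y / A) powr 1 \<le> (y / A) powr p"
          using A 2 by (intro powr_mono) auto
        then have "y / A \<le> y powr p / j"
          using A y by (simp add: powr_divide Ap)
        then have "y \<le> A / j * y powr p"
          using A by (simp add: field_simps)
        then show ?thesis using A by simp
      qed
      then show ?thesis using y A j0
        by (simp add: epowr_ennreal flip: ennreal_mult ennreal_plus)
    qed
    \<comment> \<open>The weight enters through its mass in the first summand and through its bound
      \<open>B\<close> in the second, whose remaining integral is
      \<open>(A / j) * j = A\<close>.\<close>
    have "(\<integral>\<^sup>+x. f x * w x \<partial>M) \<le> (\<integral>\<^sup>+x. ennreal A * w x + ennreal (A / j) * epowr (f x) p * B \<partial>M)"
    proof (intro nn_integral_mono)
      fix x
      have "f x * w x \<le> (ennreal A + ennreal (A / j) * epowr (f x) p) * w x"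
        by (intro mult_right_mono pw) auto
      also have "\<dots> \<le> ennreal A * w x + ennreal (A / j) * epowr (f x) p * B"
        unfolding distrib_right by (intro add_mono order_refl mult_left_mono w) auto
      finally show "f x * w x \<le> ennreal A * w x + ennreal (A / j) * epowr (f x) p * B" .
    qed
    also have "\<dots> = ennreal A * (\<integral>\<^sup>+x. w x \<partial>M) + ennreal (A / j) * J * B"
      by (simp add: nn_integral_add nn_integral_cmult nn_integral_multc J_def)
    also have "ennreal (A / j) * J = ennreal A"
      using A j0 by (simp add: j flip: ennreal_mult)
    also have "ennreal A * (\<integral>\<^sup>+x. w x \<partial>M) + ennreal A * B = Lp_norm q M f * ((\<integral>\<^sup>+x. w x \<partial>M) + B)"
      using j unfolding norm by (simp add: epowr_ennreal A_def distrib_left)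
    finally show ?thesis .
  qed
qed

text \<open>The hypothesis \<open>le\<close> says that the image measure of \<open>M\<close> under
  \<open>T\<close> is at most \<open>K\<close> times \<open>M\<close>. For infinite \<open>q\<close>
  it is applied to the indicator of the set where \<open>f\<close> exceeds its essential supremum,
  whose preimage is thereby null.\<close>

lemma Lp_norm_compose:
  assumes q: "1 \<le> q" and T [measurable]: "T \<in> M \<rightarrow>\<^sub>M M" and K: "0 \<le> K"
    and le: "\<And>h. h \<in> borel_measurable M \<Longrightarrow> (\<integral>\<^sup>+x. h (T x) \<partial>M) \<le> ennreal K * (\<integral>\<^sup>+x. h x \<partial>M)"
  obtains C where "0 \<le> C" "\<And>f. f \<in> borel_measurable M \<Longrightarrow> Lp_norm q M (\<lambda>x. f (T x)) \<le> ennreal C * Lp_norm q M f"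
  using q
proof (cases rule: exponent_cases)
  case 1
  have "Lp_norm q M (\<lambda>x. f (T x)) \<le> ennreal 1 * Lp_norm q M f" if [measurable]: "f \<in> borel_measurable M" for f
  proof -
    have "(\<integral>\<^sup>+x. indicator {x. \<not> f x \<le> esssup M f} (T x) \<partial>M) \<le>
        ennreal K * (\<integral>\<^sup>+x. indicator {x. \<not> f x \<le> esssup M f} x \<partial>M)"
      by (intro le) measurable
    also have "(\<integral>\<^sup>+x. indicator {x. \<not> f x \<le> esssup M f} x \<partial>M) = (\<integral>\<^sup>+x. 0 \<partial>M)"
      using esssup_AE[of f M] by (intro nn_integral_cong_AE) (auto elim!: eventually_mono simp: indicator_def)
    finally have "(\<integral>\<^sup>+x. indicator {x. \<not> f x \<le> esssup M f} (T x) \<partial>M) = 0" by simp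
    then have "AE x in M. indicator {x. \<not> f x \<le> esssup M f} (T x) = (0::ennreal)"
      by (subst (asm) nn_integral_0_iff_AE) auto
    then have "AE x in M. f (T x) \<le> esssup M f"
      by eventually_elim (auto simp: indicator_def split: if_splits)
    then show ?thesis
      using 1 by (simp only: Lp_norm_top ennreal_1 mult_1) (intro esssup_I, auto)
  qed
  then show ?thesis using that[of 1] by simp
next
  case (2 p)
  have "Lp_norm q M (\<lambda>x. f (T x)) \<le> ennreal (K powr (1 / p)) * Lp_norm q M f"
    if [measurable]: "f \<in> borel_measurable M" for f
  proof -
    have "(\<integral>\<^sup>+x. epowr (f (T x)) p \<partial>M) \<le> ennreal K * (\<integral>\<^sup>+x. epowr (f x) p \<partial>M)"
      by (intro le[of "\<lambda>x. epowr (f x) p"]) measurable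
    then have "epowr (\<integral>\<^sup>+x. epowr (f (T x)) p \<partial>M) (1 / p) \<le> epowr (ennreal K * (\<integral>\<^sup>+x. epowr (f x) p \<partial>M)) (1 / p)"
      using 2 by (intro epowr_mono) auto
    then show ?thesis using 2 K by (simp add: Lp_norm_ennreal epowr_mult epowr_ennreal)
  qed
  then show ?thesis using that[of "K powr (1 / p)"] by simp
qed

section \<open>Young's inequality and mixed norms\<close>

lemma nn_integral_lborel_reflect:
  fixes f :: "'a::euclidean_space \<Rightarrow> ennreal"
  assumes [measurable]: "f \<in> borel_measurable borel"
  shows "(\<integral>\<^sup>+x. f (y - x) \<partial>lborel) = (\<integral>\<^sup>+x. f x \<partial>lborel)"
  using nn_integral_lborel_affine[of "-1" f y] by simp

lemma nn_integral_lborel_translate: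
  fixes f :: "'a::euclidean_space \<Rightarrow> ennreal"
  assumes [measurable]: "f \<in> borel_measurable borel"
  shows "(\<integral>\<^sup>+x. f (x - y) \<partial>lborel) = (\<integral>\<^sup>+x. f x \<partial>lborel)"
  using nn_integral_lborel_affine[of 1 f "- y"] by simp

text \<open>For fixed \<open>x\<close>, the crude Hoelder inequality is applied to the measure with
  density \<open>K (y - x)\<close>, of mass \<open>\<kappa>\<close>, and the weight 1, bounded by 1:
  this gives the factor \<open>\<kappa> + 1\<close>. Exchanging the integrals then produces one more
  \<open>\<kappa>\<close> under the root.\<close>

lemma Lp_norm_convolution:
  fixes G K :: "'a::euclidean_space \<Rightarrow> ennreal"
  assumes p: "1 \<le> p" and [measurable]: "G \<in> borel_measurable borel" "K \<in> borel_measurable borel"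
    and \<kappa>: "(\<integral>\<^sup>+x. K x \<partial>lborel) = ennreal \<kappa>" "0 \<le> \<kappa>"
  shows "Lp_norm (ennreal p) lborel (\<lambda>x. \<integral>\<^sup>+y. G y * K (y - x) \<partial>lborel) \<le>
    ennreal ((\<kappa> + 1) * \<kappa> powr (1 / p)) * Lp_norm (ennreal p) lborel G"
proof -
  have p0: "0 < p" using p by simp
  have pw: "epowr (\<integral>\<^sup>+y. G y * K (y - x) \<partial>lborel) p \<le>
      ennreal ((\<kappa> + 1) powr p) * (\<integral>\<^sup>+y. epowr (G y) p * K (y - x) \<partial>lborel)" for x
  proof -
    let ?M = "density lborel (\<lambda>y. K (y - x))"
    let ?N = "Lp_norm (ennreal p) ?M G"
    have "(\<integral>\<^sup>+y. 1 \<partial>?M) = (\<integral>\<^sup>+y. K (y - x) * 1 \<partial>lborel)"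
      by (rule nn_integral_density) measurable
    then have mass: "(\<integral>\<^sup>+y. 1 \<partial>?M) = ennreal \<kappa>"
      using \<kappa> by (simp only: mult_1_right) (simp add: nn_integral_lborel_translate)
    have N: "?N = epowr (\<integral>\<^sup>+y. epowr (G y) p * K (y - x) \<partial>lborel) (1 / p)"
      using p by (simp add: Lp_norm_ennreal nn_integral_density mult.commute)
    have "(\<integral>\<^sup>+y. G y * K (y - x) \<partial>lborel) = (\<integral>\<^sup>+y. G y * 1 \<partial>?M)"
      by (simp add: nn_integral_density mult.commute)
    also have "\<dots> \<le> ?N * (ennreal \<kappa> + 1)"
    proof (cases "?N < \<infinity>")
      case True
      then show ?thesis
        unfolding mass[symmetric] using p by (intro nn_integral_mult_le_Lp_norm) auto
    next
      case False
      then have "?N = top" by (simp add: less_top[symmetric])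
      then show ?thesis by (simp add: ennreal_top_mult add_eq_0_iff_both_eq_0)
    qed
    also have "ennreal \<kappa> + 1 = ennreal (\<kappa> + 1)" using \<kappa> by simp
    finally have "epowr (\<integral>\<^sup>+y. G y * K (y - x) \<partial>lborel) p \<le> epowr (?N * ennreal (\<kappa> + 1)) p"
      using p by (intro epowr_mono) auto
    also have "\<dots> = ennreal ((\<kappa> + 1) powr p) * epowr ?N p"
      using \<kappa> epowr_ennreal[of "\<kappa> + 1" p] by (simp add: epowr_mult mult.commute del: ennreal_plus)
    also have "epowr ?N p = (\<integral>\<^sup>+y. epowr (G y) p * K (y - x) \<partial>lborel)"
      unfolding N epowr_epowr using p0 by simp
    finally show ?thesis .
  qed
  have "(\<integral>\<^sup>+x. epowr (\<integral>\<^sup>+y. G y * K (y - x) \<partial>lborel) p \<partial>lborel) \<le>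
      (\<integral>\<^sup>+x. ennreal ((\<kappa> + 1) powr p) * (\<integral>\<^sup>+y. epowr (G y) p * K (y - x) \<partial>lborel) \<partial>lborel)"
    by (intro nn_integral_mono pw)
  also have "\<dots> = ennreal ((\<kappa> + 1) powr p) * (\<integral>\<^sup>+x. \<integral>\<^sup>+y. epowr (G y) p * K (y - x) \<partial>lborel \<partial>lborel)"
    by (intro nn_integral_cmult) measurable
  also have "(\<integral>\<^sup>+x. \<integral>\<^sup>+y. epowr (G y) p * K (y - x) \<partial>lborel \<partial>lborel) =
      (\<integral>\<^sup>+y. \<integral>\<^sup>+x. epowr (G y) p * K (y - x) \<partial>lborel \<partial>lborel)"
    by (intro lborel_pair.Fubini'[symmetric]) measurable
  also have "\<dots> = (\<integral>\<^sup>+y. epowr (G y) p * ennreal \<kappa> \<partial>lborel)"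
    by (simp add: nn_integral_cmult nn_integral_lborel_reflect \<kappa>)
  also have "\<dots> = (\<integral>\<^sup>+y. epowr (G y) p \<partial>lborel) * ennreal \<kappa>"
    by (intro nn_integral_multc) measurable
  finally have "Lp_norm (ennreal p) lborel (\<lambda>x. \<integral>\<^sup>+y. G y * K (y - x) \<partial>lborel) \<le>
      epowr (ennreal ((\<kappa> + 1) powr p) * ((\<integral>\<^sup>+y. epowr (G y) p \<partial>lborel) * ennreal \<kappa>)) (1 / p)"
    using p by (simp add: Lp_norm_ennreal epowr_mono)
  also have "\<dots> = ennreal ((\<kappa> + 1) * \<kappa> powr (1 / p)) * Lp_norm (ennreal p) lborel G"
    using p \<kappa> by (simp add: Lp_norm_ennreal epowr_mult epowr_ennreal powr_powr ennreal_mult mult_ac)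
  finally show ?thesis .
qed

definition mixed_norm :: "ennreal \<Rightarrow> real \<Rightarrow> (real \<Rightarrow> 'a::euclidean_space \<Rightarrow> complex) \<Rightarrow> ennreal" where
  "mixed_norm r p g = Lp_norm r (restrict_space lborel {0<..})
     (\<lambda>t. Lp_norm (ennreal p) lborel (\<lambda>x. ennreal (cmod (g t x))))"

lemma borel_measurable_section:
  assumes "case_prod g \<in> borel_measurable (lborel \<Otimes>\<^sub>M lborel)"
  shows "g t \<in> borel_measurable borel"
proof -
  have "(\<lambda>x. case_prod g (t, x)) \<in> borel_measurable lborel"
    using assms by (rule measurable_compose_Pair1[rotated]) simp
  then show ?thesis by simp
qed

lemma borel_measurable_Lp_norm_section:
  fixes g :: "real \<Rightarrow> 'a::euclidean_space \<Rightarrow> complex"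
  assumes [measurable]: "case_prod g \<in> borel_measurable (lborel \<Otimes>\<^sub>M lborel)" and p: "1 \<le> p"
  shows "(\<lambda>t. Lp_norm (ennreal p) lborel (\<lambda>x. ennreal (cmod (g t x)))) \<in> borel_measurable borel"
proof -
  have "(\<lambda>t. \<integral>\<^sup>+x. epowr (ennreal (cmod (case_prod g (t, x)))) p \<partial>lborel) \<in> borel_measurable lborel"
    by measurable
  then have [measurable]: "(\<lambda>t. \<integral>\<^sup>+x. epowr (ennreal (cmod (g t x))) p \<partial>lborel) \<in> borel_measurable borel"
    by simp
  have "(\<lambda>t. epowr (\<integral>\<^sup>+x. epowr (ennreal (cmod (g t x))) p \<partial>lborel) (1 / p)) \<in> borel_measurable borel"
    by measurable
  then show ?thesis using p by (simp add: Lp_norm_ennreal)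
qed

lemma borel_measurable_restrict_lborel:
  "f \<in> borel_measurable borel \<Longrightarrow> f \<in> borel_measurable (restrict_space lborel A)"
  by (intro measurable_restrict_space1) simp

lemma mixed_norm_mono_cmult:
  fixes g h :: "real \<Rightarrow> 'a::euclidean_space \<Rightarrow> complex"
  assumes r: "1 \<le> r" and p: "1 \<le> p" and C: "0 \<le> C"
    and g: "case_prod g \<in> borel_measurable (lborel \<Otimes>\<^sub>M lborel)"
    and N: "N \<in> borel_measurable (restrict_space lborel {0<..})"
    and le: "\<And>t. Lp_norm (ennreal p) lborel (\<lambda>x. ennreal (cmod (g t x))) \<le> ennreal C * N t"
  shows "mixed_norm r p g \<le> ennreal C * Lp_norm r (restrict_space lborel {0<..}) N"
proof -
  have "mixed_norm r p g \<le> Lp_norm r (restrict_space lborel {0<..}) (\<lambda>t. ennreal C * N t)"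
    unfolding mixed_norm_def
    by (intro Lp_norm_mono r le borel_measurable_restrict_lborel borel_measurable_Lp_norm_section g p)
  also have "\<dots> \<le> ennreal C * Lp_norm r (restrict_space lborel {0<..}) N"
    by (intro Lp_norm_cmult r C N)
  finally show ?thesis .
qed

text \<open>The factor 16 is the product of the factors 4 from the norm in space and from the norm
  in time.\<close>

lemma mixed_norm_add:
  fixes g h :: "real \<Rightarrow> 'a::euclidean_space \<Rightarrow> complex"
  assumes r: "1 \<le> r" and p: "1 \<le> p"
    and g: "case_prod g \<in> borel_measurable (lborel \<Otimes>\<^sub>M lborel)"
    and h: "case_prod h \<in> borel_measurable (lborel \<Otimes>\<^sub>M lborel)"
  shows "mixed_norm r p (\<lambda>t x. g t x + h t x) \<le> 16 * (mixed_norm r p g + mixed_norm r p h)"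
proof -
  note [measurable] = g h borel_measurable_section[OF g] borel_measurable_section[OF h]
  define N where "N g t = Lp_norm (ennreal p) lborel (\<lambda>x. ennreal (cmod (g t x)))"
    for g :: "real \<Rightarrow> 'a \<Rightarrow> complex" and t
  have Nm: "N g \<in> borel_measurable (restrict_space lborel {0<..})" "N h \<in> borel_measurable (restrict_space lborel {0<..})"
    unfolding N_def by (intro borel_measurable_restrict_lborel borel_measurable_Lp_norm_section g h p)+
  have p': "1 \<le> ennreal p" using p by simp
  have "mixed_norm r p (\<lambda>t x. g t x + h t x) \<le> ennreal 4 * Lp_norm r (restrict_space lborel {0<..}) (\<lambda>t. N g t + N h t)"
  proof (intro mixed_norm_mono_cmult r p)
    show "(\<lambda>(t, x). g t x + h t x) \<in> borel_measurable (lborel \<Otimes>\<^sub>M lborel)"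
      using borel_measurable_add[OF g h] by (simp add: case_prod_unfold)
    fix t
    have "Lp_norm (ennreal p) lborel (\<lambda>x. ennreal (cmod (g t x + h t x))) \<le>
        Lp_norm (ennreal p) lborel (\<lambda>x. ennreal (cmod (g t x)) + ennreal (cmod (h t x)))"
      by (intro Lp_norm_mono p') (auto simp flip: ennreal_plus intro!: ennreal_leI norm_triangle_ineq)
    also have "\<dots> \<le> 4 * (N g t + N h t)"
      unfolding N_def by (intro Lp_norm_add p') auto
    finally show "Lp_norm (ennreal p) lborel (\<lambda>x. ennreal (cmod (g t x + h t x))) \<le> ennreal 4 * (N g t + N h t)"
      by simp
  qed (use Nm in auto)
  also have "\<dots> \<le> ennreal 4 * (4 * (Lp_norm r (restrict_space lborel {0<..}) (N g) + Lp_norm r (restrict_space lborel {0<..}) (N h)))"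
    by (intro mult_left_mono Lp_norm_add r Nm) auto
  also have "\<dots> = 16 * (mixed_norm r p g + mixed_norm r p h)"
    by (simp add: mixed_norm_def N_def[abs_def] flip: mult.assoc)
  finally show ?thesis .
qed

lemma mixed_norm_convolution:
  fixes g :: "real \<Rightarrow> 'a::euclidean_space \<Rightarrow> complex"
  assumes r: "1 \<le> r" and p: "1 \<le> p"
    and g: "case_prod g \<in> borel_measurable (lborel \<Otimes>\<^sub>M lborel)"
    and h: "case_prod h \<in> borel_measurable (lborel \<Otimes>\<^sub>M lborel)"
    and H: "integrable lborel H"
    and le: "\<And>t x. ennreal (cmod (h t x)) \<le> (\<integral>\<^sup>+y. ennreal (cmod (g t y)) * ennreal (cmod (H (y - x))) \<partial>lborel)"
  defines "\<kappa> \<equiv> LINT x|lborel. cmod (H x)"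
  shows "mixed_norm r p h \<le> ennreal ((\<kappa> + 1) * \<kappa> powr (1 / p)) * mixed_norm r p g"
proof -
  have [measurable]: "H \<in> borel_measurable borel" using H by auto
  have \<kappa>: "(\<integral>\<^sup>+x. ennreal (cmod (H x)) \<partial>lborel) = ennreal \<kappa>" "0 \<le> \<kappa>"
    using H by (simp_all add: \<kappa>_def nn_integral_eq_integral)
  have p': "1 \<le> ennreal p" using p by simp
  show ?thesis
    unfolding mixed_norm_def[of r p g]
  proof (rule mixed_norm_mono_cmult[OF r p _ h])
    show "0 \<le> (\<kappa> + 1) * \<kappa> powr (1 / p)" using \<kappa> by simp
    show "(\<lambda>t. Lp_norm (ennreal p) lborel (\<lambda>x. ennreal (cmod (g t x)))) \<in> borel_measurable (restrict_space lborel {0<..})"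
      by (intro borel_measurable_restrict_lborel borel_measurable_Lp_norm_section g p)
    fix t
    note [measurable] = borel_measurable_section[OF g, of t] borel_measurable_section[OF h, of t]
    have "Lp_norm (ennreal p) lborel (\<lambda>x. ennreal (cmod (h t x))) \<le>
        Lp_norm (ennreal p) lborel (\<lambda>x. \<integral>\<^sup>+y. ennreal (cmod (g t y)) * ennreal (cmod (H (y - x))) \<partial>lborel)"
      by (intro Lp_norm_mono p' le) measurable
    also have "\<dots> \<le> ennreal ((\<kappa> + 1) * \<kappa> powr (1 / p)) * Lp_norm (ennreal p) lborel (\<lambda>x. ennreal (cmod (g t x)))"
      by (intro Lp_norm_convolution p \<kappa>) measurable
    finally show "Lp_norm (ennreal p) lborel (\<lambda>x. ennreal (cmod (h t x))) \<le>
      ennreal ((\<kappa> + 1) * \<kappa> powr (1 / p)) * Lp_norm (ennreal p) lborel (\<lambda>x. ennreal (cmod (g t x)))" .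
  qed
qed

lemma nn_integral_half_line_mult:
  assumes b: "0 < b" and h: "h \<in> borel_measurable (restrict_space lborel {0<..})"
  shows "(\<integral>\<^sup>+t. h (b * t) \<partial>restrict_space lborel {0<..}) \<le> ennreal (1 / b) * (\<integral>\<^sup>+t. h t \<partial>restrict_space lborel {0<..})"
proof -
  have [measurable]: "(\<lambda>t. h t * indicator {0<..} t) \<in> borel_measurable borel"
    using h by (subst (asm) borel_measurable_restrict_space_iff_ennreal) auto
  have "(\<integral>\<^sup>+t. h (b * t) \<partial>restrict_space lborel {0<..}) = (\<integral>\<^sup>+t. h (b * t) * indicator {0<..} (b * t) \<partial>lborel)"
    using b by (subst nn_integral_restrict_space) (auto simp: indicator_def zero_less_mult_iff intro!: nn_integral_cong)
  also have "\<dots> = ennreal (1 / b) * (\<integral>\<^sup>+t. h t * indicator {0<..} t \<partial>lborel)"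
    using b nn_integral_lborel_scaleR[of b "\<lambda>t. h t * indicator {0<..} t"] by simp
  also have "(\<integral>\<^sup>+t. h t * indicator {0<..} t \<partial>lborel) = (\<integral>\<^sup>+t. h t \<partial>restrict_space lborel {0<..})"
    by (subst nn_integral_restrict_space) auto
  finally show ?thesis by simp
qed

text \<open>Two uses of \<open>Lp_norm_compose\<close>, in space and on the half line. The constant
  is chosen before \<open>g\<close>, as is required to treat all frequency blocks at once.\<close>

lemma mixed_norm_dilate:
  assumes r: "1 \<le> r" and p: "1 \<le> p" and a: "0 < a" and b: "0 < b"
  obtains C where "0 \<le> C" "\<And>g :: real \<Rightarrow> 'a::euclidean_space \<Rightarrow> complex.
    case_prod g \<in> borel_measurable (lborel \<Otimes>\<^sub>M lborel) \<Longrightarrow>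
    mixed_norm r p (\<lambda>t x. of_real c * g (b * t) (a *\<^sub>R x)) \<le> ennreal C * mixed_norm r p g"
proof -
  have p': "1 \<le> ennreal p" using p by simp
  obtain C1 where C1: "0 \<le> C1" "\<And>f :: 'a \<Rightarrow> ennreal. f \<in> borel_measurable lborel \<Longrightarrow>
      Lp_norm (ennreal p) lborel (\<lambda>x. f (a *\<^sub>R x)) \<le> ennreal C1 * Lp_norm (ennreal p) lborel f"
  proof (rule Lp_norm_compose[OF p', of "\<lambda>x::'a. a *\<^sub>R x" lborel "1 / \<bar>a\<bar> ^ DIM('a)"])
    show "(\<integral>\<^sup>+x. h (a *\<^sub>R x) \<partial>lborel) \<le> ennreal (1 / \<bar>a\<bar> ^ DIM('a)) * (\<integral>\<^sup>+x. h x \<partial>lborel)"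
      if "h \<in> borel_measurable lborel" for h :: "'a \<Rightarrow> ennreal"
      using that a by (subst nn_integral_lborel_scaleR) auto
  qed auto
  obtain C2 where C2: "0 \<le> C2" "\<And>f. f \<in> borel_measurable (restrict_space lborel {0<..}) \<Longrightarrow>
      Lp_norm r (restrict_space lborel {0<..}) (\<lambda>t. f (b * t)) \<le> ennreal C2 * Lp_norm r (restrict_space lborel {0<..}) f"
  proof (rule Lp_norm_compose[OF r, of "\<lambda>t. b * t" "restrict_space lborel {0<..}" "1 / b"])
    show "(\<lambda>t. b * t) \<in> restrict_space lborel {0<..} \<rightarrow>\<^sub>M restrict_space lborel {0<..}"
      using b by (intro measurable_restrict_space3) auto
  qed (use b nn_integral_half_line_mult in auto)
  show ?thesis
  proof (rule that)
    show "0 \<le> \<bar>c\<bar> * C1 * C2" using C1 C2 by simp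
    fix g :: "real \<Rightarrow> 'a \<Rightarrow> complex"
    assume g: "case_prod g \<in> borel_measurable (lborel \<Otimes>\<^sub>M lborel)"
    note [measurable] = g borel_measurable_section[OF g]
    let ?N = "\<lambda>t. Lp_norm (ennreal p) lborel (\<lambda>x. ennreal (cmod (g t x)))"
    have Nm: "?N \<in> borel_measurable borel" by (intro borel_measurable_Lp_norm_section g p)
    have "mixed_norm r p (\<lambda>t x. of_real c * g (b * t) (a *\<^sub>R x)) \<le>
        ennreal (\<bar>c\<bar> * C1) * Lp_norm r (restrict_space lborel {0<..}) (\<lambda>t. ?N (b * t))"
    proof (rule mixed_norm_mono_cmult[OF r p])
      show "0 \<le> \<bar>c\<bar> * C1" using C1 by simp
      have "(\<lambda>z. of_real c * case_prod g (b * fst z, a *\<^sub>R snd z)) \<in> borel_measurable (lborel \<Otimes>\<^sub>M lborel)"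
        by measurable
      then show "(\<lambda>(t, x). of_real c * g (b * t) (a *\<^sub>R x)) \<in> borel_measurable (lborel \<Otimes>\<^sub>M lborel)"
        by (simp add: case_prod_unfold)
      show "(\<lambda>t. ?N (b * t)) \<in> borel_measurable (restrict_space lborel {0<..})"
        by (intro borel_measurable_restrict_lborel measurable_compose[OF _ Nm]) measurable
      fix t
      have "Lp_norm (ennreal p) lborel (\<lambda>x. ennreal (cmod (of_real c * g (b * t) (a *\<^sub>R x)))) =
          Lp_norm (ennreal p) lborel (\<lambda>x. ennreal \<bar>c\<bar> * ennreal (cmod (g (b * t) (a *\<^sub>R x))))"
        by (simp add: norm_mult ennreal_mult)
      also have "\<dots> \<le> ennreal \<bar>c\<bar> * Lp_norm (ennreal p) lborel (\<lambda>x. ennreal (cmod (g (b * t) (a *\<^sub>R x))))"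
        by (intro Lp_norm_cmult p') auto
      also have "\<dots> \<le> ennreal \<bar>c\<bar> * (ennreal C1 * ?N (b * t))"
        by (intro mult_left_mono C1(2)[of "\<lambda>x. ennreal (cmod (g (b * t) x))"]) auto
      finally show "Lp_norm (ennreal p) lborel (\<lambda>x. ennreal (cmod (of_real c * g (b * t) (a *\<^sub>R x)))) \<le>
          ennreal (\<bar>c\<bar> * C1) * ?N (b * t)"
        using C1 by (simp add: ennreal_mult mult.assoc)
    qed
    also have "\<dots> \<le> ennreal (\<bar>c\<bar> * C1) * (ennreal C2 * mixed_norm r p g)"
      unfolding mixed_norm_def by (intro mult_left_mono C2 borel_measurable_restrict_lborel Nm) auto
    finally show "mixed_norm r p (\<lambda>t x. of_real c * g (b * t) (a *\<^sub>R x)) \<le> ennreal (\<bar>c\<bar> * C1 * C2) * mixed_norm r p g"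
      using C1 C2 by (simp add: ennreal_mult mult.assoc)
  qed
qed

text \<open>The norm of a represented distribution is an infimum, which need not be attained. This
  predicate keeps a representative together with its bound, so that sums, dilates and convolutions
  can be formed from representatives.\<close>

definition trep_bounded :: "ennreal \<Rightarrow> real \<Rightarrow> ('a::euclidean_space) tdistr \<Rightarrow> ennreal \<Rightarrow> bool" where
  "trep_bounded r p U x \<longleftrightarrow> (\<exists>g. trepresented_by {0<..} U g \<and> mixed_norm r p g \<le> x)"

lemma trep_bounded_cong:
  assumes "trep_bounded r p U x"
    and "\<And>\<eta> \<zeta>. \<eta> \<in> D_test {0<..} \<Longrightarrow> \<zeta> \<in> schwartz \<Longrightarrow> U' \<eta> \<zeta> = U \<eta> \<zeta>"
  shows "trep_bounded r p U' x"
  using assms unfolding trep_bounded_def trepresented_by_def by simp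

lemma trep_bounded_zero:
  assumes "1 \<le> r" "1 \<le> p"
  shows "trep_bounded r p (\<lambda>\<eta> \<zeta>. 0) 0"
proof -
  have "1 \<le> ennreal p" using assms by simp
  then have "mixed_norm r p (\<lambda>t x. 0) = 0"
    using assms by (simp add: mixed_norm_def Lp_norm_zero)
  then show ?thesis
    unfolding trep_bounded_def trepresented_by_def
    by (intro exI[of _ "\<lambda>t x. 0"]) (simp add: case_prod_unfold)
qed

lemma trep_bounded_add:
  assumes r: "1 \<le> r" and p: "1 \<le> p" and U: "trep_bounded r p U x" and V: "trep_bounded r p V y"
  shows "trep_bounded r p (\<lambda>\<eta> \<zeta>. U \<eta> \<zeta> + V \<eta> \<zeta>) (16 * (x + y))"
proof -
  obtain g where g: "trepresented_by {0<..} U g" "mixed_norm r p g \<le> x"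
    using U unfolding trep_bounded_def by blast
  obtain h where h: "trepresented_by {0<..} V h" "mixed_norm r p h \<le> y"
    using V unfolding trep_bounded_def by blast
  have gm: "case_prod g \<in> borel_measurable (lborel \<Otimes>\<^sub>M lborel)" and hm: "case_prod h \<in> borel_measurable (lborel \<Otimes>\<^sub>M lborel)"
    using g h by (auto simp: trepresented_by_def)
  have "mixed_norm r p (\<lambda>t x. g t x + h t x) \<le> 16 * (mixed_norm r p g + mixed_norm r p h)"
    by (intro mixed_norm_add r p gm hm)
  also have "\<dots> \<le> 16 * (x + y)"
    by (intro mult_left_mono add_mono g h) auto
  finally have le: "mixed_norm r p (\<lambda>t x. g t x + h t x) \<le> 16 * (x + y)" .
  have "trepresented_by {0<..} (\<lambda>\<eta> \<zeta>. U \<eta> \<zeta> + V \<eta> \<zeta>) (\<lambda>t x. g t x + h t x)"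
    unfolding trepresented_by_def
  proof (intro conjI ballI)
    show "(\<lambda>(t, x). g t x + h t x) \<in> borel_measurable (lborel \<Otimes>\<^sub>M lborel)"
      using borel_measurable_add[OF gm hm] by (simp add: case_prod_unfold)
    fix \<eta> :: "real \<Rightarrow> complex" and \<zeta> :: "'a \<Rightarrow> complex"
    assume *: "\<eta> \<in> D_test {0<..}" "\<zeta> \<in> schwartz"
    have G: "integrable (lborel \<Otimes>\<^sub>M lborel) (\<lambda>(t, x). g t x * \<eta> t * \<zeta> x)"
        "U \<eta> \<zeta> = (LINT (t, x)|(lborel \<Otimes>\<^sub>M lborel). g t x * \<eta> t * \<zeta> x)"
      using g(1) * by (auto simp: trepresented_by_def)
    have H: "integrable (lborel \<Otimes>\<^sub>M lborel) (\<lambda>(t, x). h t x * \<eta> t * \<zeta> x)"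
        "V \<eta> \<zeta> = (LINT (t, x)|(lborel \<Otimes>\<^sub>M lborel). h t x * \<eta> t * \<zeta> x)"
      using h(1) * by (auto simp: trepresented_by_def)
    have eq: "(\<lambda>(t, x). (g t x + h t x) * \<eta> t * \<zeta> x) =
        (\<lambda>z. (case z of (t, x) \<Rightarrow> g t x * \<eta> t * \<zeta> x) + (case z of (t, x) \<Rightarrow> h t x * \<eta> t * \<zeta> x))"
      by (auto simp: fun_eq_iff distrib_right)
    show "integrable (lborel \<Otimes>\<^sub>M lborel) (\<lambda>(t, x). (g t x + h t x) * \<eta> t * \<zeta> x)"
      unfolding eq by (intro Bochner_Integration.integrable_add G H)
    show "U \<eta> \<zeta> + V \<eta> \<zeta> = (LINT (t, x)|(lborel \<Otimes>\<^sub>M lborel). (g t x + h t x) * \<eta> t * \<zeta> x)"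
      unfolding eq by (simp only: Bochner_Integration.integral_add[OF G(1) H(1)] G(2) H(2))
  qed
  then show ?thesis using le unfolding trep_bounded_def by blast
qed

text \<open>Each added summand costs another factor 16. This loss is harmless since the number of
  summands will not depend on the frequency.\<close>

lemma trep_bounded_sum:
  assumes r: "1 \<le> r" and p: "1 \<le> p" and K: "finite K" and U: "\<And>k. k \<in> K \<Longrightarrow> trep_bounded r p (U k) (x k)"
  shows "trep_bounded r p (\<lambda>\<eta> \<zeta>. \<Sum>k\<in>K. U k \<eta> \<zeta>) (16 ^ card K * (\<Sum>k\<in>K. x k))"
  using K U
proof (induction K rule: finite_induct)
  case empty
  show ?case using trep_bounded_zero[OF r p] by simp
next
  case (insert k K)
  have "trep_bounded r p (\<lambda>\<eta> \<zeta>. U k \<eta> \<zeta> + (\<Sum>k\<in>K. U k \<eta> \<zeta>)) (16 * (x k + 16 ^ card K * (\<Sum>k\<in>K. x k)))"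
    using insert by (intro trep_bounded_add r p) auto
  moreover have "16 * (x k + 16 ^ card K * (\<Sum>k\<in>K. x k)) \<le> 16 ^ card (insert k K) * (\<Sum>k\<in>insert k K. x k)"
  proof -
    have "1 * x k \<le> 16 ^ card K * x k" by (intro mult_right_mono one_le_power) auto
    then have "16 * (x k + 16 ^ card K * (\<Sum>k\<in>K. x k)) \<le> 16 * (16 ^ card K * x k + 16 ^ card K * (\<Sum>k\<in>K. x k))"
      by (intro mult_left_mono add_right_mono) auto
    also have "\<dots> = 16 ^ card (insert k K) * (\<Sum>k\<in>insert k K. x k)"
      using insert by (simp add: distrib_left mult.assoc)
    finally show ?thesis .
  qed
  ultimately show ?case
    using insert by (auto simp: trep_bounded_def intro: order_trans)
qed

lemma integrable_product_dilate:
  fixes f :: "real \<times> 'a::euclidean_space \<Rightarrow> complex"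
  assumes a: "0 < a" and b: "0 < b" and f: "integrable (lborel \<Otimes>\<^sub>M lborel) f"
  shows "integrable (lborel \<Otimes>\<^sub>M lborel) (\<lambda>(t, x). f (b * t, a *\<^sub>R x))"
    and "(LINT (t, x)|(lborel \<Otimes>\<^sub>M lborel). f (b * t, a *\<^sub>R x)) = of_real (1 / (b * a ^ DIM('a))) * integral\<^sup>L (lborel \<Otimes>\<^sub>M lborel) f"
proof -
  have fm [measurable]: "f \<in> borel_measurable (lborel \<Otimes>\<^sub>M lborel)" using f by auto
  have m: "(\<lambda>z. f (b * fst z, a *\<^sub>R snd z)) \<in> borel_measurable (lborel \<Otimes>\<^sub>M lborel)"
    by measurable
  have "(\<integral>\<^sup>+z. ennreal (norm (f (b * fst z, a *\<^sub>R snd z))) \<partial>(lborel \<Otimes>\<^sub>M lborel)) =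
      (\<integral>\<^sup>+t. \<integral>\<^sup>+x. ennreal (norm (f (b * t, a *\<^sub>R x))) \<partial>lborel \<partial>lborel)"
    using m by (subst lborel.nn_integral_fst[symmetric]) auto
  also have "\<dots> = (\<integral>\<^sup>+t. ennreal (1 / \<bar>a\<bar> ^ DIM('a)) * (\<integral>\<^sup>+x. ennreal (norm (f (b * t, x))) \<partial>lborel) \<partial>lborel)"
  proof (intro nn_integral_cong)
    fix t
    have "(\<lambda>x. f (b * t, x)) \<in> borel_measurable borel"
      using measurable_compose_Pair1[OF _ fm, of "b * t"] by simp
    then show "(\<integral>\<^sup>+x. ennreal (norm (f (b * t, a *\<^sub>R x))) \<partial>lborel) =
        ennreal (1 / \<bar>a\<bar> ^ DIM('a)) * (\<integral>\<^sup>+x. ennreal (norm (f (b * t, x))) \<partial>lborel)"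
      using a by (subst nn_integral_lborel_scaleR[symmetric, of a "\<lambda>x. ennreal (norm (f (b * t, x)))"]) auto
  qed
  also have "\<dots> = ennreal (1 / \<bar>b\<bar>) * (\<integral>\<^sup>+t. ennreal (1 / \<bar>a\<bar> ^ DIM('a)) * (\<integral>\<^sup>+x. ennreal (norm (f (t, x))) \<partial>lborel) \<partial>lborel)"
  proof -
    have "(\<lambda>t. \<integral>\<^sup>+x. ennreal (norm (f (t, x))) \<partial>lborel) \<in> borel_measurable lborel" by measurable
    then show ?thesis
      using b nn_integral_lborel_scaleR[of b "\<lambda>t. ennreal (1 / \<bar>a\<bar> ^ DIM('a)) * (\<integral>\<^sup>+x. ennreal (norm (f (t, x))) \<partial>lborel)"]
      by simp
  qed
  also have "\<dots> = ennreal (1 / \<bar>b\<bar>) * (ennreal (1 / \<bar>a\<bar> ^ DIM('a)) * (\<integral>\<^sup>+z. ennreal (norm (f z)) \<partial>(lborel \<Otimes>\<^sub>M lborel)))"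
    using lborel.nn_integral_fst[of "\<lambda>z. ennreal (norm (f z))" lborel] by (simp add: nn_integral_cmult)
  also have "\<dots> < \<infinity>"
    using f by (auto simp: integrable_iff_bounded ennreal_mult_less_top)
  finally have int: "integrable (lborel \<Otimes>\<^sub>M lborel) (\<lambda>z. f (b * fst z, a *\<^sub>R snd z))"
    using m by (simp add: integrable_iff_bounded)
  then show "integrable (lborel \<Otimes>\<^sub>M lborel) (\<lambda>(t, x). f (b * t, a *\<^sub>R x))"
    by (simp add: case_prod_unfold)
  have "(LINT (t, x)|(lborel \<Otimes>\<^sub>M lborel). f (b * t, a *\<^sub>R x)) = (LINT t|lborel. LINT x|lborel. f (b * t, a *\<^sub>R x))"
    using lborel_pair.integral_fst'[OF int] by (simp add: case_prod_unfold)
  also have "\<dots> = (LINT t|lborel. (1 / \<bar>a\<bar> ^ DIM('a)) *\<^sub>R (LINT x|lborel. f (b * t, x)))"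
    using a by (subst integral_lborel_scaleR[symmetric, of a]) auto
  also have "\<dots> = (1 / \<bar>a\<bar> ^ DIM('a)) *\<^sub>R (LINT t|lborel. LINT x|lborel. f (b * t, x))"
    by simp
  also have "(LINT t|lborel. LINT x|lborel. f (b * t, x)) = of_real (1 / b) * (LINT t|lborel. LINT x|lborel. f (t, x))"
    using integral_mult_real[OF b, of "\<lambda>t. LINT x|lborel. f (t, x)"] by simp
  also have "(LINT t|lborel. LINT x|lborel. f (t, x)) = integral\<^sup>L (lborel \<Otimes>\<^sub>M lborel) f"
    by (rule lborel_pair.integral_fst'[OF f])
  finally show "(LINT (t, x)|(lborel \<Otimes>\<^sub>M lborel). f (b * t, a *\<^sub>R x)) =
      of_real (1 / (b * a ^ DIM('a))) * integral\<^sup>L (lborel \<Otimes>\<^sub>M lborel) f"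
    using a by (simp add: scaleR_conv_of_real)
qed

lemma trep_bounded_tdilate:
  assumes r: "1 \<le> r" and p: "1 \<le> p" and a: "0 < a" and b: "0 < b"
  obtains C where "0 \<le> C" "\<And>(U :: 'a::euclidean_space tdistr) x. trep_bounded r p U x \<Longrightarrow>
    trep_bounded r p (tdilate c a b U) (ennreal C * x)"
proof -
  obtain C where C: "0 \<le> C" "\<And>g :: real \<Rightarrow> 'a \<Rightarrow> complex.
    case_prod g \<in> borel_measurable (lborel \<Otimes>\<^sub>M lborel) \<Longrightarrow>
    mixed_norm r p (\<lambda>t x. of_real c * g (b * t) (a *\<^sub>R x)) \<le> ennreal C * mixed_norm r p g"
    using mixed_norm_dilate[OF r p a b] by metis
  show ?thesis
  proof (rule that[OF C(1)])
    fix U :: "'a tdistr" and x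
    assume "trep_bounded r p U x"
    then obtain g where g: "trepresented_by {0<..} U g" "mixed_norm r p g \<le> x"
      unfolding trep_bounded_def by blast
    then have gm [measurable]: "case_prod g \<in> borel_measurable (lborel \<Otimes>\<^sub>M lborel)"
      by (simp add: trepresented_by_def)
    have "mixed_norm r p (\<lambda>t x. of_real c * g (b * t) (a *\<^sub>R x)) \<le> ennreal C * x"
      using C(2)[OF gm] g(2) by (meson mult_left_mono order_trans zero_le)
    moreover have "trepresented_by {0<..} (tdilate c a b U) (\<lambda>t x. of_real c * g (b * t) (a *\<^sub>R x))"
      unfolding trepresented_by_def
    proof (intro conjI ballI)
      have "(\<lambda>z. of_real c * case_prod g (b * fst z, a *\<^sub>R snd z)) \<in> borel_measurable (lborel \<Otimes>\<^sub>M lborel)"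
        by measurable
      then show "(\<lambda>(t, x). of_real c * g (b * t) (a *\<^sub>R x)) \<in> borel_measurable (lborel \<Otimes>\<^sub>M lborel)"
        by (simp add: case_prod_unfold)
      fix \<eta> :: "real \<Rightarrow> complex" and \<zeta> :: "'a \<Rightarrow> complex"
      assume \<eta>: "\<eta> \<in> D_test {0<..}" and \<zeta>: "\<zeta> \<in> schwartz"
      have S: "(\<lambda>x. \<zeta> (x /\<^sub>R a)) \<in> schwartz" using a \<zeta> by (intro schwartz_scaleR) auto
      define f where "f = (\<lambda>(t, x). g t x * \<eta> (t / b) * \<zeta> (x /\<^sub>R a))"
      have f: "integrable (lborel \<Otimes>\<^sub>M lborel) f" "U (\<lambda>t. \<eta> (t / b)) (\<lambda>x. \<zeta> (x /\<^sub>R a)) = integral\<^sup>L (lborel \<Otimes>\<^sub>M lborel) f"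
        using g(1) D_test_dilated[OF b \<eta>] S by (auto simp: trepresented_by_def f_def)
      have eq: "(\<lambda>(t, x). of_real c * g (b * t) (a *\<^sub>R x) * \<eta> t * \<zeta> x) =
          (\<lambda>z. of_real c * (case z of (t, x) \<Rightarrow> f (b * t, a *\<^sub>R x)))"
        using a b by (auto simp: f_def fun_eq_iff)
      show "integrable (lborel \<Otimes>\<^sub>M lborel) (\<lambda>(t, x). of_real c * g (b * t) (a *\<^sub>R x) * \<eta> t * \<zeta> x)"
        unfolding eq by (intro integrable_mult_right integrable_product_dilate a b f)
      show "tdilate c a b U \<eta> \<zeta> = (LINT (t, x)|(lborel \<Otimes>\<^sub>M lborel). of_real c * g (b * t) (a *\<^sub>R x) * \<eta> t * \<zeta> x)"
        unfolding eq integral_mult_right_zero integrable_product_dilate(2)[OF a b f(1)]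
        by (simp add: tdilate_def f mult.commute[of b])
    qed
    ultimately show "trep_bounded r p (tdilate c a b U) (ennreal C * x)"
      unfolding trep_bounded_def by blast
  qed
qed

section \<open>Convolution of represented distributions by duality\<close>

lemma norm_integral_le_nn_integral:
  fixes f :: "'b \<Rightarrow> complex"
  shows "ennreal (cmod (LINT x|M. f x)) \<le> (\<integral>\<^sup>+x. ennreal (cmod (f x)) \<partial>M)"
  by (cases "integrable M f") (auto simp: integral_norm_bound_ennreal not_integrable_integral_eq)

text \<open>The convolution of the absolute values, as a function of \<open>y\<close>, is bounded
  because \<open>H\<close> is, and integrable because \<open>H\<close> and \<open>\<zeta>\<close>
  are. These are the two properties of a weight in \<open>nn_integral_mult_le_Lp_norm\<close>;
  \<open>B\<close> serves for both.\<close>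

lemma nn_integral_convolution_weight:
  fixes H \<zeta> :: "'a::euclidean_space \<Rightarrow> complex"
  assumes H: "H \<in> schwartz" and \<zeta>: "\<zeta> \<in> schwartz"
  shows "\<exists>B\<ge>0. (\<forall>y. (\<integral>\<^sup>+x. ennreal (cmod (H (y - x) * \<zeta> x)) \<partial>lborel) \<le> ennreal B) \<and>
    (\<integral>\<^sup>+y. \<integral>\<^sup>+x. ennreal (cmod (H (y - x) * \<zeta> x)) \<partial>lborel \<partial>lborel) \<le> ennreal B"
proof -
  note [measurable] = schwartz_measurable[OF H] schwartz_measurable[OF \<zeta>]
  obtain M where M: "0 \<le> M" "\<And>x. cmod (H x) \<le> M"
    using rapidly_decaying_bounded[OF schwartz_rapidly_decaying[OF H]] by blast
  define h where "h = (LINT x|lborel. cmod (H x))"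
  define z where "z = (LINT x|lborel. cmod (\<zeta> x))"
  have h: "(\<integral>\<^sup>+x. ennreal (cmod (H x)) \<partial>lborel) = ennreal h" "0 \<le> h"
    using schwartz_integrable[OF H] by (simp_all add: h_def nn_integral_eq_integral)
  have z: "(\<integral>\<^sup>+x. ennreal (cmod (\<zeta> x)) \<partial>lborel) = ennreal z" "0 \<le> z"
    using schwartz_integrable[OF \<zeta>] by (simp_all add: z_def nn_integral_eq_integral)
  have le1: "(\<integral>\<^sup>+x. ennreal (cmod (H (y - x) * \<zeta> x)) \<partial>lborel) \<le> ennreal (M * z)" for y
  proof -
    have "(\<integral>\<^sup>+x. ennreal (cmod (H (y - x) * \<zeta> x)) \<partial>lborel) \<le> (\<integral>\<^sup>+x. ennreal M * ennreal (cmod (\<zeta> x)) \<partial>lborel)"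
      using M by (intro nn_integral_mono) (auto simp: norm_mult ennreal_mult[symmetric] intro!: ennreal_leI mult_right_mono)
    then show ?thesis using M z by (simp add: nn_integral_cmult ennreal_mult)
  qed
  have le2: "(\<integral>\<^sup>+y. \<integral>\<^sup>+x. ennreal (cmod (H (y - x) * \<zeta> x)) \<partial>lborel \<partial>lborel) = ennreal (h * z)"
  proof -
    have "(\<integral>\<^sup>+y. \<integral>\<^sup>+x. ennreal (cmod (H (y - x) * \<zeta> x)) \<partial>lborel \<partial>lborel) =
        (\<integral>\<^sup>+x. \<integral>\<^sup>+y. ennreal (cmod (H (y - x))) * ennreal (cmod (\<zeta> x)) \<partial>lborel \<partial>lborel)"
      unfolding norm_mult ennreal_mult[OF norm_ge_zero norm_ge_zero]
      by (intro lborel_pair.Fubini'[symmetric]) measurable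
    also have "\<dots> = (\<integral>\<^sup>+x. ennreal h * ennreal (cmod (\<zeta> x)) \<partial>lborel)"
      by (simp add: nn_integral_multc nn_integral_lborel_translate[of "\<lambda>x. ennreal (cmod (H x))"] h)
    also have "\<dots> = ennreal (h * z)"
      using h z by (simp add: nn_integral_cmult ennreal_mult)
    finally show ?thesis .
  qed
  show ?thesis
  proof (intro exI[of _ "max (M * z) (h * z)"] conjI allI)
    show "0 \<le> max (M * z) (h * z)" using M z by (simp add: le_max_iff_disj)
    show "(\<integral>\<^sup>+x. ennreal (cmod (H (y - x) * \<zeta> x)) \<partial>lborel) \<le> ennreal (max (M * z) (h * z))" for y
      by (rule order_trans[OF le1]) (intro ennreal_leI max.cobounded1)
    show "(\<integral>\<^sup>+y. \<integral>\<^sup>+x. ennreal (cmod (H (y - x) * \<zeta> x)) \<partial>lborel \<partial>lborel) \<le> ennreal (max (M * z) (h * z))"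
      unfolding le2 by (intro ennreal_leI max.cobounded2)
  qed
qed

text \<open>Fubini in the variables \<open>t\<close>, \<open>y\<close>, \<open>x\<close> moves the
  convolution from the test function to the representative \<open>g\<close>. The absolute
  integrability that it requires comes from the finite mixed norm of \<open>g\<close>, by applying
  the crude Hoelder inequality in space and then in time.\<close>

lemma trepresented_by_convolution:
  fixes g :: "real \<Rightarrow> 'a::euclidean_space \<Rightarrow> complex" and H \<zeta> :: "'a \<Rightarrow> complex"
  assumes r: "1 \<le> r" and p: "1 \<le> p" and U: "trepresented_by {0<..} U g" and fin: "mixed_norm r p g < \<infinity>"
    and H: "H \<in> schwartz" and \<zeta>: "\<zeta> \<in> schwartz" and \<eta>: "\<eta> \<in> D_test {0<..}"
    and conv: "(\<lambda>y. LINT x|lborel. H (y - x) * \<zeta> x) \<in> schwartz"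
  shows "integrable (lborel \<Otimes>\<^sub>M lborel) (\<lambda>(t, x). (LINT y|lborel. g t y * H (y - x)) * \<eta> t * \<zeta> x)"
    and "U \<eta> (\<lambda>y. LINT x|lborel. H (y - x) * \<zeta> x) =
      (LINT (t, x)|(lborel \<Otimes>\<^sub>M lborel). (LINT y|lborel. g t y * H (y - x)) * \<eta> t * \<zeta> x)"
proof -
  have gm [measurable]: "case_prod g \<in> borel_measurable (lborel \<Otimes>\<^sub>M lborel)"
    using U by (simp add: trepresented_by_def)
  have \<eta>S: "\<eta> \<in> schwartz" using \<eta> by (rule D_test_schwartz)
  note [measurable] = schwartz_measurable[OF H] schwartz_measurable[OF \<zeta>] schwartz_measurable[OF \<eta>S]
    borel_measurable_section[OF gm]
  define N where "N t = Lp_norm (ennreal p) lborel (\<lambda>x. ennreal (cmod (g t x)))" for t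
  have Nm [measurable]: "N \<in> borel_measurable borel"
    unfolding N_def by (rule borel_measurable_Lp_norm_section[OF gm p])
  have p': "1 \<le> ennreal p" using p by simp
  obtain B where B: "0 \<le> B" "\<And>y. (\<integral>\<^sup>+x. ennreal (cmod (H (y - x) * \<zeta> x)) \<partial>lborel) \<le> ennreal B"
    "(\<integral>\<^sup>+y. \<integral>\<^sup>+x. ennreal (cmod (H (y - x) * \<zeta> x)) \<partial>lborel \<partial>lborel) \<le> ennreal B"
    using nn_integral_convolution_weight[OF H \<zeta>] by (elim exE conjE) simp
  define \<Phi> where "\<Phi> y = (\<integral>\<^sup>+x. ennreal (cmod (H (y - x) * \<zeta> x)) \<partial>lborel)" for y
  have \<Phi>m [measurable]: "\<Phi> \<in> borel_measurable borel"
  proof -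
    have "(\<lambda>y. \<integral>\<^sup>+x. ennreal (cmod (H (y - x) * \<zeta> x)) \<partial>lborel) \<in> borel_measurable lborel" by measurable
    then show ?thesis by (simp add: \<Phi>_def[abs_def])
  qed
  define f where "f t y x = g t y * \<eta> t * (H (y - x) * \<zeta> x)" for t y x
  have "(\<lambda>z. case_prod g (fst z, fst (snd z)) * \<eta> (fst z) * (H (fst (snd z) - snd (snd z)) * \<zeta> (snd (snd z))))
      \<in> borel_measurable (lborel \<Otimes>\<^sub>M (lborel \<Otimes>\<^sub>M lborel))"
    by measurable
  then have fm [measurable]: "(\<lambda>z. f (fst z) (fst (snd z)) (snd (snd z))) \<in> borel_measurable (lborel \<Otimes>\<^sub>M (lborel \<Otimes>\<^sub>M lborel))"
    by (simp add: f_def)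
  have fm2 [measurable]: "(\<lambda>z. f t (fst z) (snd z)) \<in> borel_measurable (lborel \<Otimes>\<^sub>M lborel)" for t
    unfolding f_def by measurable
  \<comment> \<open>Hoelder in \<open>y\<close>, with the weight \<open>\<Phi>\<close>, bounds the
    inner double integral by the spatial norm \<open>N t\<close>.\<close>
  have inner: "(\<integral>\<^sup>+y. \<integral>\<^sup>+x. ennreal (cmod (f t y x)) \<partial>lborel \<partial>lborel) \<le>
      ennreal (2 * B + 1) * (N t * ennreal (cmod (\<eta> t)))" for t
  proof -
    have "(\<integral>\<^sup>+x. ennreal (cmod (f t y x)) \<partial>lborel) = ennreal (cmod (\<eta> t)) * (ennreal (cmod (g t y)) * \<Phi> y)" for y
    proof -
      have "(\<integral>\<^sup>+x. ennreal (cmod (f t y x)) \<partial>lborel) =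
          (\<integral>\<^sup>+x. (ennreal (cmod (\<eta> t)) * ennreal (cmod (g t y))) * ennreal (cmod (H (y - x) * \<zeta> x)) \<partial>lborel)"
        by (intro nn_integral_cong) (simp add: f_def norm_mult ennreal_mult[symmetric] mult_ac)
      then show ?thesis
        unfolding \<Phi>_def by (subst (asm) nn_integral_cmult) (auto simp: mult.assoc)
    qed
    then have eq: "(\<integral>\<^sup>+y. \<integral>\<^sup>+x. ennreal (cmod (f t y x)) \<partial>lborel \<partial>lborel) =
        ennreal (cmod (\<eta> t)) * (\<integral>\<^sup>+y. ennreal (cmod (g t y)) * \<Phi> y \<partial>lborel)"
      by (simp add: nn_integral_cmult)
    have le: "(\<integral>\<^sup>+y. ennreal (cmod (g t y)) * \<Phi> y \<partial>lborel) \<le> N t * ennreal (2 * B + 1)"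
    proof (cases "N t < \<infinity>")
      case True
      then have "(\<integral>\<^sup>+y. ennreal (cmod (g t y)) * \<Phi> y \<partial>lborel) \<le> N t * ((\<integral>\<^sup>+y. \<Phi> y \<partial>lborel) + ennreal B)"
        unfolding N_def using B by (intro nn_integral_mult_le_Lp_norm p') (auto simp: \<Phi>_def)
      also have "\<dots> \<le> N t * (ennreal B + ennreal B)"
        using B(3) unfolding \<Phi>_def by (intro mult_left_mono add_right_mono) auto
      also have "\<dots> \<le> N t * ennreal (2 * B + 1)"
        using B(1) by (intro mult_left_mono) (auto simp flip: ennreal_plus intro!: ennreal_leI)
      finally show ?thesis .
    next
      case False
      then have "N t = top" by (simp add: less_top[symmetric])
      \<comment> \<open>The summand 1 keeps the constant positive even for \<open>B = 0\<close>, so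
        that the bound is infinite when \<open>N t\<close> is, as 0 times infinity is 0.\<close>
      moreover have "ennreal (2 * B + 1) \<noteq> 0" using B(1) by (simp add: ennreal_eq_0_iff not_le)
      ultimately show ?thesis by (simp add: ennreal_top_mult)
    qed
    show ?thesis
      using mult_left_mono[OF le, of "ennreal (cmod (\<eta> t))"] unfolding eq by (simp add: mult_ac)
  qed
  have total: "(\<integral>\<^sup>+t. \<integral>\<^sup>+y. \<integral>\<^sup>+x. ennreal (cmod (f t y x)) \<partial>lborel \<partial>lborel \<partial>lborel) < \<infinity>"
  proof -
    obtain M where M: "\<And>t. cmod (\<eta> t) \<le> M"
      using rapidly_decaying_bounded[OF schwartz_rapidly_decaying[OF \<eta>S]] by blast
    have "(\<integral>\<^sup>+t. \<integral>\<^sup>+y. \<integral>\<^sup>+x. ennreal (cmod (f t y x)) \<partial>lborel \<partial>lborel \<partial>lborel) \<le>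
        (\<integral>\<^sup>+t. ennreal (2 * B + 1) * (N t * ennreal (cmod (\<eta> t))) \<partial>lborel)"
      by (intro nn_integral_mono inner)
    also have "\<dots> = ennreal (2 * B + 1) * (\<integral>\<^sup>+t. N t * ennreal (cmod (\<eta> t)) \<partial>lborel)"
      by (simp add: nn_integral_cmult)
    finally have le: "(\<integral>\<^sup>+t. \<integral>\<^sup>+y. \<integral>\<^sup>+x. ennreal (cmod (f t y x)) \<partial>lborel \<partial>lborel \<partial>lborel) \<le>
        ennreal (2 * B + 1) * (\<integral>\<^sup>+t. N t * ennreal (cmod (\<eta> t)) \<partial>lborel)" .
    \<comment> \<open>Hoelder in \<open>t\<close>, with the weight \<open>cmod (\<eta> t)\<close>.
      As \<open>\<eta>\<close> vanishes off the half line, the integral can be restricted to the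
      times that the mixed norm controls.\<close>
    have "(\<integral>\<^sup>+t. N t * ennreal (cmod (\<eta> t)) \<partial>lborel) =
        (\<integral>\<^sup>+t. N t * ennreal (cmod (\<eta> t)) \<partial>restrict_space lborel {0<..})"
      using D_test_eq_0[OF \<eta>]
      by (subst nn_integral_restrict_space) (auto simp: indicator_def intro!: nn_integral_cong)
    also have "\<dots> \<le> mixed_norm r p g * ((\<integral>\<^sup>+t. ennreal (cmod (\<eta> t)) \<partial>restrict_space lborel {0<..}) + ennreal M)"
      using fin M unfolding mixed_norm_def N_def[abs_def, symmetric]
      by (intro nn_integral_mult_le_Lp_norm r borel_measurable_restrict_lborel) (auto intro!: ennreal_leI)
    also have "\<dots> < \<infinity>"
    proof -
      have "(\<integral>\<^sup>+t. ennreal (cmod (\<eta> t)) \<partial>restrict_space lborel {0<..}) \<le> (\<integral>\<^sup>+t. ennreal (cmod (\<eta> t)) \<partial>lborel)"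
        by (subst nn_integral_restrict_space) (auto intro!: nn_integral_mono simp: indicator_def)
      also have "\<dots> < \<infinity>"
        using schwartz_integrable[OF \<eta>S] by (simp add: integrable_iff_bounded)
      finally show ?thesis using fin by (simp add: ennreal_mult_less_top)
    qed
    finally have "ennreal (2 * B + 1) * (\<integral>\<^sup>+t. N t * ennreal (cmod (\<eta> t)) \<partial>lborel) < \<infinity>"
      by (simp add: ennreal_mult_less_top)
    with le show ?thesis by (rule le_less_trans)
  qed
  have swap_nn: "(\<integral>\<^sup>+x. \<integral>\<^sup>+y. ennreal (cmod (f t y x)) \<partial>lborel \<partial>lborel) = (\<integral>\<^sup>+y. \<integral>\<^sup>+x. ennreal (cmod (f t y x)) \<partial>lborel \<partial>lborel)" for t
    using lborel_pair.Fubini'[of "\<lambda>y x. ennreal (cmod (f t y x))"] fm2[of t] by (simp add: case_prod_unfold)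
  have sf: "sigma_finite_measure (lborel \<Otimes>\<^sub>M lborel :: ('a \<times> 'a) measure)"
    unfolding lborel_prod by (rule sigma_finite_lborel)
  then interpret triple: pair_sigma_finite "lborel :: real measure" "lborel \<Otimes>\<^sub>M lborel :: ('a \<times> 'a) measure"
    by (simp add: pair_sigma_finite_def sigma_finite_lborel)
  have "integrable (lborel \<Otimes>\<^sub>M (lborel \<Otimes>\<^sub>M lborel)) (\<lambda>z. f (fst z) (fst (snd z)) (snd (snd z)))"
  proof (rule integrableI_bounded[OF fm])
    have "(\<integral>\<^sup>+z. ennreal (cmod (f (fst z) (fst (snd z)) (snd (snd z)))) \<partial>(lborel \<Otimes>\<^sub>M (lborel \<Otimes>\<^sub>M lborel))) =
        (\<integral>\<^sup>+t. \<integral>\<^sup>+z. ennreal (cmod (f t (fst z) (snd z))) \<partial>(lborel \<Otimes>\<^sub>M lborel) \<partial>lborel)"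
      using sigma_finite_measure.nn_integral_fst[OF sf, of "\<lambda>z. ennreal (cmod (f (fst z) (fst (snd z)) (snd (snd z))))" lborel] fm by simp
    also have "\<dots> = (\<integral>\<^sup>+t. \<integral>\<^sup>+y. \<integral>\<^sup>+x. ennreal (cmod (f t y x)) \<partial>lborel \<partial>lborel \<partial>lborel)"
      by (subst lborel.nn_integral_fst[symmetric]) auto
    finally show "(\<integral>\<^sup>+z. ennreal (cmod (f (fst z) (fst (snd z)) (snd (snd z)))) \<partial>(lborel \<Otimes>\<^sub>M (lborel \<Otimes>\<^sub>M lborel))) < \<infinity>"
      using total by simp
  qed
  then have "AE t in lborel. integrable (lborel \<Otimes>\<^sub>M lborel) (\<lambda>z. f t (fst z) (snd z))"
    using triple.AE_integrable_fst'[of "\<lambda>z. f (fst z) (fst (snd z)) (snd (snd z))"] by simp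
  \<comment> \<open>The integrals in \<open>y\<close> and \<open>x\<close> can be exchanged for
    almost every \<open>t\<close>, which suffices under the integral in \<open>t\<close>.\<close>
  then have swap: "AE t in lborel. (LINT y|lborel. LINT x|lborel. f t y x) = (LINT x|lborel. LINT y|lborel. f t y x)"
  proof eventually_elim
    case (elim t)
    then have "integrable (lborel \<Otimes>\<^sub>M lborel) (case_prod (\<lambda>y x. f t y x))" by (simp add: case_prod_unfold)
    from lborel_pair.Fubini_integral[OF this] show ?case by simp
  qed
  have f1: "(LINT x|lborel. f t y x) = g t y * \<eta> t * (LINT x|lborel. H (y - x) * \<zeta> x)" for t y
    unfolding f_def by (rule integral_mult_right_zero)
  have f2: "(LINT y|lborel. f t y x) = (LINT y|lborel. g t y * H (y - x)) * \<eta> t * \<zeta> x" for t x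
  proof -
    have "f t y x = (g t y * H (y - x)) * (\<eta> t * \<zeta> x)" for y by (simp add: f_def mult_ac)
    then have "(LINT y|lborel. f t y x) = (LINT y|lborel. g t y * H (y - x)) * (\<eta> t * \<zeta> x)"
      by (simp only: integral_mult_left_zero)
    then show ?thesis by (simp only: mult.assoc)
  qed
  have m: "(\<lambda>z. LINT y|lborel. f (fst z) y (snd z)) \<in> borel_measurable (lborel \<Otimes>\<^sub>M lborel)"
  proof -
    have "(\<lambda>(z, y). case_prod g (fst z, y) * \<eta> (fst z) * (H (y - snd z) * \<zeta> (snd z))) \<in> borel_measurable ((lborel \<Otimes>\<^sub>M lborel) \<Otimes>\<^sub>M lborel)"
      by measurable
    then have "(\<lambda>(z, y). f (fst z) y (snd z)) \<in> borel_measurable ((lborel \<Otimes>\<^sub>M lborel) \<Otimes>\<^sub>M lborel)"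
      by (simp add: f_def)
    then show ?thesis by (rule lborel.borel_measurable_lebesgue_integral)
  qed
  have int: "integrable (lborel \<Otimes>\<^sub>M lborel) (\<lambda>z. LINT y|lborel. f (fst z) y (snd z))"
  proof (rule integrableI_bounded[OF m])
    have "(\<integral>\<^sup>+z. ennreal (cmod (LINT y|lborel. f (fst z) y (snd z))) \<partial>(lborel \<Otimes>\<^sub>M lborel)) =
        (\<integral>\<^sup>+t. \<integral>\<^sup>+x. ennreal (cmod (LINT y|lborel. f t y x)) \<partial>lborel \<partial>lborel)"
      using m by (subst lborel.nn_integral_fst[symmetric]) auto
    also have "\<dots> \<le> (\<integral>\<^sup>+t. \<integral>\<^sup>+x. \<integral>\<^sup>+y. ennreal (cmod (f t y x)) \<partial>lborel \<partial>lborel \<partial>lborel)"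
      by (intro nn_integral_mono norm_integral_le_nn_integral)
    finally show "(\<integral>\<^sup>+z. ennreal (cmod (LINT y|lborel. f (fst z) y (snd z))) \<partial>(lborel \<Otimes>\<^sub>M lborel)) < \<infinity>"
      using total unfolding swap_nn by (rule le_less_trans)
  qed
  then show "integrable (lborel \<Otimes>\<^sub>M lborel) (\<lambda>(t, x). (LINT y|lborel. g t y * H (y - x)) * \<eta> t * \<zeta> x)"
    unfolding f2 by (simp add: case_prod_unfold)
  have U': "integrable (lborel \<Otimes>\<^sub>M lborel) (\<lambda>z. g (fst z) (snd z) * \<eta> (fst z) * (LINT x|lborel. H (snd z - x) * \<zeta> x))"
    "U \<eta> (\<lambda>y. LINT x|lborel. H (y - x) * \<zeta> x) =
      (LINT z|(lborel \<Otimes>\<^sub>M lborel). g (fst z) (snd z) * \<eta> (fst z) * (LINT x|lborel. H (snd z - x) * \<zeta> x))"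
    using U[unfolded trepresented_by_def, THEN conjunct2, THEN bspec, OF \<eta>, THEN bspec, OF conv]
    by (simp_all add: case_prod_unfold)
  have "U \<eta> (\<lambda>y. LINT x|lborel. H (y - x) * \<zeta> x) = (LINT t|lborel. LINT y|lborel. LINT x|lborel. f t y x)"
    unfolding U'(2) f1 using lborel_pair.integral_fst'[OF U'(1)] by simp
  also have "\<dots> = (LINT t|lborel. LINT x|lborel. LINT y|lborel. f t y x)"
  proof (rule integral_cong_AE[OF _ _ swap])
    show "(\<lambda>t. LINT y|lborel. LINT x|lborel. f t y x) \<in> borel_measurable lborel"
      unfolding f1 using lborel_pair.integrable_fst'[OF U'(1)] by auto
    show "(\<lambda>t. LINT x|lborel. LINT y|lborel. f t y x) \<in> borel_measurable lborel"
      using lborel_pair.integrable_fst'[OF int] by auto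
  qed
  also have "\<dots> = (LINT z|(lborel \<Otimes>\<^sub>M lborel). LINT y|lborel. f (fst z) y (snd z))"
    using lborel_pair.integral_fst'[OF int] by simp
  finally show "U \<eta> (\<lambda>y. LINT x|lborel. H (y - x) * \<zeta> x) =
      (LINT (t, x)|(lborel \<Otimes>\<^sub>M lborel). (LINT y|lborel. g t y * H (y - x)) * \<eta> t * \<zeta> x)"
    unfolding f2 by (simp add: case_prod_unfold)
qed

text \<open>The constant depends on the kernel through its norm in \<open>L^1\<close> alone, so it
  is common to all kernels of the same mass. Finiteness of \<open>x\<close> supplies the
  integrability that Fubini needs.\<close>

lemma trep_bounded_convolution:
  fixes U :: "'a::euclidean_space tdistr" and H :: "'a \<Rightarrow> complex"
  assumes r: "1 \<le> r" and p: "1 \<le> p" and U: "trep_bounded r p U x" and x: "x < \<infinity>" and H: "H \<in> schwartz"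
    and conv: "\<And>\<zeta>. \<zeta> \<in> schwartz \<Longrightarrow> (\<lambda>y. LINT x|lborel. H (y - x) * \<zeta> x) \<in> schwartz"
  defines "\<kappa> \<equiv> LINT x|lborel. cmod (H x)"
  shows "trep_bounded r p (\<lambda>\<eta> \<zeta>. U \<eta> (\<lambda>y. LINT x|lborel. H (y - x) * \<zeta> x))
    (ennreal ((\<kappa> + 1) * \<kappa> powr (1 / p)) * x)"
proof -
  obtain g where g: "trepresented_by {0<..} U g" "mixed_norm r p g \<le> x"
    using U unfolding trep_bounded_def by blast
  have gm [measurable]: "case_prod g \<in> borel_measurable (lborel \<Otimes>\<^sub>M lborel)"
    using g by (simp add: trepresented_by_def)
  note [measurable] = schwartz_measurable[OF H]
  have fin: "mixed_norm r p g < \<infinity>" using g(2) x by simp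
  define h where "h t x = (LINT y|lborel. g t y * H (y - x))" for t x
  have hm: "case_prod h \<in> borel_measurable (lborel \<Otimes>\<^sub>M lborel)"
  proof -
    have "(\<lambda>(z, y). case_prod g (fst z, y) * H (y - snd z)) \<in> borel_measurable ((lborel \<Otimes>\<^sub>M lborel) \<Otimes>\<^sub>M lborel)"
      by measurable
    then have "(\<lambda>z. LINT y|lborel. g (fst z) y * H (y - snd z)) \<in> borel_measurable (lborel \<Otimes>\<^sub>M lborel)"
      using lborel.borel_measurable_lebesgue_integral[of "\<lambda>z y. g (fst z) y * H (y - snd z)" "lborel \<Otimes>\<^sub>M lborel"] by simp
    then show ?thesis by (simp add: h_def case_prod_unfold)
  qed
  have "mixed_norm r p h \<le> ennreal ((\<kappa> + 1) * \<kappa> powr (1 / p)) * mixed_norm r p g"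
    unfolding \<kappa>_def
  proof (rule mixed_norm_convolution[OF r p gm hm schwartz_integrable[OF H]])
    fix t x
    show "ennreal (cmod (h t x)) \<le> (\<integral>\<^sup>+y. ennreal (cmod (g t y)) * ennreal (cmod (H (y - x))) \<partial>lborel)"
      using norm_integral_le_nn_integral[of lborel "\<lambda>y. g t y * H (y - x)"]
      by (simp add: h_def norm_mult ennreal_mult)
  qed
  also have "\<dots> \<le> ennreal ((\<kappa> + 1) * \<kappa> powr (1 / p)) * x"
    by (intro mult_left_mono g) auto
  finally have "mixed_norm r p h \<le> ennreal ((\<kappa> + 1) * \<kappa> powr (1 / p)) * x" .
  moreover have "trepresented_by {0<..} (\<lambda>\<eta> \<zeta>. U \<eta> (\<lambda>y. LINT x|lborel. H (y - x) * \<zeta> x)) h"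
    unfolding trepresented_by_def
    using hm trepresented_by_convolution[OF r p g(1) fin H _ _ conv]
    by (simp add: h_def)
  ultimately show ?thesis unfolding trep_bounded_def by blast
qed

section \<open>Dilation invariance of the Chemin-Lerner spaces\<close>

lemma dparts_add:
  assumes "smooth_fun f" "smooth_fun g" "set bs \<subseteq> Basis"
  shows "dparts bs (\<lambda>x. f x + g x) = (\<lambda>x. dparts bs f x + dparts bs g x)"
  using assms(3)
proof (induction bs)
  case (Cons b bs)
  then have d: "dparts bs f differentiable (at x)" "dparts bs g differentiable (at x)" for x
    using assms(1,2) unfolding smooth_fun_def by auto
  have "dpart b (\<lambda>x. dparts bs f x + dparts bs g x) = (\<lambda>x. dpart b (dparts bs f) x + dpart b (dparts bs g) x)"
    using dpart_lincomb[OF d, of b 1 1] by auto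
  then show ?case using Cons by simp
qed simp

lemma Z_test_add:
  assumes "f \<in> Z_test" "g \<in> Z_test"
  shows "(\<lambda>x. f x + g x) \<in> Z_test"
proof -
  note S = assms[THEN Z_testD]
  have F: "fourier (\<lambda>x. f x + g x) = (\<lambda>\<xi>. fourier f \<xi> + fourier g \<xi>)"
    using S by (intro ext fourier_add schwartz_integrable)
  have "dparts bs (fourier (\<lambda>x. f x + g x)) 0 = 0" if bs: "set bs \<subseteq> Basis" for bs
    unfolding F using assms bs dparts_add[OF schwartz_smooth schwartz_smooth bs, OF S[THEN fourier_schwartz]]
    by (simp add: Z_test_def)
  then show ?thesis
    unfolding Z_test_def using schwartz_add[OF S] by blast
qed

text \<open>Membership and additivity are carried through one induction, because linearity of
  \<open>u\<close> is available on \<open>Z_test\<close> only.\<close>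

lemma Z_dual_sum:
  assumes u: "u \<in> Z_dual" and K: "finite K" and f: "\<And>k. k \<in> K \<Longrightarrow> f k \<in> Z_test"
  shows "(\<lambda>x. \<Sum>k\<in>K. f k x) \<in> Z_test \<and> u (\<lambda>x. \<Sum>k\<in>K. f k x) = (\<Sum>k\<in>K. u (f k))"
  using K f
proof (induction K rule: finite_induct)
  case empty
  have z: "(\<lambda>x. 0) \<in> (Z_test :: ('a \<Rightarrow> complex) set)"
    using fourier_mem_Z_test[OF schwartz_zero zero_less_one] by (simp add: fourier_def[abs_def])
  have "u (\<lambda>x. 0 * 0 + 0 * 0) = 0 * u (\<lambda>x. 0) + 0 * u (\<lambda>x. 0)"
    using u by (intro lin_onD[of Z_test u "\<lambda>x. 0" "\<lambda>x. 0", OF _ z z]) (simp add: Z_dual_def)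
  then show ?case using z by simp
next
  case (insert k K)
  let ?g = "\<lambda>x. \<Sum>k\<in>K. f k x"
  have fk: "f k \<in> Z_test" and g: "?g \<in> Z_test" "u ?g = (\<Sum>k\<in>K. u (f k))"
    using insert by auto
  have "u (\<lambda>x. 1 * f k x + 1 * ?g x) = 1 * u (f k) + 1 * u ?g"
    using u by (intro lin_onD[OF _ fk g(1)]) (simp add: Z_dual_def)
  then show ?case using insert g Z_test_add[OF fk g(1)] by simp
qed

lemma dyadic_partition_support:
  assumes "dyadic_partition r R \<theta>" "\<theta> \<xi> \<noteq> 0"
  shows "r \<le> norm \<xi>" "norm \<xi> \<le> R"
proof -
  have cl: "\<xi> \<in> closure {\<xi>. \<theta> \<xi> \<noteq> 0}" using assms(2) by (intro closure_subset[THEN subsetD]) simp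
  have "closure {\<xi>. \<theta> \<xi> \<noteq> 0} \<subseteq> {\<xi>. r \<le> norm \<xi> \<and> norm \<xi> \<le> R}"
    using assms(1) by (simp add: dyadic_partition_def)
  from subsetD[OF this cl] show "r \<le> norm \<xi>" "norm \<xi> \<le> R" by simp_all
qed

text \<open>Non-vanishing at level \<open>j\<close> puts
  \<open>2 powi (- j) * a * norm \<xi>\<close> between 3/4 and 8/3, and non-vanishing of the summand
  of index \<open>k\<close> does the same for \<open>2 powi (- k) * norm \<xi>\<close>. If
  \<open>k\<close> and \<open>j\<close> differ by more than \<open>L\<close>, these quantities
  differ by a factor of at least 4, which exceeds the ratio 32/9 of the radii. Hence all other terms
  of the full dyadic sum vanish.\<close>

lemma dyadic_partition_overlap:
  fixes \<phi> :: "'a::euclidean_space \<Rightarrow> real"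
  assumes \<phi>: "dyadic_partition (3/4) (8/3) \<phi>" and a: "0 < a"
    and L: "4 * a \<le> 2 ^ L" "4 / a \<le> 2 ^ L"
    and \<xi>: "\<phi> (2 powi (- j) *\<^sub>R a *\<^sub>R \<xi>) \<noteq> 0"
  shows "(\<Sum>k = j - int L..j + int L. \<phi> (2 powi (- k) *\<^sub>R \<xi>)) = 1"
proof -
  have m: "3/4 \<le> norm (2 powi (- j) *\<^sub>R a *\<^sub>R \<xi>)" "norm (2 powi (- j) *\<^sub>R a *\<^sub>R \<xi>) \<le> 8/3"
    using dyadic_partition_support[OF \<phi> \<xi>] by auto
  have m': "3/4 \<le> 2 powi (- j) * a * norm \<xi>" "2 powi (- j) * a * norm \<xi> \<le> 8/3"
    using m a by (simp_all add: mult.assoc)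
  have "\<xi> \<noteq> 0" using m' by auto
  have zero: "\<phi> (2 powi (- k) *\<^sub>R \<xi>) = 0" if k: "k \<notin> {j - int L..j + int L}" for k
  proof (rule ccontr)
    assume nz: "\<phi> (2 powi (- k) *\<^sub>R \<xi>) \<noteq> 0"
    have "3/4 \<le> norm (2 powi (- k) *\<^sub>R \<xi>)" "norm (2 powi (- k) *\<^sub>R \<xi>) \<le> 8/3"
      by (rule dyadic_partition_support[OF \<phi> nz])+
    then have nk: "3/4 \<le> 2 powi (- k) * norm \<xi>" "2 powi (- k) * norm \<xi> \<le> 8/3" by simp_all
    have split: "(2::real) powi (- j) = 2 powi (k - j) * 2 powi (- k)"
      by (simp add: power_int_diff power_int_minus field_simps)
    consider "k - j > int L" | "j - k > int L" using k by force
    then show False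
    proof cases
      case 1
      have "(2::real) ^ L * 1 \<le> 2 powi (k - j)"
        using 1 power_int_increasing[of "int L" "k - j" "2::real"] by simp
      then have "4 / a * 1 \<le> 2 powi (k - j)" using L by linarith
      then have "4 \<le> 2 powi (k - j) * a" using a by (simp add: field_simps)
      then have "4 * (3/4) \<le> (2 powi (k - j) * a) * (2 powi (- k) * norm \<xi>)"
        using nk by (intro mult_mono) auto
      also have "\<dots> = 2 powi (- j) * a * norm \<xi>" unfolding split by (simp add: mult_ac)
      finally show False using m' by simp
    next
      case 2
      have "(2::real) ^ L * 1 \<le> 2 powi (j - k)"
        using 2 power_int_increasing[of "int L" "j - k" "2::real"] by simp
      then have "4 * a \<le> 2 powi (j - k)" using L by linarith
      then have "4 * a * (2 powi (- j) * norm \<xi>) \<le> 2 powi (j - k) * (2 powi (- j) * norm \<xi>)"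
        by (intro mult_right_mono) auto
      also have "\<dots> = 2 powi (- k) * norm \<xi>"
        by (simp add: power_int_diff power_int_minus field_simps)
      finally show False using m' nk by (simp add: mult_ac)
    qed
  qed
  have "((\<lambda>k::int. \<phi> (2 powi (- k) *\<^sub>R \<xi>)) has_sum 1) UNIV"
    using \<phi> \<open>\<xi> \<noteq> 0\<close> by (simp add: dyadic_partition_def)
  moreover have "((\<lambda>k::int. \<phi> (2 powi (- k) *\<^sub>R \<xi>)) has_sum 1) UNIV \<longleftrightarrow>
      ((\<lambda>k::int. \<phi> (2 powi (- k) *\<^sub>R \<xi>)) has_sum 1) {j - int L..j + int L}"
    using zero by (intro has_sum_cong_neutral) auto
  ultimately have "((\<lambda>k::int. \<phi> (2 powi (- k) *\<^sub>R \<xi>)) has_sum 1) {j - int L..j + int L}"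
    by blast
  then show ?thesis
    using has_sum_finite[of "{j - int L..j + int L}" "\<lambda>k. \<phi> (2 powi (- k) *\<^sub>R \<xi>)"] has_sum_unique by blast
qed

text \<open>On the support of the dilated symbol, the finite sum of neighbouring blocks has symbol
  1, so it can be inserted without changing anything. What remains beside each block is the
  multiplier \<open>m\<close>, which acts on the test function as a convolution.\<close>

lemma lp_block_dilated_partition:
  fixes \<phi> :: "'a::euclidean_space \<Rightarrow> real" and j :: int
  assumes \<phi>: "dyadic_partition (3/4) (8/3) \<phi>" and a: "0 < a"
    and L: "4 * a \<le> 2 ^ L" "4 / a \<le> 2 ^ L"
    and u: "u \<in> Z_dual" and \<zeta>: "\<zeta> \<in> schwartz"
  defines "m \<equiv> \<lambda>\<xi>. complex_of_real (\<phi> (a *\<^sub>R 2 powi (- j) *\<^sub>R \<xi>))"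
  shows "lp_block (\<lambda>\<xi>. \<phi> (a *\<^sub>R \<xi>)) j u \<zeta> =
    (\<Sum>k = j - int L..j + int L. lp_block \<phi> k u (fourier (\<lambda>\<xi>. m \<xi> * fourier_inv \<zeta> \<xi>)))"
proof -
  let ?K = "{j - int L..j + int L}"
  have \<phi>S: "(\<lambda>\<xi>. complex_of_real (\<phi> \<xi>)) \<in> schwartz" using \<phi> by (simp add: dyadic_partition_def)
  have bump: "(\<lambda>\<xi>. complex_of_real (\<phi> (c *\<^sub>R \<xi>))) \<in> schwartz" if "c \<noteq> 0" for c
    using schwartz_scaleR[OF \<phi>S that] .
  have m: "m \<in> schwartz"
    unfolding m_def scaleR_scaleR using a by (intro bump) simp
  define h where "h = (\<lambda>\<xi>. m \<xi> * fourier_inv \<zeta> \<xi>)"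
  have h: "h \<in> schwartz" unfolding h_def by (intro schwartz_mult m fourier_inv_schwartz \<zeta>)
  have Fh: "fourier h \<in> schwartz" using h by (rule fourier_schwartz)
  \<comment> \<open>\<open>lp_block\<close> starts with an inverse transform; applied to
    \<open>fourier h\<close> this returns \<open>h\<close>, so the two symbols multiply.\<close>
  have inv: "fourier_inv (fourier h) = h" using fourier_inversion[OF h] by blast
  define f where "f k = (\<lambda>\<xi>. of_real (\<phi> (2 powi (- k) *\<^sub>R \<xi>)) * h \<xi>)" for k :: int
  have fS: "f k \<in> schwartz" for k
    unfolding f_def by (intro schwartz_mult bump h) simp
  \<comment> \<open>Splitting \<open>u (fourier h)\<close> into its pieces uses linearity of
    \<open>u\<close>, hence needs each piece in \<open>Z_test\<close>. The radius is the inner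
    radius 3/4 of the support of \<open>\<phi>\<close>, scaled by \<open>2 powi k\<close>.\<close>
  have fZ: "fourier (f k) \<in> Z_test" for k
  proof (rule fourier_mem_Z_test[OF fS])
    show "0 < 2 powi k * (3/4 :: real)" by simp
    fix \<xi> :: 'a assume \<xi>: "norm \<xi> < 2 powi k * (3/4)"
    have "\<phi> (2 powi (- k) *\<^sub>R \<xi>) = 0"
    proof (rule ccontr)
      assume "\<phi> (2 powi (- k) *\<^sub>R \<xi>) \<noteq> 0"
      then have "3/4 \<le> norm (2 powi (- k) *\<^sub>R \<xi>)" by (rule dyadic_partition_support[OF \<phi>])
      with \<xi> show False by (simp add: power_int_minus field_simps)
    qed
    then show "f k \<xi> = 0" by (simp add: f_def)
  qed
  have "h \<xi> = (\<Sum>k\<in>?K. f k \<xi>)" for \<xi>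
  proof (cases "m \<xi> = 0")
    case False
    then have "\<phi> (2 powi (- j) *\<^sub>R a *\<^sub>R \<xi>) \<noteq> 0" by (simp add: m_def mult.commute)
    from dyadic_partition_overlap[OF \<phi> a L this]
    have "(\<Sum>k\<in>?K. complex_of_real (\<phi> (2 powi (- k) *\<^sub>R \<xi>))) = 1"
      by (metis of_real_1 of_real_sum)
    then show ?thesis by (simp add: f_def flip: sum_distrib_right)
  qed (simp add: f_def h_def)
  then have h_eq: "h = (\<lambda>\<xi>. \<Sum>k\<in>?K. f k \<xi>)" by blast
  have "fourier h = (\<lambda>x. \<Sum>k\<in>?K. fourier (f k) x)"
    by (rule ext, subst h_eq, rule fourier_sum[OF schwartz_integrable[OF fS]])
  then have "u (fourier h) = (\<Sum>k\<in>?K. u (fourier (f k)))"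
    using Z_dual_sum[OF u, of ?K "\<lambda>k. fourier (f k)"] fZ by simp
  moreover have "lp_block (\<lambda>\<xi>. \<phi> (a *\<^sub>R \<xi>)) j u \<zeta> = u (fourier h)"
    using \<zeta> by (simp add: lp_block_def h_def m_def)
  moreover have "lp_block \<phi> k u (fourier h) = u (fourier (f k))" for k
    using Fh by (simp add: lp_block_def inv f_def)
  ultimately show ?thesis by (simp add: h_def)
qed

text \<open>The strict hypothesis places each block norm, an infimum, strictly below the stated
  bound, so some representative obeys that bound.\<close>

lemma chemin_lerner_trep_bounded:
  assumes "chemin_lerner_norm \<phi> \<infinity> r s (ennreal p) V < ennreal A"
  shows "trep_bounded r p (\<lambda>\<eta>. lp_block \<phi> k (V \<eta>)) (ennreal (A * 2 powr (- (real_of_int k * s))))"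
proof -
  let ?w = "2 powr (real_of_int k * s)"
  let ?D = "distr_LrLp_norm {0<..} r (ennreal p) (\<lambda>\<eta>. lp_block \<phi> k (V \<eta>))"
  have "ennreal ?w * ?D \<le> chemin_lerner_norm \<phi> \<infinity> r s (ennreal p) V"
    unfolding chemin_lerner_norm_def time_interval_infinity by (rule SUP_upper) simp
  then have lt: "ennreal ?w * ?D < ennreal A" using assms by (rule le_less_trans)
  have "?D < ennreal (A * 2 powr (- (real_of_int k * s)))"
  proof (rule ccontr)
    assume "\<not> ?thesis"
    then have "ennreal ?w * ennreal (A * 2 powr (- (real_of_int k * s))) \<le> ennreal ?w * ?D"
      by (intro mult_left_mono) auto
    also have "ennreal ?w * ennreal (A * 2 powr (- (real_of_int k * s))) = ennreal A"
    proof -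
      have "?w * (A * 2 powr (- (real_of_int k * s))) = A" by (simp add: powr_minus)
      then show ?thesis by (metis ennreal_mult' powr_ge_zero)
    qed
    finally show False using lt by simp
  qed
  then show ?thesis
    unfolding distr_LrLp_norm_def Inf_less_iff trep_bounded_def mixed_norm_def by (auto intro: less_imp_le)
qed

lemma tdilate_chemin_lerner:
  fixes V :: "'a::euclidean_space tdistr"
  assumes \<phi>: "dyadic_partition (3/4) (8/3) \<phi>" and r: "1 \<le> r" and p: "1 \<le> p" and a: "0 < a" and b: "0 < b"
    and V: "V \<in> chemin_lerner \<phi> \<infinity> r s (ennreal p)"
  shows "tdilate c a b V \<in> chemin_lerner \<phi> \<infinity> r s (ennreal p)"
proof -
  have VZ: "V \<in> Z_distributions {0<..}" and fin: "chemin_lerner_norm \<phi> \<infinity> r s (ennreal p) V < \<infinity>"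
    using V by (simp_all add: chemin_lerner_def)
  obtain A where A: "0 \<le> A" "chemin_lerner_norm \<phi> \<infinity> r s (ennreal p) V < ennreal A"
  proof -
    obtain y where y: "chemin_lerner_norm \<phi> \<infinity> r s (ennreal p) V = ennreal y" "0 \<le> y"
      using fin by (metis ennreal_cases infinity_ennreal_def less_irrefl)
    then show ?thesis using that[of "y + 1"] by (simp add: ennreal_lessI del: ennreal_plus)
  qed
  \<comment> \<open>\<open>L\<close> is determined by \<open>a\<close> alone, so the number
    \<open>2 * L + 1\<close> of neighbouring blocks is the same at every frequency.\<close>
  obtain L where L: "4 * a \<le> 2 ^ L" "4 / a \<le> 2 ^ L"
  proof -
    obtain L where "max (4 * a) (4 / a) < 2 ^ L" using real_arch_pow[of 2 "max (4 * a) (4 / a)"] by auto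
    then show ?thesis using that[of L] by simp
  qed
  define \<phi>' where "\<phi>' = (\<lambda>\<xi>. complex_of_real (\<phi> \<xi>))"
  have \<phi>S: "\<phi>' \<in> schwartz" using \<phi> by (simp add: dyadic_partition_def \<phi>'_def)
  define \<gamma> where "\<gamma> = (2 * pi) powr (- real DIM('a) / 2)"
  define \<kappa> where "\<kappa> = \<gamma> * (LINT x|lborel. cmod (fourier \<phi>' x))"
  have \<kappa>: "0 \<le> \<kappa>" by (simp add: \<kappa>_def \<gamma>_def)
  define C1 where "C1 = (\<kappa> + 1) * \<kappa> powr (1 / p)"
  have C1: "0 \<le> C1" using \<kappa> by (simp add: C1_def)
  obtain C2 where C2: "0 \<le> C2" "\<And>(U :: 'a tdistr) x. trep_bounded r p U x \<Longrightarrow>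
    trep_bounded r p (tdilate c a b U) (ennreal C2 * x)"
    using trep_bounded_tdilate[OF r p a b, of c] by metis
  let ?K = "\<lambda>j. {j - int L..j + int L}"
  \<comment> \<open>The factors are the loss of \<open>trep_bounded_sum\<close> for
    \<open>2 * L + 1\<close> blocks, their number, the Young constant \<open>C1\<close>, the bound
    \<open>A\<close> on the norm of \<open>V\<close>, and the largest change of the weight
    \<open>2 powr (- (real_of_int k * s))\<close> over a distance \<open>L\<close> from
    \<open>j\<close>.\<close>
  define E where "E = 16 ^ (2 * L + 1) * (real (2 * L + 1) * (C1 * (A * 2 powr (real L * \<bar>s\<bar>))))"
  have E: "0 \<le> E" using C1 A by (simp add: E_def)
  have block: "trep_bounded r p (\<lambda>\<eta>. lp_block (\<lambda>\<xi>. \<phi> (a *\<^sub>R \<xi>)) j (V \<eta>)) (ennreal (E * 2 powr (- (real_of_int j * s))))" for j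
  proof -
    define lam where "lam = a * 2 powi (- j)"
    have l: "0 < lam" using a by (simp add: lam_def)
    define m where "m = (\<lambda>\<xi>. \<phi>' (lam *\<^sub>R \<xi>))"
    have m: "m \<in> schwartz" unfolding m_def using l by (intro schwartz_scaleR \<phi>S) simp
    define H where "H = (\<lambda>x. complex_of_real \<gamma> * fourier m x)"
    have H: "H \<in> schwartz" unfolding H_def by (intro schwartz_cmult fourier_schwartz m)
    have conv: "(\<lambda>y. LINT x|lborel. H (y - x) * \<zeta> x) = fourier (\<lambda>\<xi>. m \<xi> * fourier_inv \<zeta> \<xi>)"
      if "\<zeta> \<in> schwartz" for \<zeta>
      using fourier_mult_fourier_inv[OF m that] by (simp add: fun_eq_iff H_def \<gamma>_def)
    have convS: "(\<lambda>y. LINT x|lborel. H (y - x) * \<zeta> x) \<in> schwartz" if "\<zeta> \<in> schwartz" for \<zeta>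
      unfolding conv[OF that] by (intro fourier_schwartz schwartz_mult m fourier_inv_schwartz that)
    \<comment> \<open>Dilating the symbol by \<open>lam\<close> turns its transform into a dilate
      normalized in \<open>L^1\<close>: the Jacobian \<open>lam ^ DIM('a)\<close> cancels the factor
      of \<open>fourier_scaleR\<close>. The mass is therefore free of \<open>j\<close>.\<close>
    have mass: "(LINT x|lborel. cmod (H x)) = \<kappa>"
    proof -
      have "cmod (H x) = \<gamma> * (1 / lam ^ DIM('a) * cmod (fourier \<phi>' (inverse lam *\<^sub>R x)))" for x
        using l unfolding H_def m_def by (subst fourier_scaleR) (auto simp: norm_mult norm_divide norm_power \<gamma>_def)
      then have "(LINT x|lborel. cmod (H x)) =
          \<gamma> * (1 / lam ^ DIM('a) * (LINT x|lborel. cmod (fourier \<phi>' (inverse lam *\<^sub>R x))))"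
        by simp
      also have "(LINT x|lborel. cmod (fourier \<phi>' (inverse lam *\<^sub>R x))) = lam ^ DIM('a) * (LINT x|lborel. cmod (fourier \<phi>' x))"
        using l integral_lborel_scaleR[of "inverse lam" "\<lambda>x. cmod (fourier \<phi>' x)"]
        by (simp add: power_inverse divide_inverse mult.commute)
      finally show ?thesis using l by (simp add: \<kappa>_def)
    qed
    have k: "trep_bounded r p (\<lambda>\<eta> \<zeta>. lp_block \<phi> k (V \<eta>) (\<lambda>y. LINT x|lborel. H (y - x) * \<zeta> x))
        (ennreal C1 * ennreal (A * 2 powr (- (real_of_int k * s))))" for k
      using trep_bounded_convolution[OF r p chemin_lerner_trep_bounded[OF A(2), of k] _ H convS]
      unfolding mass C1_def by simp
    have sum: "trep_bounded r p (\<lambda>\<eta> \<zeta>. \<Sum>k\<in>?K j. lp_block \<phi> k (V \<eta>) (\<lambda>y. LINT x|lborel. H (y - x) * \<zeta> x))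
        (16 ^ card (?K j) * (\<Sum>k\<in>?K j. ennreal C1 * ennreal (A * 2 powr (- (real_of_int k * s)))))"
      by (intro trep_bounded_sum r p k) simp
    have "16 ^ card (?K j) * (\<Sum>k\<in>?K j. ennreal C1 * ennreal (A * 2 powr (- (real_of_int k * s)))) \<le>
        ennreal (E * 2 powr (- (real_of_int j * s)))"
    proof -
      have card: "card (?K j) = 2 * L + 1"
        unfolding card_atLeastAtMost_int by linarith
      \<comment> \<open>Since \<open>k\<close> and \<open>j\<close> differ by at most
        \<open>L\<close>, replacing \<open>k\<close> by \<open>j\<close> in the weight costs at most
        \<open>2 powr (real L * \<bar>s\<bar>)\<close>, for either sign of \<open>s\<close>.\<close>
      have le: "A * 2 powr (- (real_of_int k * s)) \<le> A * (2 powr (real L * \<bar>s\<bar>) * 2 powr (- (real_of_int j * s)))"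
        if "k \<in> ?K j" for k
      proof (intro mult_left_mono A)
        have "\<bar>real_of_int (j - k)\<bar> * \<bar>s\<bar> \<le> real L * \<bar>s\<bar>"
          using that by (intro mult_right_mono) auto
        then have "real_of_int (j - k) * s \<le> real L * \<bar>s\<bar>"
          using abs_ge_self[of "real_of_int (j - k) * s"] unfolding abs_mult by linarith
        then have "- (real_of_int k * s) \<le> real L * \<bar>s\<bar> + - (real_of_int j * s)"
          by (simp add: left_diff_distrib)
        then show "2 powr (- (real_of_int k * s)) \<le> 2 powr (real L * \<bar>s\<bar>) * 2 powr (- (real_of_int j * s))"
          unfolding powr_add[symmetric] by (intro powr_mono) auto
      qed
      have "(\<Sum>k\<in>?K j. ennreal C1 * ennreal (A * 2 powr (- (real_of_int k * s)))) \<le>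
          (\<Sum>k\<in>?K j. ennreal C1 * ennreal (A * (2 powr (real L * \<bar>s\<bar>) * 2 powr (- (real_of_int j * s)))))"
        by (rule sum_mono, rule mult_left_mono[OF ennreal_leI[OF le]]) auto
      also have "\<dots> = of_nat (2 * L + 1) * (ennreal C1 * ennreal (A * (2 powr (real L * \<bar>s\<bar>) * 2 powr (- (real_of_int j * s)))))"
        by (simp only: sum_constant card)
      finally have "16 ^ card (?K j) * (\<Sum>k\<in>?K j. ennreal C1 * ennreal (A * 2 powr (- (real_of_int k * s)))) \<le>
          16 ^ (2 * L + 1) * (of_nat (2 * L + 1) * (ennreal C1 * ennreal (A * (2 powr (real L * \<bar>s\<bar>) * 2 powr (- (real_of_int j * s))))))"
        unfolding card by (intro mult_left_mono) auto
      also have "\<dots> = ennreal (E * 2 powr (- (real_of_int j * s)))"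
      proof -
        have "(16::ennreal) ^ (2 * L + 1) = ennreal (16 ^ (2 * L + 1))"
          by (simp only: ennreal_power[symmetric] ennreal_numeral)
        then show ?thesis
          using C1 A unfolding E_def by (simp only: ennreal_of_nat_eq_real_of_nat ennreal_mult'[symmetric] mult_nonneg_nonneg powr_ge_zero of_nat_0_le_iff zero_le_power zero_le_numeral mult.assoc)
      qed
      finally show ?thesis .
    qed
    then have "trep_bounded r p (\<lambda>\<eta> \<zeta>. \<Sum>k\<in>?K j. lp_block \<phi> k (V \<eta>) (\<lambda>y. LINT x|lborel. H (y - x) * \<zeta> x))
        (ennreal (E * 2 powr (- (real_of_int j * s))))"
      using sum unfolding trep_bounded_def by (meson order_trans)
    then show ?thesis
    proof (rule trep_bounded_cong)
      fix \<eta> and \<zeta> :: "'a \<Rightarrow> complex" assume "\<eta> \<in> D_test {0<..}" and \<zeta>: "\<zeta> \<in> schwartz"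
      then have "V \<eta> \<in> Z_dual" using VZ by (simp add: Z_distributions_def)
      from lp_block_dilated_partition[OF \<phi> a L this \<zeta>, of j]
      show "lp_block (\<lambda>\<xi>. \<phi> (a *\<^sub>R \<xi>)) j (V \<eta>) \<zeta> =
          (\<Sum>k\<in>?K j. lp_block \<phi> k (V \<eta>) (\<lambda>y. LINT x|lborel. H (y - x) * \<zeta> x))"
        unfolding conv[OF \<zeta>] m_def lam_def \<phi>'_def by simp
    qed
  qed
  have "ennreal (2 powr (real_of_int j * s)) * distr_LrLp_norm {0<..} r (ennreal p) (\<lambda>\<eta>. lp_block \<phi> j (tdilate c a b V \<eta>)) \<le>
      ennreal (C2 * E)" for j
  proof -
    have "(\<lambda>\<eta>. lp_block \<phi> j (tdilate c a b V \<eta>)) = tdilate c a b (\<lambda>\<eta>. lp_block (\<lambda>\<xi>. \<phi> (a *\<^sub>R \<xi>)) j (V \<eta>))"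
      by (simp only: tdilate_eq_dilate lp_block_dilate[OF a])
    then have "trep_bounded r p (\<lambda>\<eta>. lp_block \<phi> j (tdilate c a b V \<eta>)) (ennreal C2 * ennreal (E * 2 powr (- (real_of_int j * s))))"
      using C2(2)[OF block[of j]] by simp
    then have "distr_LrLp_norm {0<..} r (ennreal p) (\<lambda>\<eta>. lp_block \<phi> j (tdilate c a b V \<eta>)) \<le>
        ennreal C2 * ennreal (E * 2 powr (- (real_of_int j * s)))"
      unfolding trep_bounded_def distr_LrLp_norm_def mixed_norm_def by (blast intro: Inf_lower order_trans)
    then have "ennreal (2 powr (real_of_int j * s)) * distr_LrLp_norm {0<..} r (ennreal p) (\<lambda>\<eta>. lp_block \<phi> j (tdilate c a b V \<eta>)) \<le>
        ennreal (2 powr (real_of_int j * s)) * (ennreal C2 * ennreal (E * 2 powr (- (real_of_int j * s))))"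
      by (rule mult_left_mono) simp
    \<comment> \<open>The weight \<open>2 powr (real_of_int j * s)\<close> cancels against its
      inverse in the block bound, leaving a constant independent of \<open>j\<close>.\<close>
    also have "\<dots> = ennreal (C2 * E)"
      using C2(1) E by (simp add: powr_minus flip: ennreal_mult)
    finally show ?thesis .
  qed
  then have "chemin_lerner_norm \<phi> \<infinity> r s (ennreal p) (tdilate c a b V) \<le> ennreal (C2 * E)"
    unfolding chemin_lerner_norm_def time_interval_infinity by (intro SUP_least)
  then have "chemin_lerner_norm \<phi> \<infinity> r s (ennreal p) (tdilate c a b V) < \<infinity>"
    by (rule le_less_trans) simp
  then show ?thesis
    using tdilate_Z_distributions[OF VZ a b] by (simp add: chemin_lerner_def)
qed

section \<open>Self-similarity\<close>

lemma global_solutions_tdilate: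
  fixes v0 w0 :: "'a::euclidean_space distr"
  assumes \<phi>: "dyadic_partition (3/4) (8/3) \<phi>" and n: "2 \<le> DIM('a)" and p: "1 \<le> p" and a: "0 < a"
    and v0: "v0 = dilate (a\<^sup>2) a v0" and w0: "w0 = dilate (a\<^sup>2) a w0"
    and VW: "(V, W) \<in> global_solutions \<phi> p v0 w0"
  shows "(tdilate (a\<^sup>2) a (a\<^sup>2) V, tdilate (a\<^sup>2) a (a\<^sup>2) W) \<in> global_solutions \<phi> p v0 w0"
proof -
  have a2: "0 < a\<^sup>2" using a by simp
  have cls: "tdilate (a\<^sup>2) a (a\<^sup>2) U \<in> solution_class \<phi> p" if "U \<in> solution_class \<phi> p" for U
    unfolding solution_class_def
  proof (rule INT_I)
    fix r :: ennreal assume r: "r \<in> {r. 1 < r \<and> r \<le> \<infinity>}"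
    then have "U \<in> chemin_lerner \<phi> \<infinity> r (- 2 + real DIM('a) / p + enn2real (2 / r)) (ennreal p)"
      using that unfolding solution_class_def by (rule INT_D[rotated])
    then show "tdilate (a\<^sup>2) a (a\<^sup>2) U \<in> chemin_lerner \<phi> \<infinity> r (- 2 + real DIM('a) / p + enn2real (2 / r)) (ennreal p)"
      using r by (intro tdilate_chemin_lerner \<phi> p a a2) auto
  qed
  obtain v w where vw: "time_slices V v" "time_slices W w" "duhamel_system v0 w0 v w"
    and VW': "V \<in> solution_class \<phi> p" "W \<in> solution_class \<phi> p"
    using VW unfolding global_solutions_def by blast
  have "duhamel_system v0 w0 (\<lambda>t. dilate (a\<^sup>2) a (v (a\<^sup>2 * t))) (\<lambda>t. dilate (a\<^sup>2) a (w (a\<^sup>2 * t)))"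
    using vw by (intro duhamel_system_dilate a n v0 w0) (auto simp: time_slices_def)
  note sol = conjI[OF time_slices_tdilate[OF vw(1) a a2, of "a\<^sup>2"]
      conjI[OF time_slices_tdilate[OF vw(2) a a2, of "a\<^sup>2"] this]]
  show ?thesis
    unfolding global_solutions_def mem_Collect_eq case_prod_conv
    by (intro conjI cls VW') (rule exI, rule exI, rule sol)
qed

lemma Z_distributions_Z_dual: "U \<in> Z_distributions I \<Longrightarrow> \<eta> \<in> D_test I \<Longrightarrow> U \<eta> \<in> Z_dual"
  by (simp add: Z_distributions_def)

lemma Z_distributions_eq_0: "U \<in> Z_distributions I \<Longrightarrow> \<eta> \<notin> D_test I \<Longrightarrow> U \<eta> = (\<lambda>_. 0)"
  by (simp add: Z_distributions_def)

text \<open>The inverse Laplacian removes exactly the weight 2 of \<open>V\<close> and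
  \<open>W\<close>, so the potential has weight 0 and its dilation carries the constant 1.\<close>

lemma potential_tdilate:
  fixes V W :: "'a::euclidean_space tdistr"
  assumes n: "2 \<le> DIM('a)" and a: "0 < a" and V: "V \<in> Z_distributions {0<..}" and W: "W \<in> Z_distributions {0<..}"
  shows "potential (tdilate (a\<^sup>2) a (a\<^sup>2) V) (tdilate (a\<^sup>2) a (a\<^sup>2) W) = tdilate 1 a (a\<^sup>2) (potential V W)"
proof
  fix \<eta> :: "real \<Rightarrow> complex"
  define \<eta>' where "\<eta>' = (\<lambda>t. \<eta> (t / a\<^sup>2))"
  \<comment> \<open>If \<open>\<eta>'\<close> is not an admissible test function in time, both
    slices are the zero functional by the default value in \<open>Z_distributions\<close>.
    Homogeneity thus holds for every \<open>\<eta>\<close>, and the final identity is one of total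
    functions.\<close>
  have scalar: "W \<eta>' (\<lambda>x. k * \<zeta> x) - V \<eta>' (\<lambda>x. k * \<zeta> x) = k * (W \<eta>' \<zeta> - V \<eta>' \<zeta>)" if "k \<noteq> 0" for k \<zeta>
  proof (cases "\<eta>' \<in> D_test {0<..}")
    case True
    then show ?thesis using V W that by (intro diff_scalar Z_distributions_Z_dual)
  next
    case False
    then have "V \<eta>' = (\<lambda>_. 0)" "W \<eta>' = (\<lambda>_. 0)" using V W by (auto intro: Z_distributions_eq_0)
    then show ?thesis by simp
  qed
  have "potential (tdilate (a\<^sup>2) a (a\<^sup>2) V) (tdilate (a\<^sup>2) a (a\<^sup>2) W) \<eta> =
      inv_neg_laplace (dilate (a\<^sup>2 / a\<^sup>2) a (\<lambda>\<zeta>. W \<eta>' \<zeta> - V \<eta>' \<zeta>))"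
    unfolding potential_def tdilate_eq_dilate diff_dilate \<eta>'_def ..
  also have "\<dots> = dilate (a\<^sup>2 / a\<^sup>2 / a\<^sup>2) a (inv_neg_laplace (\<lambda>\<zeta>. W \<eta>' \<zeta> - V \<eta>' \<zeta>))"
    by (intro inv_neg_laplace_dilate a n scalar)
  finally show "potential (tdilate (a\<^sup>2) a (a\<^sup>2) V) (tdilate (a\<^sup>2) a (a\<^sup>2) W) \<eta> = tdilate 1 a (a\<^sup>2) (potential V W) \<eta>"
    using a by (simp add: potential_def tdilate_eq_dilate \<eta>'_def)
qed

lemma solution_class_Z_distributions:
  fixes V :: "'a::euclidean_space tdistr"
  assumes "V \<in> solution_class \<phi> p"
  shows "V \<in> Z_distributions {0<..}"
proof -
  have "V \<in> chemin_lerner \<phi> \<infinity> \<infinity> (- 2 + real DIM('a) / p + enn2real (2 / \<infinity>)) (ennreal p)"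
    using assms unfolding solution_class_def by (rule INT_D) simp
  then show ?thesis by (simp add: chemin_lerner_def)
qed

theorem corollary1p2:
  fixes \<psi> \<phi> :: "real ^ 'n \<Rightarrow> real"
    and p \<epsilon> :: real
    and v0 w0 :: "(real ^ 'n) distr"
    and V W :: "(real ^ 'n) tdistr"
  assumes "2 \<le> CARD('n)"
    and "real CARD('n) / 2 \<le> p" and "p < 2 * real CARD('n)"
    and "littlewood_paley \<psi> \<phi>"
    and "smallness_constant \<phi> p \<epsilon>"
    and "v0 \<in> data_space \<phi> p" and "w0 \<in> data_space \<phi> p"
    and "data_norm \<phi> p v0 w0 \<le> ennreal \<epsilon>"
    and "\<forall>\<mu>>0. v0 = dilate (\<mu>\<^sup>2) \<mu> v0" and "\<forall>\<mu>>0. w0 = dilate (\<mu>\<^sup>2) \<mu> w0"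
    and "(V, W) \<in> global_solutions \<phi> p v0 w0"
  shows "\<forall>\<mu>>0. V = tdilate (\<mu>\<^sup>2) \<mu> (\<mu>\<^sup>2) V \<and> W = tdilate (\<mu>\<^sup>2) \<mu> (\<mu>\<^sup>2) W \<and>
    potential V W = tdilate 1 \<mu> (\<mu>\<^sup>2) (potential V W)"
proof (intro allI impI)
  fix \<mu> :: real assume \<mu>: "0 < \<mu>"
  have n: "2 \<le> DIM(real ^ 'n)" using assms(1) by simp
  \<comment> \<open>The dimension is at least 2 and \<open>p\<close> is at least half of it;
    \<open>1 \<le> p\<close> is what the estimates for the \<open>L^p\<close> norms ask for.\<close>
  have p: "1 \<le> p" using assms(1,2) by simp
  have \<phi>: "dyadic_partition (3/4) (8/3) \<phi>" using assms(4) by (simp add: littlewood_paley_def)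
  let ?V = "tdilate (\<mu>\<^sup>2) \<mu> (\<mu>\<^sup>2) V" and ?W = "tdilate (\<mu>\<^sup>2) \<mu> (\<mu>\<^sup>2) W"
  have "(?V, ?W) \<in> global_solutions \<phi> p v0 w0"
    using assms(9-11) \<mu> by (intro global_solutions_tdilate \<phi> n p) auto
  moreover have "\<exists>!VW. VW \<in> global_solutions \<phi> p v0 w0"
    using assms(5-8) by (simp add: smallness_constant_def)
  ultimately have "(?V, ?W) = (V, W)"
    using assms(11) by (auto elim!: ex1E)
  then have eq: "?V = V" "?W = W" by simp_all
  have "V \<in> Z_distributions {0<..}" "W \<in> Z_distributions {0<..}"
    using assms(11) by (auto simp only: global_solutions_def mem_Collect_eq case_prod_conv intro: solution_class_Z_distributions)
  from potential_tdilate[OF n \<mu> this] eq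
  show "V = ?V \<and> W = ?W \<and> potential V W = tdilate 1 \<mu> (\<mu>\<^sup>2) (potential V W)" by simp
qed

end
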